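(* Let $X$ be a higher-order rewrite system, let $\mathcal{H}(X)$ be the free cartesian closed 2-category on $X$ and $\mathcal{R}(X)$ the rewriting 2-category of $X$ (both described in the context). There exists a cartesian closed 2-functor $\mathcal{H}(X)\to\mathcal{R}(X)$ which is the identity on objects, the identity on morphisms, and locally full (i.e., surjective on 2-cells between any two given parallel morphisms).
   Context: Types $\mathcal{L}_0(X_0)$ over a set $X_0$: $A,B::= x\mid 1\mid A\times B\mid B^A$. A 1-signature is a set $X_0$ of sorts and a set $X_1$ of operations each over a sequent $(A_1,\ldots,A_n\vdash A)$ of types. $\mathcal{L}_1(X)$: the 1-signature of simply-typed $\lambda$-terms (unit, products with pairing and projections $\pi,\pi'$, functions) over base types $X_0$ with term formers $c\langle M_1,\ldots,M_n\rangle$ for operations $c\in X_1$, modulo $\beta\eta$; $\mathcal{L}_1(X)_\parallel$ is the set of pairs of such terms over the same sequent. A 2-signature adds a set $X_2$ of rules with a map $a\colon X_2\to\mathcal{L}_1(X)_\parallel$; write $r\in X(G\vdash M,N\colon A)$ when $a(r)=(G\vdash M,N\colon A)$. A higher-order rewrite system is a 2-signature such that for every rule with $a(r)=(\Gamma\vdash M,N\colon A)$, $M$ is not a variable, $A$ is a sort, and every variable of $\Gamma$ occurs free in $M$. Reductions: judgements $\Gamma\vdash P\colon M\to N\colon A$ ($M,N$ terms modulo $\beta\eta$) generated by: rule application $r\langle P_1,\ldots,P_n\rangle\colon M[M_1,\ldots,M_n]\to N[N_1,\ldots,N_n]$ for $r\in X(G\vdash M,N\colon A)$ and $P_i\colon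 M_i\to N_i\colon G_i$; vertical composition $P;_{M_2}Q\colon M_1\to M_3$ for $P\colon M_1\to M_2$, $Q\colon M_2\to M_3$; and the term constructors lifted to reductions: variables $x\colon x\to x$, $()\colon()\to()$, $c\langle P_1,\ldots,P_n\rangle$, $\lambda x{:}A.P$, application $PQ\colon MN\to M'N'$, pairing $(P,Q)$, projections $\pi P,\pi' P$. Every term $M$ thus gives a reduction $M\colon M\to M$. For a tuple $\Gamma\vdash Q\colon N\to N'\colon\Delta$ and $\Delta\vdash P\colon M\to M'\colon A$, substitution is $P[Q]=P[N];_{M'[N]}M'[Q]$, where $M'[Q]$ replaces each variable $x_i$ by $Q_i$ in the term $M'$ and $P[N]$ substitutes the terms $N_i$ for the variables in $P$ (both structurally through all constructors). Permutation equivalence $\equiv$ is the least congruence (w.r.t. all reduction constructors) on reductions of equal type containing: associativity of $;$ and $M;P\equiv P\equiv P;N$ for $P\colon M\to N$; $(\lambda x.P)Q\equiv P[Q/x]$, $P\equiv\lambda x.(Px)$ ($x$ fresh), $\pi(P,Q)\equiv P$, $\pi'(P,Q)\equiv Q$, $P\equiv(\pi P,\pi'P)$, $P\equiv()$ at type $1$; for $r\in X(\Gamma\vdash M_1,M_2\colon A)$ and tuples $P\colon N_1\to N_2$, $Q\colon N_2\to N_3$: $r\langle P;Q\rangle\equiv M_1[P];r\langle Q\rangle$ and $r\langle P;Q\rangle\equiv r\langle P\rangle;M_2[Q]$; and each of $c\langle-\rangle$, $\lambda x$, application, pairing, $\pi$, $\pi'$ commutes with $;$ componentwise (e.g. $(P;P')(Q;Q')\equiv(PQ);(P'Q')$).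 $\mathcal{H}(X)$ is the cartesian closed 2-category with objects the types in $\mathcal{L}_0(X_0)$, morphisms $A\to B$ the terms $x\colon A\vdash M\colon B$ modulo $\beta\eta$ (composition by substitution, identities variables), 2-cells $M\Rightarrow N$ the $\equiv$-classes of reductions $x\colon A\vdash P\colon M\to N\colon B$ (vertical composition $;$, horizontal composition by substitution of reductions), with products, terminal object and exponentials given by the type formers. $\mathcal{R}(X)$ has the same objects and morphisms and exactly one 2-cell $M\Rightarrow N$ when $M\to^*N$ in the usual (Nipkow) sense, i.e. in the reflexive-transitive closure of the relation $L[\vec M/\vec x]\to R[\vec M/\vec x]$ for rules with $a(r)=(\vec x\colon G\vdash L,R\colon A)$, closed under all term constructors, and none otherwise. A cartesian closed 2-functor is a 2-functor strictly preserving the chosen terminal object, products, projections, exponentials and evaluation morphisms. *)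

theory Defs
  imports Main
begin

section \<open>Signatures and simply typed terms\<close>

datatype 's ty = Base 's | One | Prod "'s ty" "'s ty" | Fun "'s ty" "'s ty"
  \<comment> \<open>\<open>Fun A B\<close> is the exponential written $B^A$.\<close>

text \<open>
  Raw terms are in de Bruijn form: in a context \<open>\<Gamma>\<close> (a list of types) the variable \<open>Var i\<close>
  has type \<open>\<Gamma> ! i\<close>, and a binder pushes its variable to the front of the context.
\<close>

datatype ('s, 'o) tm =
    Var nat
  | Star
  | Op 'o "('s, 'o) tm list"
  | Lam "'s ty" "('s, 'o) tm"
  | App "('s, 'o) tm" "('s, 'o) tm"
  | Tup "('s, 'o) tm" "('s, 'o) tm"
  | Fst "('s, 'o) tm"
  | Snd "('s, 'o) tm"

record ('s, 'o) one_sig =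
  sorts :: "'s set"
  ops :: "'o set"
  op_dom :: "'o \<Rightarrow> 's ty list"
  op_cod :: "'o \<Rightarrow> 's ty"

text \<open>
  The sides of a rule are terms modulo \<open>\<beta>\<eta>\<close>, hence sets of raw terms
  (\<open>two_signature\<close> below requires them to be \<open>\<beta>\<eta>\<close>-classes).
\<close>

record ('s, 'o, 'r) two_sig = "('s, 'o) one_sig" +
  rules :: "'r set"
  rule_ctx :: "'r \<Rightarrow> 's ty list"
  rule_lhs :: "'r \<Rightarrow> ('s, 'o) tm set"
  rule_rhs :: "'r \<Rightarrow> ('s, 'o) tm set"
  rule_ty :: "'r \<Rightarrow> 's ty"

definition types :: "('s, 'o, 'z) one_sig_scheme \<Rightarrow> 's ty set" where
  "types X = {A. set_ty A \<subseteq> sorts X}"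

subsection \<open>Substitution and free variables\<close>

primrec up_ren :: "(nat \<Rightarrow> nat) \<Rightarrow> nat \<Rightarrow> nat" where
  "up_ren \<xi> 0 = 0"
| "up_ren \<xi> (Suc i) = Suc (\<xi> i)"

primrec ren :: "(nat \<Rightarrow> nat) \<Rightarrow> ('s, 'o) tm \<Rightarrow> ('s, 'o) tm" where
  "ren \<xi> (Var i) = Var (\<xi> i)"
| "ren \<xi> Star = Star"
| "ren \<xi> (Op c Ms) = Op c (map (ren \<xi>) Ms)"
| "ren \<xi> (Lam A M) = Lam A (ren (up_ren \<xi>) M)"
| "ren \<xi> (App M N) = App (ren \<xi> M) (ren \<xi> N)"
| "ren \<xi> (Tup M N) = Tup (ren \<xi> M) (ren \<xi> N)"
| "ren \<xi> (Fst M) = Fst (ren \<xi> M)"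
| "ren \<xi> (Snd M) = Snd (ren \<xi> M)"

primrec up :: "(nat \<Rightarrow> ('s, 'o) tm) \<Rightarrow> nat \<Rightarrow> ('s, 'o) tm" where
  "up \<sigma> 0 = Var 0"
| "up \<sigma> (Suc i) = ren Suc (\<sigma> i)"

text \<open>
  Simultaneous substitution. The tuple substitution $M[M_1,\dots,M_n]$ is \<open>sub (nth Ms) M\<close>;
  the values of \<open>nth Ms\<close> beyond the length of \<open>Ms\<close> are irrelevant on terms typed in a
  context of that length.
\<close>

primrec sub :: "(nat \<Rightarrow> ('s, 'o) tm) \<Rightarrow> ('s, 'o) tm \<Rightarrow> ('s, 'o) tm" where
  "sub \<sigma> (Var i) = \<sigma> i"
| "sub \<sigma> Star = Star"
| "sub \<sigma> (Op c Ms) = Op c (map (sub \<sigma>) Ms)"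
| "sub \<sigma> (Lam A M) = Lam A (sub (up \<sigma>) M)"
| "sub \<sigma> (App M N) = App (sub \<sigma> M) (sub \<sigma> N)"
| "sub \<sigma> (Tup M N) = Tup (sub \<sigma> M) (sub \<sigma> N)"
| "sub \<sigma> (Fst M) = Fst (sub \<sigma> M)"
| "sub \<sigma> (Snd M) = Snd (sub \<sigma> M)"

primrec fv :: "('s, 'o) tm \<Rightarrow> nat set" where
  "fv (Var i) = {i}"
| "fv Star = {}"
| "fv (Op c Ms) = \<Union> (set (map fv Ms))"
| "fv (Lam A M) = {i. Suc i \<in> fv M}"
| "fv (App M N) = fv M \<union> fv N"
| "fv (Tup M N) = fv M \<union> fv N"
| "fv (Fst M) = fv M"
| "fv (Snd M) = fv M"

subsection \<open>Typing and \<open>\<beta>\<eta>\<close>-conversion\<close>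

inductive has_type ::
  "('s, 'o, 'z) one_sig_scheme \<Rightarrow> 's ty list \<Rightarrow> ('s, 'o) tm \<Rightarrow> 's ty \<Rightarrow> bool"
  for X where
  ty_Var: "i < length \<Gamma> \<Longrightarrow> has_type X \<Gamma> (Var i) (\<Gamma> ! i)"
| ty_Star: "has_type X \<Gamma> Star One"
| ty_Op: "\<lbrakk>c \<in> ops X; length Ms = length (op_dom X c);
    \<forall>i < length (op_dom X c). has_type X \<Gamma> (Ms ! i) (op_dom X c ! i)\<rbrakk>
    \<Longrightarrow> has_type X \<Gamma> (Op c Ms) (op_cod X c)"
| ty_Lam: "\<lbrakk>A \<in> types X; has_type X (A # \<Gamma>) M B\<rbrakk> \<Longrightarrow> has_type X \<Gamma> (Lam A M) (Fun A B)"
| ty_App: "\<lbrakk>has_type X \<Gamma> M (Fun A B); has_type X \<Gamma> N A\<rbrakk> \<Longrightarrow> has_type X \<Gamma> (App M N) B"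
| ty_Tup: "\<lbrakk>has_type X \<Gamma> M A; has_type X \<Gamma> N B\<rbrakk> \<Longrightarrow> has_type X \<Gamma> (Tup M N) (Prod A B)"
| ty_Fst: "has_type X \<Gamma> M (Prod A B) \<Longrightarrow> has_type X \<Gamma> (Fst M) A"
| ty_Snd: "has_type X \<Gamma> M (Prod A B) \<Longrightarrow> has_type X \<Gamma> (Snd M) B"

text \<open>The premise \<open>A \<in> types X\<close> of \<open>cv_eta\<close> is automatic for contexts over \<open>types X\<close>.\<close>

inductive conv ::
  "('s, 'o, 'z) one_sig_scheme \<Rightarrow> 's ty list \<Rightarrow> ('s, 'o) tm \<Rightarrow> ('s, 'o) tm \<Rightarrow> 's ty \<Rightarrow> bool"
  for X where
  cv_refl: "has_type X \<Gamma> M A \<Longrightarrow> conv X \<Gamma> M M A"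
| cv_sym: "conv X \<Gamma> M N A \<Longrightarrow> conv X \<Gamma> N M A"
| cv_trans: "\<lbrakk>conv X \<Gamma> M N A; conv X \<Gamma> N K A\<rbrakk> \<Longrightarrow> conv X \<Gamma> M K A"
| cv_Op: "\<lbrakk>c \<in> ops X; length Ms = length (op_dom X c); length Ns = length (op_dom X c);
    \<forall>i < length (op_dom X c). conv X \<Gamma> (Ms ! i) (Ns ! i) (op_dom X c ! i)\<rbrakk>
    \<Longrightarrow> conv X \<Gamma> (Op c Ms) (Op c Ns) (op_cod X c)"
| cv_Lam: "\<lbrakk>A \<in> types X; conv X (A # \<Gamma>) M N B\<rbrakk> \<Longrightarrow> conv X \<Gamma> (Lam A M) (Lam A N) (Fun A B)"
| cv_App: "\<lbrakk>conv X \<Gamma> M M' (Fun A B); conv X \<Gamma> N N' A\<rbrakk> \<Longrightarrow> conv X \<Gamma> (App M N) (App M' N') B"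
| cv_Tup: "\<lbrakk>conv X \<Gamma> M M' A; conv X \<Gamma> N N' B\<rbrakk> \<Longrightarrow> conv X \<Gamma> (Tup M N) (Tup M' N') (Prod A B)"
| cv_Fst: "conv X \<Gamma> M M' (Prod A B) \<Longrightarrow> conv X \<Gamma> (Fst M) (Fst M') A"
| cv_Snd: "conv X \<Gamma> M M' (Prod A B) \<Longrightarrow> conv X \<Gamma> (Snd M) (Snd M') B"
| cv_beta: "\<lbrakk>A \<in> types X; has_type X (A # \<Gamma>) M B; has_type X \<Gamma> N A\<rbrakk>
    \<Longrightarrow> conv X \<Gamma> (App (Lam A M) N) (sub (case_nat N Var) M) B"
| cv_eta: "\<lbrakk>A \<in> types X; has_type X \<Gamma> M (Fun A B)\<rbrakk>
    \<Longrightarrow> conv X \<Gamma> M (Lam A (App (ren Suc M) (Var 0))) (Fun A B)"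
| cv_fst: "\<lbrakk>has_type X \<Gamma> M A; has_type X \<Gamma> N B\<rbrakk> \<Longrightarrow> conv X \<Gamma> (Fst (Tup M N)) M A"
| cv_snd: "\<lbrakk>has_type X \<Gamma> M A; has_type X \<Gamma> N B\<rbrakk> \<Longrightarrow> conv X \<Gamma> (Snd (Tup M N)) N B"
| cv_tup: "has_type X \<Gamma> M (Prod A B) \<Longrightarrow> conv X \<Gamma> M (Tup (Fst M) (Snd M)) (Prod A B)"
| cv_star: "has_type X \<Gamma> M One \<Longrightarrow> conv X \<Gamma> M Star One"

definition conv_rel ::
  "('s, 'o, 'z) one_sig_scheme \<Rightarrow> 's ty list \<Rightarrow> 's ty \<Rightarrow> (('s, 'o) tm \<times> ('s, 'o) tm) set" where
  "conv_rel X \<Gamma> A = {(M, N). conv X \<Gamma> M N A}"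

definition terms ::
  "('s, 'o, 'z) one_sig_scheme \<Rightarrow> 's ty list \<Rightarrow> 's ty \<Rightarrow> ('s, 'o) tm set set" where
  "terms X \<Gamma> A = {M. has_type X \<Gamma> M A} // conv_rel X \<Gamma> A"

subsection \<open>Well-formed signatures and higher-order rewrite systems\<close>

definition one_signature :: "('s, 'o, 'z) one_sig_scheme \<Rightarrow> bool" where
  "one_signature X \<longleftrightarrow>
    (\<forall>c \<in> ops X. set (op_dom X c) \<subseteq> types X \<and> op_cod X c \<in> types X)"

definition two_signature :: "('s, 'o, 'r) two_sig \<Rightarrow> bool" where
  "two_signature X \<longleftrightarrow> one_signature X \<and>
    (\<forall>r \<in> rules X. set (rule_ctx X r) \<subseteq> types X \<and> rule_ty X r \<in> types X \<and>
      rule_lhs X r \<in> terms X (rule_ctx X r) (rule_ty X r) \<and>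
      rule_rhs X r \<in> terms X (rule_ctx X r) (rule_ty X r))"

text \<open>
  Free occurrence is not invariant under \<open>\<beta>\<eta>\<close>: a variable is taken to occur free in a term
  modulo \<open>\<beta>\<eta>\<close> when it occurs free in each of its representatives (every class has
  representatives with spurious occurrences, such as \<open>(\<lambda>y. M) x\<close>).
\<close>

definition hors :: "('s, 'o, 'r) two_sig \<Rightarrow> bool" where
  "hors X \<longleftrightarrow> two_signature X \<and>
    (\<forall>r \<in> rules X.
      (\<forall>i. Var i \<notin> rule_lhs X r) \<and>
      (\<exists>s \<in> sorts X. rule_ty X r = Base s) \<and>
      (\<forall>i < length (rule_ctx X r). \<forall>M \<in> rule_lhs X r. i \<in> fv M))"

section \<open>Reductions and permutation equivalence\<close>

text \<open>\<open>RComp P M Q\<close> is the vertical composite \<open>P ;\<^sub>M Q\<close>.\<close>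

datatype ('s, 'o, 'r) rd =
    RVar nat
  | RStar
  | ROp 'o "('s, 'o, 'r) rd list"
  | RLam "'s ty" "('s, 'o, 'r) rd"
  | RApp "('s, 'o, 'r) rd" "('s, 'o, 'r) rd"
  | RTup "('s, 'o, 'r) rd" "('s, 'o, 'r) rd"
  | RFst "('s, 'o, 'r) rd"
  | RSnd "('s, 'o, 'r) rd"
  | RRule 'r "('s, 'o, 'r) rd list"
  | RComp "('s, 'o, 'r) rd" "('s, 'o) tm" "('s, 'o, 'r) rd"

primrec emb :: "('s, 'o) tm \<Rightarrow> ('s, 'o, 'r) rd" where
  "emb (Var i) = RVar i"
| "emb Star = RStar"
| "emb (Op c Ms) = ROp c (map emb Ms)"
| "emb (Lam A M) = RLam A (emb M)"
| "emb (App M N) = RApp (emb M) (emb N)"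
| "emb (Tup M N) = RTup (emb M) (emb N)"
| "emb (Fst M) = RFst (emb M)"
| "emb (Snd M) = RSnd (emb M)"

primrec rren :: "(nat \<Rightarrow> nat) \<Rightarrow> ('s, 'o, 'r) rd \<Rightarrow> ('s, 'o, 'r) rd" where
  "rren \<xi> (RVar i) = RVar (\<xi> i)"
| "rren \<xi> RStar = RStar"
| "rren \<xi> (ROp c Ps) = ROp c (map (rren \<xi>) Ps)"
| "rren \<xi> (RLam A P) = RLam A (rren (up_ren \<xi>) P)"
| "rren \<xi> (RApp P Q) = RApp (rren \<xi> P) (rren \<xi> Q)"
| "rren \<xi> (RTup P Q) = RTup (rren \<xi> P) (rren \<xi> Q)"
| "rren \<xi> (RFst P) = RFst (rren \<xi> P)"
| "rren \<xi> (RSnd P) = RSnd (rren \<xi> P)"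
| "rren \<xi> (RRule r Ps) = RRule r (map (rren \<xi>) Ps)"
| "rren \<xi> (RComp P M Q) = RComp (rren \<xi> P) (ren \<xi> M) (rren \<xi> Q)"

text \<open>\<open>rsub \<sigma> P\<close> is $P[N]$: terms for the variables of a reduction.\<close>

primrec rsub :: "(nat \<Rightarrow> ('s, 'o) tm) \<Rightarrow> ('s, 'o, 'r) rd \<Rightarrow> ('s, 'o, 'r) rd" where
  "rsub \<sigma> (RVar i) = emb (\<sigma> i)"
| "rsub \<sigma> RStar = RStar"
| "rsub \<sigma> (ROp c Ps) = ROp c (map (rsub \<sigma>) Ps)"
| "rsub \<sigma> (RLam A P) = RLam A (rsub (up \<sigma>) P)"
| "rsub \<sigma> (RApp P Q) = RApp (rsub \<sigma> P) (rsub \<sigma> Q)"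
| "rsub \<sigma> (RTup P Q) = RTup (rsub \<sigma> P) (rsub \<sigma> Q)"
| "rsub \<sigma> (RFst P) = RFst (rsub \<sigma> P)"
| "rsub \<sigma> (RSnd P) = RSnd (rsub \<sigma> P)"
| "rsub \<sigma> (RRule r Ps) = RRule r (map (rsub \<sigma>) Ps)"
| "rsub \<sigma> (RComp P M Q) = RComp (rsub \<sigma> P) (sub \<sigma> M) (rsub \<sigma> Q)"

primrec rup :: "(nat \<Rightarrow> ('s, 'o, 'r) rd) \<Rightarrow> nat \<Rightarrow> ('s, 'o, 'r) rd" where
  "rup \<tau> 0 = RVar 0"
| "rup \<tau> (Suc i) = rren Suc (\<tau> i)"

text \<open>\<open>lsub \<tau> M\<close> is $M[Q]$: reductions for the variables of a term.\<close>

primrec lsub :: "(nat \<Rightarrow> ('s, 'o, 'r) rd) \<Rightarrow> ('s, 'o) tm \<Rightarrow> ('s, 'o, 'r) rd" where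
  "lsub \<tau> (Var i) = \<tau> i"
| "lsub \<tau> Star = RStar"
| "lsub \<tau> (Op c Ms) = ROp c (map (lsub \<tau>) Ms)"
| "lsub \<tau> (Lam A M) = RLam A (lsub (rup \<tau>) M)"
| "lsub \<tau> (App M N) = RApp (lsub \<tau> M) (lsub \<tau> N)"
| "lsub \<tau> (Tup M N) = RTup (lsub \<tau> M) (lsub \<tau> N)"
| "lsub \<tau> (Fst M) = RFst (lsub \<tau> M)"
| "lsub \<tau> (Snd M) = RSnd (lsub \<tau> M)"

text \<open>
  The substitution $P[Q] = P[N] ;_{M'[N]} M'[Q]$ depends on the target \<open>M'\<close> of \<open>P\<close> and on
  the source of \<open>Q\<close>; these are arguments here (\<open>\<sigma>\<close> the source of the tuple \<open>\<tau>\<close>).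
\<close>

definition hsub ::
  "('s, 'o, 'r) rd \<Rightarrow> ('s, 'o) tm \<Rightarrow> (nat \<Rightarrow> ('s, 'o) tm) \<Rightarrow> (nat \<Rightarrow> ('s, 'o, 'r) rd) \<Rightarrow> ('s, 'o, 'r) rd"
  where "hsub P M' \<sigma> \<tau> = RComp (rsub \<sigma> P) (sub \<sigma> M') (lsub \<tau> M')"

definition vcomps ::
  "('s, 'o, 'r) rd list \<Rightarrow> ('s, 'o) tm list \<Rightarrow> ('s, 'o, 'r) rd list \<Rightarrow> ('s, 'o, 'r) rd list" where
  "vcomps Ps Ns Qs = map (\<lambda>i. RComp (Ps ! i) (Ns ! i) (Qs ! i)) [0..<length Ps]"

text \<open>
  \<open>red X \<Gamma> P M N A\<close> is the judgement $\Gamma \vdash P : M \to N : A$. The rule \<open>rd_conv\<close> expresses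
  that sources and targets are terms modulo \<open>\<beta>\<eta>\<close>.
\<close>

inductive red ::
  "('s, 'o, 'r) two_sig \<Rightarrow> 's ty list \<Rightarrow> ('s, 'o, 'r) rd \<Rightarrow>
    ('s, 'o) tm \<Rightarrow> ('s, 'o) tm \<Rightarrow> 's ty \<Rightarrow> bool"
  for X where
  rd_Var: "i < length \<Gamma> \<Longrightarrow> red X \<Gamma> (RVar i) (Var i) (Var i) (\<Gamma> ! i)"
| rd_Star: "red X \<Gamma> RStar Star Star One"
| rd_Op: "\<lbrakk>c \<in> ops X; length Ps = length (op_dom X c);
    length Ms = length (op_dom X c); length Ns = length (op_dom X c);
    \<forall>i < length (op_dom X c). red X \<Gamma> (Ps ! i) (Ms ! i) (Ns ! i) (op_dom X c ! i)\<rbrakk>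
    \<Longrightarrow> red X \<Gamma> (ROp c Ps) (Op c Ms) (Op c Ns) (op_cod X c)"
| rd_Lam: "\<lbrakk>A \<in> types X; red X (A # \<Gamma>) P M N B\<rbrakk>
    \<Longrightarrow> red X \<Gamma> (RLam A P) (Lam A M) (Lam A N) (Fun A B)"
| rd_App: "\<lbrakk>red X \<Gamma> P M M' (Fun A B); red X \<Gamma> Q N N' A\<rbrakk>
    \<Longrightarrow> red X \<Gamma> (RApp P Q) (App M N) (App M' N') B"
| rd_Tup: "\<lbrakk>red X \<Gamma> P M M' A; red X \<Gamma> Q N N' B\<rbrakk>
    \<Longrightarrow> red X \<Gamma> (RTup P Q) (Tup M N) (Tup M' N') (Prod A B)"
| rd_Fst: "red X \<Gamma> P M M' (Prod A B) \<Longrightarrow> red X \<Gamma> (RFst P) (Fst M) (Fst M') A"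
| rd_Snd: "red X \<Gamma> P M M' (Prod A B) \<Longrightarrow> red X \<Gamma> (RSnd P) (Snd M) (Snd M') B"
| rd_Rule: "\<lbrakk>r \<in> rules X; L \<in> rule_lhs X r; R \<in> rule_rhs X r;
    length Ps = length (rule_ctx X r);
    length Ms = length (rule_ctx X r); length Ns = length (rule_ctx X r);
    \<forall>i < length (rule_ctx X r). red X \<Gamma> (Ps ! i) (Ms ! i) (Ns ! i) (rule_ctx X r ! i)\<rbrakk>
    \<Longrightarrow> red X \<Gamma> (RRule r Ps) (sub (nth Ms) L) (sub (nth Ns) R) (rule_ty X r)"
| rd_Comp: "\<lbrakk>red X \<Gamma> P M1 M2 A; red X \<Gamma> Q M2 M3 A\<rbrakk> \<Longrightarrow> red X \<Gamma> (RComp P M2 Q) M1 M3 A"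
| rd_conv: "\<lbrakk>red X \<Gamma> P M N A; conv X \<Gamma> M M' A; conv X \<Gamma> N N' A\<rbrakk> \<Longrightarrow> red X \<Gamma> P M' N' A"

text \<open>
  \<open>perm X \<Gamma> P Q M N A\<close> states that \<open>P\<close> and \<open>Q\<close>, both reductions \<open>M \<rightarrow> N\<close> of type \<open>A\<close> in \<open>\<Gamma>\<close>,
  are permutation equivalent. The annotation of a composite is a term modulo \<open>\<beta>\<eta>\<close>, whence
  the form of \<open>pm_Comp\<close>.
\<close>

inductive perm ::
  "('s, 'o, 'r) two_sig \<Rightarrow> 's ty list \<Rightarrow> ('s, 'o, 'r) rd \<Rightarrow> ('s, 'o, 'r) rd \<Rightarrow>
    ('s, 'o) tm \<Rightarrow> ('s, 'o) tm \<Rightarrow> 's ty \<Rightarrow> bool"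
  for X where
  pm_refl: "red X \<Gamma> P M N A \<Longrightarrow> perm X \<Gamma> P P M N A"
| pm_sym: "perm X \<Gamma> P Q M N A \<Longrightarrow> perm X \<Gamma> Q P M N A"
| pm_trans: "\<lbrakk>perm X \<Gamma> P Q M N A; perm X \<Gamma> Q R M N A\<rbrakk> \<Longrightarrow> perm X \<Gamma> P R M N A"
| pm_conv: "\<lbrakk>perm X \<Gamma> P Q M N A; conv X \<Gamma> M M' A; conv X \<Gamma> N N' A\<rbrakk> \<Longrightarrow> perm X \<Gamma> P Q M' N' A"
  \<comment> \<open>congruence\<close>
| pm_Op: "\<lbrakk>c \<in> ops X; length Ps = length (op_dom X c); length Qs = length (op_dom X c);
    length Ms = length (op_dom X c); length Ns = length (op_dom X c);
    \<forall>i < length (op_dom X c). perm X \<Gamma> (Ps ! i) (Qs ! i) (Ms ! i) (Ns ! i) (op_dom X c ! i)\<rbrakk>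
    \<Longrightarrow> perm X \<Gamma> (ROp c Ps) (ROp c Qs) (Op c Ms) (Op c Ns) (op_cod X c)"
| pm_Lam: "\<lbrakk>A \<in> types X; perm X (A # \<Gamma>) P Q M N B\<rbrakk>
    \<Longrightarrow> perm X \<Gamma> (RLam A P) (RLam A Q) (Lam A M) (Lam A N) (Fun A B)"
| pm_App: "\<lbrakk>perm X \<Gamma> P P' M M' (Fun A B); perm X \<Gamma> Q Q' N N' A\<rbrakk>
    \<Longrightarrow> perm X \<Gamma> (RApp P Q) (RApp P' Q') (App M N) (App M' N') B"
| pm_Tup: "\<lbrakk>perm X \<Gamma> P P' M M' A; perm X \<Gamma> Q Q' N N' B\<rbrakk>
    \<Longrightarrow> perm X \<Gamma> (RTup P Q) (RTup P' Q') (Tup M N) (Tup M' N') (Prod A B)"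
| pm_Fst: "perm X \<Gamma> P P' M M' (Prod A B) \<Longrightarrow> perm X \<Gamma> (RFst P) (RFst P') (Fst M) (Fst M') A"
| pm_Snd: "perm X \<Gamma> P P' M M' (Prod A B) \<Longrightarrow> perm X \<Gamma> (RSnd P) (RSnd P') (Snd M) (Snd M') B"
| pm_Rule: "\<lbrakk>r \<in> rules X; L \<in> rule_lhs X r; R \<in> rule_rhs X r;
    length Ps = length (rule_ctx X r); length Qs = length (rule_ctx X r);
    length Ms = length (rule_ctx X r); length Ns = length (rule_ctx X r);
    \<forall>i < length (rule_ctx X r). perm X \<Gamma> (Ps ! i) (Qs ! i) (Ms ! i) (Ns ! i) (rule_ctx X r ! i)\<rbrakk>
    \<Longrightarrow> perm X \<Gamma> (RRule r Ps) (RRule r Qs) (sub (nth Ms) L) (sub (nth Ns) R) (rule_ty X r)"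
| pm_Comp: "\<lbrakk>perm X \<Gamma> P P' M1 M2 A; perm X \<Gamma> Q Q' M2 M3 A; conv X \<Gamma> M2 M2' A\<rbrakk>
    \<Longrightarrow> perm X \<Gamma> (RComp P M2 Q) (RComp P' M2' Q') M1 M3 A"
  \<comment> \<open>category laws for vertical composition\<close>
| pm_assoc: "\<lbrakk>red X \<Gamma> P M1 M2 A; red X \<Gamma> Q M2 M3 A; red X \<Gamma> R M3 M4 A\<rbrakk>
    \<Longrightarrow> perm X \<Gamma> (RComp (RComp P M2 Q) M3 R) (RComp P M2 (RComp Q M3 R)) M1 M4 A"
| pm_idl: "red X \<Gamma> P M N A \<Longrightarrow> perm X \<Gamma> (RComp (emb M) M P) P M N A"
| pm_idr: "red X \<Gamma> P M N A \<Longrightarrow> perm X \<Gamma> (RComp P N (emb N)) P M N A"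
  \<comment> \<open>\<open>\<beta>\<close> and \<open>\<eta>\<close>\<close>
| pm_beta: "\<lbrakk>A \<in> types X; red X (A # \<Gamma>) P M M' B; red X \<Gamma> Q N N' A\<rbrakk>
    \<Longrightarrow> perm X \<Gamma> (RApp (RLam A P) Q) (hsub P M' (case_nat N Var) (case_nat Q RVar))
          (sub (case_nat N Var) M) (sub (case_nat N' Var) M') B"
| pm_eta: "\<lbrakk>A \<in> types X; red X \<Gamma> P M N (Fun A B)\<rbrakk>
    \<Longrightarrow> perm X \<Gamma> P (RLam A (RApp (rren Suc P) (RVar 0))) M N (Fun A B)"
| pm_fst: "\<lbrakk>red X \<Gamma> P M M' A; red X \<Gamma> Q N N' B\<rbrakk> \<Longrightarrow> perm X \<Gamma> (RFst (RTup P Q)) P M M' A"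
| pm_snd: "\<lbrakk>red X \<Gamma> P M M' A; red X \<Gamma> Q N N' B\<rbrakk> \<Longrightarrow> perm X \<Gamma> (RSnd (RTup P Q)) Q N N' B"
| pm_tup: "red X \<Gamma> P M N (Prod A B) \<Longrightarrow> perm X \<Gamma> P (RTup (RFst P) (RSnd P)) M N (Prod A B)"
| pm_star: "red X \<Gamma> P M N One \<Longrightarrow> perm X \<Gamma> P RStar M N One"
  \<comment> \<open>rules and vertical composition\<close>
| pm_rule_left: "\<lbrakk>r \<in> rules X; L \<in> rule_lhs X r; R \<in> rule_rhs X r;
    length Ps = length (rule_ctx X r); length Qs = length (rule_ctx X r);
    length Ns1 = length (rule_ctx X r); length Ns2 = length (rule_ctx X r);
    length Ns3 = length (rule_ctx X r);
    \<forall>i < length (rule_ctx X r). red X \<Gamma> (Ps ! i) (Ns1 ! i) (Ns2 ! i) (rule_ctx X r ! i);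
    \<forall>i < length (rule_ctx X r). red X \<Gamma> (Qs ! i) (Ns2 ! i) (Ns3 ! i) (rule_ctx X r ! i)\<rbrakk>
    \<Longrightarrow> perm X \<Gamma> (RRule r (vcomps Ps Ns2 Qs))
          (RComp (lsub (nth Ps) L) (sub (nth Ns2) L) (RRule r Qs))
          (sub (nth Ns1) L) (sub (nth Ns3) R) (rule_ty X r)"
| pm_rule_right: "\<lbrakk>r \<in> rules X; L \<in> rule_lhs X r; R \<in> rule_rhs X r;
    length Ps = length (rule_ctx X r); length Qs = length (rule_ctx X r);
    length Ns1 = length (rule_ctx X r); length Ns2 = length (rule_ctx X r);
    length Ns3 = length (rule_ctx X r);
    \<forall>i < length (rule_ctx X r). red X \<Gamma> (Ps ! i) (Ns1 ! i) (Ns2 ! i) (rule_ctx X r ! i);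
    \<forall>i < length (rule_ctx X r). red X \<Gamma> (Qs ! i) (Ns2 ! i) (Ns3 ! i) (rule_ctx X r ! i)\<rbrakk>
    \<Longrightarrow> perm X \<Gamma> (RRule r (vcomps Ps Ns2 Qs))
          (RComp (RRule r Ps) (sub (nth Ns2) R) (lsub (nth Qs) R))
          (sub (nth Ns1) L) (sub (nth Ns3) R) (rule_ty X r)"
  \<comment> \<open>term constructors and vertical composition\<close>
| pm_Op_Comp: "\<lbrakk>c \<in> ops X; length Ps = length (op_dom X c); length Qs = length (op_dom X c);
    length Ns1 = length (op_dom X c); length Ns2 = length (op_dom X c);
    length Ns3 = length (op_dom X c);
    \<forall>i < length (op_dom X c). red X \<Gamma> (Ps ! i) (Ns1 ! i) (Ns2 ! i) (op_dom X c ! i);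
    \<forall>i < length (op_dom X c). red X \<Gamma> (Qs ! i) (Ns2 ! i) (Ns3 ! i) (op_dom X c ! i)\<rbrakk>
    \<Longrightarrow> perm X \<Gamma> (ROp c (vcomps Ps Ns2 Qs)) (RComp (ROp c Ps) (Op c Ns2) (ROp c Qs))
          (Op c Ns1) (Op c Ns3) (op_cod X c)"
| pm_Lam_Comp: "\<lbrakk>A \<in> types X; red X (A # \<Gamma>) P M1 M2 B; red X (A # \<Gamma>) Q M2 M3 B\<rbrakk>
    \<Longrightarrow> perm X \<Gamma> (RLam A (RComp P M2 Q)) (RComp (RLam A P) (Lam A M2) (RLam A Q))
          (Lam A M1) (Lam A M3) (Fun A B)"
| pm_App_Comp: "\<lbrakk>red X \<Gamma> P M1 M2 (Fun A B); red X \<Gamma> P' M2 M3 (Fun A B);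
    red X \<Gamma> Q N1 N2 A; red X \<Gamma> Q' N2 N3 A\<rbrakk>
    \<Longrightarrow> perm X \<Gamma> (RApp (RComp P M2 P') (RComp Q N2 Q'))
          (RComp (RApp P Q) (App M2 N2) (RApp P' Q')) (App M1 N1) (App M3 N3) B"
| pm_Tup_Comp: "\<lbrakk>red X \<Gamma> P M1 M2 A; red X \<Gamma> P' M2 M3 A;
    red X \<Gamma> Q N1 N2 B; red X \<Gamma> Q' N2 N3 B\<rbrakk>
    \<Longrightarrow> perm X \<Gamma> (RTup (RComp P M2 P') (RComp Q N2 Q'))
          (RComp (RTup P Q) (Tup M2 N2) (RTup P' Q')) (Tup M1 N1) (Tup M3 N3) (Prod A B)"
| pm_Fst_Comp: "\<lbrakk>red X \<Gamma> P M1 M2 (Prod A B); red X \<Gamma> Q M2 M3 (Prod A B)\<rbrakk>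
    \<Longrightarrow> perm X \<Gamma> (RFst (RComp P M2 Q)) (RComp (RFst P) (Fst M2) (RFst Q)) (Fst M1) (Fst M3) A"
| pm_Snd_Comp: "\<lbrakk>red X \<Gamma> P M1 M2 (Prod A B); red X \<Gamma> Q M2 M3 (Prod A B)\<rbrakk>
    \<Longrightarrow> perm X \<Gamma> (RSnd (RComp P M2 Q)) (RComp (RSnd P) (Snd M2) (RSnd Q)) (Snd M1) (Snd M3) B"

definition perm_rel ::
  "('s, 'o, 'r) two_sig \<Rightarrow> 's ty list \<Rightarrow> ('s, 'o) tm \<Rightarrow> ('s, 'o) tm \<Rightarrow> 's ty \<Rightarrow>
    (('s, 'o, 'r) rd \<times> ('s, 'o, 'r) rd) set" where
  "perm_rel X \<Gamma> M N A = {(P, Q). perm X \<Gamma> P Q M N A}"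

section \<open>Rewriting\<close>

inductive rew ::
  "('s, 'o, 'r) two_sig \<Rightarrow> 's ty list \<Rightarrow> ('s, 'o) tm \<Rightarrow> ('s, 'o) tm \<Rightarrow> 's ty \<Rightarrow> bool"
  for X where
  rw_Rule: "\<lbrakk>r \<in> rules X; L \<in> rule_lhs X r; R \<in> rule_rhs X r; length Ms = length (rule_ctx X r);
    \<forall>i < length (rule_ctx X r). has_type X \<Gamma> (Ms ! i) (rule_ctx X r ! i)\<rbrakk>
    \<Longrightarrow> rew X \<Gamma> (sub (nth Ms) L) (sub (nth Ms) R) (rule_ty X r)"
| rw_Op: "\<lbrakk>c \<in> ops X; length Ms = length (op_dom X c);
    \<forall>i < length (op_dom X c). has_type X \<Gamma> (Ms ! i) (op_dom X c ! i);
    j < length (op_dom X c); rew X \<Gamma> (Ms ! j) N (op_dom X c ! j)\<rbrakk>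
    \<Longrightarrow> rew X \<Gamma> (Op c Ms) (Op c (Ms[j := N])) (op_cod X c)"
| rw_Lam: "\<lbrakk>A \<in> types X; rew X (A # \<Gamma>) M N B\<rbrakk> \<Longrightarrow> rew X \<Gamma> (Lam A M) (Lam A N) (Fun A B)"
| rw_App1: "\<lbrakk>rew X \<Gamma> M M' (Fun A B); has_type X \<Gamma> N A\<rbrakk> \<Longrightarrow> rew X \<Gamma> (App M N) (App M' N) B"
| rw_App2: "\<lbrakk>has_type X \<Gamma> M (Fun A B); rew X \<Gamma> N N' A\<rbrakk> \<Longrightarrow> rew X \<Gamma> (App M N) (App M N') B"
| rw_Tup1: "\<lbrakk>rew X \<Gamma> M M' A; has_type X \<Gamma> N B\<rbrakk> \<Longrightarrow> rew X \<Gamma> (Tup M N) (Tup M' N) (Prod A B)"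
| rw_Tup2: "\<lbrakk>has_type X \<Gamma> M A; rew X \<Gamma> N N' B\<rbrakk> \<Longrightarrow> rew X \<Gamma> (Tup M N) (Tup M N') (Prod A B)"
| rw_Fst: "rew X \<Gamma> M M' (Prod A B) \<Longrightarrow> rew X \<Gamma> (Fst M) (Fst M') A"
| rw_Snd: "rew X \<Gamma> M M' (Prod A B) \<Longrightarrow> rew X \<Gamma> (Snd M) (Snd M') B"
| rw_conv: "\<lbrakk>rew X \<Gamma> M N A; conv X \<Gamma> M M' A; conv X \<Gamma> N N' A\<rbrakk> \<Longrightarrow> rew X \<Gamma> M' N' A"

definition rew_rel ::
  "('s, 'o, 'r) two_sig \<Rightarrow> 's ty list \<Rightarrow> 's ty \<Rightarrow> (('s, 'o) tm set \<times> ('s, 'o) tm set) set" where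
  "rew_rel X \<Gamma> A = {(m, n). m \<in> terms X \<Gamma> A \<and> n \<in> terms X \<Gamma> A \<and>
    (\<exists>M \<in> m. \<exists>N \<in> n. rew X \<Gamma> M N A)}"

section \<open>Cartesian closed 2-categories and 2-functors\<close>

text \<open>
  \<open>cell C f g\<close> is the set of 2-cells between parallel morphisms. \<open>comp C g f\<close> and
  \<open>hcomp C \<beta> \<alpha>\<close> are in applicative order, \<open>vcomp C \<alpha> \<beta>\<close> is in diagrammatic order. The
  projections and \<open>expo\<close>, \<open>evl\<close> are the chosen cartesian closed structure:
  \<open>evl C A B\<close> goes from \<open>prd C (expo C A B) A\<close> to \<open>B\<close>.
\<close>

record ('a, 'm, 'c) cc2 =
  obj :: "'a set"
  hom :: "'a \<Rightarrow> 'a \<Rightarrow> 'm set"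
  cell :: "'m \<Rightarrow> 'm \<Rightarrow> 'c set"
  idm :: "'a \<Rightarrow> 'm"
  comp :: "'m \<Rightarrow> 'm \<Rightarrow> 'm"
  idc :: "'m \<Rightarrow> 'c"
  vcomp :: "'c \<Rightarrow> 'c \<Rightarrow> 'c"
  hcomp :: "'c \<Rightarrow> 'c \<Rightarrow> 'c"
  one :: "'a"
  prd :: "'a \<Rightarrow> 'a \<Rightarrow> 'a"
  prj1 :: "'a \<Rightarrow> 'a \<Rightarrow> 'm"
  prj2 :: "'a \<Rightarrow> 'a \<Rightarrow> 'm"
  expo :: "'a \<Rightarrow> 'a \<Rightarrow> 'a"
  evl :: "'a \<Rightarrow> 'a \<Rightarrow> 'm"

locale two_category =
  fixes C :: "('a, 'm, 'c) cc2"
  assumes idm_hom: "A \<in> obj C \<Longrightarrow> idm C A \<in> hom C A A"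
    and comp_hom: "\<lbrakk>A \<in> obj C; B \<in> obj C; D \<in> obj C; f \<in> hom C A B; g \<in> hom C B D\<rbrakk>
      \<Longrightarrow> comp C g f \<in> hom C A D"
    and comp_idl: "\<lbrakk>A \<in> obj C; B \<in> obj C; f \<in> hom C A B\<rbrakk> \<Longrightarrow> comp C (idm C B) f = f"
    and comp_idr: "\<lbrakk>A \<in> obj C; B \<in> obj C; f \<in> hom C A B\<rbrakk> \<Longrightarrow> comp C f (idm C A) = f"
    and comp_assoc: "\<lbrakk>A \<in> obj C; B \<in> obj C; D \<in> obj C; E \<in> obj C;
        f \<in> hom C A B; g \<in> hom C B D; h \<in> hom C D E\<rbrakk>
      \<Longrightarrow> comp C (comp C h g) f = comp C h (comp C g f)"
    and idc_cell: "\<lbrakk>A \<in> obj C; B \<in> obj C; f \<in> hom C A B\<rbrakk> \<Longrightarrow> idc C f \<in> cell C f f"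
    and vcomp_cell: "\<lbrakk>A \<in> obj C; B \<in> obj C; f \<in> hom C A B; g \<in> hom C A B; h \<in> hom C A B;
        \<alpha> \<in> cell C f g; \<beta> \<in> cell C g h\<rbrakk> \<Longrightarrow> vcomp C \<alpha> \<beta> \<in> cell C f h"
    and vcomp_idl: "\<lbrakk>A \<in> obj C; B \<in> obj C; f \<in> hom C A B; g \<in> hom C A B; \<alpha> \<in> cell C f g\<rbrakk>
      \<Longrightarrow> vcomp C (idc C f) \<alpha> = \<alpha>"
    and vcomp_idr: "\<lbrakk>A \<in> obj C; B \<in> obj C; f \<in> hom C A B; g \<in> hom C A B; \<alpha> \<in> cell C f g\<rbrakk>
      \<Longrightarrow> vcomp C \<alpha> (idc C g) = \<alpha>"
    and vcomp_assoc: "\<lbrakk>A \<in> obj C; B \<in> obj C;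
        f \<in> hom C A B; g \<in> hom C A B; h \<in> hom C A B; k \<in> hom C A B;
        \<alpha> \<in> cell C f g; \<beta> \<in> cell C g h; \<gamma> \<in> cell C h k\<rbrakk>
      \<Longrightarrow> vcomp C (vcomp C \<alpha> \<beta>) \<gamma> = vcomp C \<alpha> (vcomp C \<beta> \<gamma>)"
    and hcomp_cell: "\<lbrakk>A \<in> obj C; B \<in> obj C; D \<in> obj C;
        f \<in> hom C A B; f' \<in> hom C A B; g \<in> hom C B D; g' \<in> hom C B D;
        \<alpha> \<in> cell C f f'; \<beta> \<in> cell C g g'\<rbrakk>
      \<Longrightarrow> hcomp C \<beta> \<alpha> \<in> cell C (comp C g f) (comp C g' f')"
    and hcomp_idl: "\<lbrakk>A \<in> obj C; B \<in> obj C; f \<in> hom C A B; g \<in> hom C A B; \<alpha> \<in> cell C f g\<rbrakk>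
      \<Longrightarrow> hcomp C (idc C (idm C B)) \<alpha> = \<alpha>"
    and hcomp_idr: "\<lbrakk>A \<in> obj C; B \<in> obj C; f \<in> hom C A B; g \<in> hom C A B; \<alpha> \<in> cell C f g\<rbrakk>
      \<Longrightarrow> hcomp C \<alpha> (idc C (idm C A)) = \<alpha>"
    and hcomp_assoc: "\<lbrakk>A \<in> obj C; B \<in> obj C; D \<in> obj C; E \<in> obj C;
        f \<in> hom C A B; f' \<in> hom C A B; g \<in> hom C B D; g' \<in> hom C B D;
        h \<in> hom C D E; h' \<in> hom C D E;
        \<alpha> \<in> cell C f f'; \<beta> \<in> cell C g g'; \<gamma> \<in> cell C h h'\<rbrakk>
      \<Longrightarrow> hcomp C (hcomp C \<gamma> \<beta>) \<alpha> = hcomp C \<gamma> (hcomp C \<beta> \<alpha>)"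
    and hcomp_idc: "\<lbrakk>A \<in> obj C; B \<in> obj C; D \<in> obj C; f \<in> hom C A B; g \<in> hom C B D\<rbrakk>
      \<Longrightarrow> hcomp C (idc C g) (idc C f) = idc C (comp C g f)"
    and interchange: "\<lbrakk>A \<in> obj C; B \<in> obj C; D \<in> obj C;
        f \<in> hom C A B; f' \<in> hom C A B; f'' \<in> hom C A B;
        g \<in> hom C B D; g' \<in> hom C B D; g'' \<in> hom C B D;
        \<alpha> \<in> cell C f f'; \<alpha>' \<in> cell C f' f''; \<beta> \<in> cell C g g'; \<beta>' \<in> cell C g' g''\<rbrakk>
      \<Longrightarrow> hcomp C (vcomp C \<beta> \<beta>') (vcomp C \<alpha> \<alpha>') = vcomp C (hcomp C \<beta> \<alpha>) (hcomp C \<beta>' \<alpha>')"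

text \<open>
  \<open>h \<times> A\<close> and \<open>\<beta> \<times> A\<close> for a morphism \<open>h : Z \<rightarrow> W\<close> and a 2-cell \<open>\<beta> : h \<Rightarrow> h'\<close>, characterised by
  their projections.
\<close>

definition mtimes :: "('a, 'm, 'c) cc2 \<Rightarrow> 'a \<Rightarrow> 'a \<Rightarrow> 'm \<Rightarrow> 'a \<Rightarrow> 'm" where
  "mtimes C Z W h A = (THE k. k \<in> hom C (prd C Z A) (prd C W A) \<and>
     comp C (prj1 C W A) k = comp C h (prj1 C Z A) \<and> comp C (prj2 C W A) k = prj2 C Z A)"

definition ctimes :: "('a, 'm, 'c) cc2 \<Rightarrow> 'a \<Rightarrow> 'a \<Rightarrow> 'm \<Rightarrow> 'm \<Rightarrow> 'c \<Rightarrow> 'a \<Rightarrow> 'c" where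
  "ctimes C Z W h h' \<beta> A = (THE \<gamma>. \<gamma> \<in> cell C (mtimes C Z W h A) (mtimes C Z W h' A) \<and>
     hcomp C (idc C (prj1 C W A)) \<gamma> = hcomp C \<beta> (idc C (prj1 C Z A)) \<and>
     hcomp C (idc C (prj2 C W A)) \<gamma> = idc C (prj2 C Z A))"

text \<open>
  The universal properties are 2-dimensional: the comparison functors
  \<open>C(Z, 1) \<rightarrow> 1\<close>, \<open>C(Z, A \<times> B) \<rightarrow> C(Z, A) \<times> C(Z, B)\<close> and \<open>C(Z, B\<^sup>A) \<rightarrow> C(Z \<times> A, B)\<close> are
  bijective on morphisms and on 2-cells, i.e. isomorphisms of categories.
\<close>

locale cc_two_category = two_category C for C :: "('a, 'm, 'c) cc2" +
  assumes one_obj: "one C \<in> obj C"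
    and prd_obj: "\<lbrakk>A \<in> obj C; B \<in> obj C\<rbrakk> \<Longrightarrow> prd C A B \<in> obj C"
    and prj1_hom: "\<lbrakk>A \<in> obj C; B \<in> obj C\<rbrakk> \<Longrightarrow> prj1 C A B \<in> hom C (prd C A B) A"
    and prj2_hom: "\<lbrakk>A \<in> obj C; B \<in> obj C\<rbrakk> \<Longrightarrow> prj2 C A B \<in> hom C (prd C A B) B"
    and expo_obj: "\<lbrakk>A \<in> obj C; B \<in> obj C\<rbrakk> \<Longrightarrow> expo C A B \<in> obj C"
    and evl_hom: "\<lbrakk>A \<in> obj C; B \<in> obj C\<rbrakk> \<Longrightarrow> evl C A B \<in> hom C (prd C (expo C A B) A) B"
    and one_univ: "Z \<in> obj C \<Longrightarrow> \<exists>!f. f \<in> hom C Z (one C)"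
    and one_univ2: "\<lbrakk>Z \<in> obj C; f \<in> hom C Z (one C); f' \<in> hom C Z (one C)\<rbrakk>
      \<Longrightarrow> \<exists>!\<alpha>. \<alpha> \<in> cell C f f'"
    and prd_univ: "\<lbrakk>Z \<in> obj C; A \<in> obj C; B \<in> obj C; f \<in> hom C Z A; g \<in> hom C Z B\<rbrakk>
      \<Longrightarrow> \<exists>!h. h \<in> hom C Z (prd C A B) \<and> comp C (prj1 C A B) h = f \<and> comp C (prj2 C A B) h = g"
    and prd_univ2: "\<lbrakk>Z \<in> obj C; A \<in> obj C; B \<in> obj C;
        h \<in> hom C Z (prd C A B); h' \<in> hom C Z (prd C A B);
        \<alpha> \<in> cell C (comp C (prj1 C A B) h) (comp C (prj1 C A B) h');
        \<beta> \<in> cell C (comp C (prj2 C A B) h) (comp C (prj2 C A B) h')\<rbrakk>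
      \<Longrightarrow> \<exists>!\<gamma>. \<gamma> \<in> cell C h h' \<and> hcomp C (idc C (prj1 C A B)) \<gamma> = \<alpha> \<and>
            hcomp C (idc C (prj2 C A B)) \<gamma> = \<beta>"
    and expo_univ: "\<lbrakk>Z \<in> obj C; A \<in> obj C; B \<in> obj C; f \<in> hom C (prd C Z A) B\<rbrakk>
      \<Longrightarrow> \<exists>!h. h \<in> hom C Z (expo C A B) \<and>
            comp C (evl C A B) (mtimes C Z (expo C A B) h A) = f"
    and expo_univ2: "\<lbrakk>Z \<in> obj C; A \<in> obj C; B \<in> obj C;
        h \<in> hom C Z (expo C A B); h' \<in> hom C Z (expo C A B);
        \<alpha> \<in> cell C (comp C (evl C A B) (mtimes C Z (expo C A B) h A))
              (comp C (evl C A B) (mtimes C Z (expo C A B) h' A))\<rbrakk>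
      \<Longrightarrow> \<exists>!\<beta>. \<beta> \<in> cell C h h' \<and>
            hcomp C (idc C (evl C A B)) (ctimes C Z (expo C A B) h h' \<beta> A) = \<alpha>"

locale two_functor = dom: two_category C + cod: two_category D
  for C :: "('a, 'm, 'c) cc2" and D :: "('b, 'n, 'd) cc2" +
  fixes F0 :: "'a \<Rightarrow> 'b" and F1 :: "'m \<Rightarrow> 'n" and F2 :: "'c \<Rightarrow> 'd"
  assumes F0_obj: "A \<in> obj C \<Longrightarrow> F0 A \<in> obj D"
    and F1_hom: "\<lbrakk>A \<in> obj C; B \<in> obj C; f \<in> hom C A B\<rbrakk> \<Longrightarrow> F1 f \<in> hom D (F0 A) (F0 B)"
    and F2_cell: "\<lbrakk>A \<in> obj C; B \<in> obj C; f \<in> hom C A B; g \<in> hom C A B; \<alpha> \<in> cell C f g\<rbrakk>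
      \<Longrightarrow> F2 \<alpha> \<in> cell D (F1 f) (F1 g)"
    and F1_idm: "A \<in> obj C \<Longrightarrow> F1 (idm C A) = idm D (F0 A)"
    and F1_comp: "\<lbrakk>A \<in> obj C; B \<in> obj C; E \<in> obj C; f \<in> hom C A B; g \<in> hom C B E\<rbrakk>
      \<Longrightarrow> F1 (comp C g f) = comp D (F1 g) (F1 f)"
    and F2_idc: "\<lbrakk>A \<in> obj C; B \<in> obj C; f \<in> hom C A B\<rbrakk> \<Longrightarrow> F2 (idc C f) = idc D (F1 f)"
    and F2_vcomp: "\<lbrakk>A \<in> obj C; B \<in> obj C; f \<in> hom C A B; g \<in> hom C A B; h \<in> hom C A B;
        \<alpha> \<in> cell C f g; \<beta> \<in> cell C g h\<rbrakk> \<Longrightarrow> F2 (vcomp C \<alpha> \<beta>) = vcomp D (F2 \<alpha>) (F2 \<beta>)"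
    and F2_hcomp: "\<lbrakk>A \<in> obj C; B \<in> obj C; E \<in> obj C;
        f \<in> hom C A B; f' \<in> hom C A B; g \<in> hom C B E; g' \<in> hom C B E;
        \<alpha> \<in> cell C f f'; \<beta> \<in> cell C g g'\<rbrakk> \<Longrightarrow> F2 (hcomp C \<beta> \<alpha>) = hcomp D (F2 \<beta>) (F2 \<alpha>)"

locale cc_two_functor = two_functor C D F0 F1 F2 + dom: cc_two_category C + cod: cc_two_category D
  for C :: "('a, 'm, 'c) cc2" and D :: "('b, 'n, 'd) cc2" and F0 F1 F2 +
  assumes F0_one: "F0 (one C) = one D"
    and F0_prd: "\<lbrakk>A \<in> obj C; B \<in> obj C\<rbrakk> \<Longrightarrow> F0 (prd C A B) = prd D (F0 A) (F0 B)"
    and F1_prj1: "\<lbrakk>A \<in> obj C; B \<in> obj C\<rbrakk> \<Longrightarrow> F1 (prj1 C A B) = prj1 D (F0 A) (F0 B)"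
    and F1_prj2: "\<lbrakk>A \<in> obj C; B \<in> obj C\<rbrakk> \<Longrightarrow> F1 (prj2 C A B) = prj2 D (F0 A) (F0 B)"
    and F0_expo: "\<lbrakk>A \<in> obj C; B \<in> obj C\<rbrakk> \<Longrightarrow> F0 (expo C A B) = expo D (F0 A) (F0 B)"
    and F1_evl: "\<lbrakk>A \<in> obj C; B \<in> obj C\<rbrakk> \<Longrightarrow> F1 (evl C A B) = evl D (F0 A) (F0 B)"

definition locally_full ::
  "('a, 'm, 'c) cc2 \<Rightarrow> ('b, 'n, 'd) cc2 \<Rightarrow> ('m \<Rightarrow> 'n) \<Rightarrow> ('c \<Rightarrow> 'd) \<Rightarrow> bool" where
  "locally_full C D F1 F2 \<longleftrightarrow>
    (\<forall>A \<in> obj C. \<forall>B \<in> obj C. \<forall>f \<in> hom C A B. \<forall>g \<in> hom C A B.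
      F2 ` cell C f g = cell D (F1 f) (F1 g))"

section \<open>The 2-categories \<open>\<H>(X)\<close> and \<open>\<R>(X)\<close>\<close>

text \<open>
  A morphism \<open>A \<rightarrow> B\<close> is a class of terms in the one-variable context \<open>[A]\<close>, tagged with its
  source and target. Operations on classes are given by their values on all representatives,
  saturated under the equivalence.
\<close>

type_synonym ('s, 'o) mor = "'s ty \<times> ('s, 'o) tm set \<times> 's ty"
type_synonym ('s, 'o, 'r) hcell = "('s, 'o) mor \<times> ('s, 'o, 'r) rd set \<times> ('s, 'o) mor"
type_synonym ('s, 'o) rcell = "('s, 'o) mor \<times> ('s, 'o) mor"

definition mhom :: "('s, 'o, 'r) two_sig \<Rightarrow> 's ty \<Rightarrow> 's ty \<Rightarrow> ('s, 'o) mor set" where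
  "mhom X A B = {(A, m, B) | m. m \<in> terms X [A] B}"

definition mor_of :: "('s, 'o, 'r) two_sig \<Rightarrow> 's ty \<Rightarrow> ('s, 'o) tm \<Rightarrow> 's ty \<Rightarrow> ('s, 'o) mor" where
  "mor_of X A M B = (A, conv_rel X [A] B `` {M}, B)"

fun mcomp :: "('s, 'o, 'r) two_sig \<Rightarrow> ('s, 'o) mor \<Rightarrow> ('s, 'o) mor \<Rightarrow> ('s, 'o) mor" where
  "mcomp X (B', n, D) (A, m, B) =
    (A, conv_rel X [A] D `` {sub (nth [M]) N | M N. M \<in> m \<and> N \<in> n}, D)"

definition mev :: "('s, 'o, 'r) two_sig \<Rightarrow> 's ty \<Rightarrow> 's ty \<Rightarrow> ('s, 'o) mor" where
  "mev X A B = mor_of X (Prod (Fun A B) A) (App (Fst (Var 0)) (Snd (Var 0))) B"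

fun hcells :: "('s, 'o, 'r) two_sig \<Rightarrow> ('s, 'o) mor \<Rightarrow> ('s, 'o) mor \<Rightarrow> ('s, 'o, 'r) hcell set" where
  "hcells X (A, m, B) (A', n, B') =
    {((A, m, B), p, (A', n, B')) | p. \<exists>M \<in> m. \<exists>N \<in> n.
       p \<in> {P. red X [A] P M N B} // perm_rel X [A] M N B}"

fun hid :: "('s, 'o, 'r) two_sig \<Rightarrow> ('s, 'o) mor \<Rightarrow> ('s, 'o, 'r) hcell" where
  "hid X (A, m, B) =
    ((A, m, B), {Q. \<exists>M \<in> m. perm X [A] (emb M) Q M M B}, (A, m, B))"

fun hvert :: "('s, 'o, 'r) two_sig \<Rightarrow> ('s, 'o, 'r) hcell \<Rightarrow> ('s, 'o, 'r) hcell \<Rightarrow> ('s, 'o, 'r) hcell" where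
  "hvert X ((A, m1, B), p, (_, m2, _)) (_, q, (A', m3, B')) =
    ((A, m1, B),
     {S. \<exists>M1 \<in> m1. \<exists>M2 \<in> m2. \<exists>M3 \<in> m3. \<exists>P \<in> p. \<exists>Q \<in> q. perm X [A] (RComp P M2 Q) S M1 M3 B},
     (A', m3, B'))"

text \<open>Horizontal composition of \<open>P : M \<rightarrow> M'\<close> and \<open>Q : N \<rightarrow> N'\<close> is the substitution $P[Q]$.\<close>

fun hhor :: "('s, 'o, 'r) two_sig \<Rightarrow> ('s, 'o, 'r) hcell \<Rightarrow> ('s, 'o, 'r) hcell \<Rightarrow> ('s, 'o, 'r) hcell" where
  "hhor X ((B1, m, D), p, (B2, m', D')) ((A, n, B), q, (A', n', B')) =
    (mcomp X (B1, m, D) (A, n, B),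
     {S. \<exists>M \<in> m. \<exists>M' \<in> m'. \<exists>N \<in> n. \<exists>N' \<in> n'. \<exists>P \<in> p. \<exists>Q \<in> q.
        perm X [A] (hsub P M' (nth [N]) (nth [Q])) S (sub (nth [N]) M) (sub (nth [N']) M') D},
     mcomp X (B2, m', D') (A', n', B'))"

definition HCat :: "('s, 'o, 'r) two_sig \<Rightarrow> ('s ty, ('s, 'o) mor, ('s, 'o, 'r) hcell) cc2" where
  "HCat X = \<lparr>
     obj = types X, hom = mhom X, cell = hcells X,
     idm = (\<lambda>A. mor_of X A (Var 0) A), comp = mcomp X,
     idc = hid X, vcomp = hvert X, hcomp = hhor X,
     one = One, prd = Prod,
     prj1 = (\<lambda>A B. mor_of X (Prod A B) (Fst (Var 0)) A),
     prj2 = (\<lambda>A B. mor_of X (Prod A B) (Snd (Var 0)) B),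
     expo = Fun, evl = mev X\<rparr>"

fun rcells :: "('s, 'o, 'r) two_sig \<Rightarrow> ('s, 'o) mor \<Rightarrow> ('s, 'o) mor \<Rightarrow> ('s, 'o) rcell set" where
  "rcells X (A, m, B) (A', n, B') =
    (if (m, n) \<in> (rew_rel X [A] B)\<^sup>* then {((A, m, B), (A', n, B'))} else {})"

definition RCat :: "('s, 'o, 'r) two_sig \<Rightarrow> ('s ty, ('s, 'o) mor, ('s, 'o) rcell) cc2" where
  "RCat X = \<lparr>
     obj = types X, hom = mhom X, cell = rcells X,
     idm = (\<lambda>A. mor_of X A (Var 0) A), comp = mcomp X,
     idc = (\<lambda>f. (f, f)),
     vcomp = (\<lambda>\<alpha> \<beta>. (fst \<alpha>, snd \<beta>)),
     hcomp = (\<lambda>\<beta> \<alpha>. (mcomp X (fst \<beta>) (fst \<alpha>), mcomp X (snd \<beta>) (snd \<alpha>))),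
     one = One, prd = Prod,
     prj1 = (\<lambda>A B. mor_of X (Prod A B) (Fst (Var 0)) A),
     prj2 = (\<lambda>A B. mor_of X (Prod A B) (Snd (Var 0)) B),
     expo = Fun, evl = mev X\<rparr>"

end

(* The main point is that simultaneous substitution of reductions is compatible with permutation
   equivalence. Substituting reductions for the variables of a term respects conversion and commutes
   with vertical composition, and the two composites "first P, then the substituted reductions" and
   "first the substituted reductions, then P" agree; this yields the interchange law. Exponential
   transposition of a reduction is RLam after substituting a pair of variables, inverted by
   beta and eta for reductions. By substitutivity of rewriting, there is a reduction from M to N
   exactly when M rewrites to N, so the rewriting 2-category arises by identifying all parallel
   2-cells, and the functor remembers only the source and target of a 2-cell. *)

theory Submission
  imports Defs
begin

section \<open>Substitution calculus\<close>

text \<open>Terms are identified up to \<beta>\<eta>, but reductions are raw trees containing raw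
  terms, so every operation on 2-cells has to be shown independent of representatives. The obstacle
  is P[N]: for convertible tuples \<sigma> and \<sigma>' the reductions
  \<open>rsub \<sigma> P\<close> and \<open>rsub \<sigma>' P\<close> are different trees, and their
  equivalence (\<open>perm_rsub_conv\<close>) is a consequence of the exchange law, not a
  preliminary to it. The exchange law meets conversion through \<open>rd_conv\<close>, since the end
  points of P are determined only up to \<beta>\<eta>, and so needs \<open>lsub\<close> to be
  invariant under conversion. The \<beta> case of that invariance contracts to a two-stage composite
  and needs \<open>lsub\<close> to preserve vertical composition. A reduction may act in parallel
  positions while a rewrite step touches one, so reductions are sequentialised before being compared
  with rewriting. The 2-dimensional universal properties of R(X) ask for existence, inherited from
  H(X), and uniqueness, automatic for a preorder.\<close>

lemma up_ren_comp: "up_ren \<xi> \<circ> up_ren \<zeta> = up_ren (\<xi> \<circ> \<zeta>)"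
proof
  show "(up_ren \<xi> \<circ> up_ren \<zeta>) i = up_ren (\<xi> \<circ> \<zeta>) i" for i by (cases i) simp_all
qed

lemma up_comp_up_ren: "up \<sigma> \<circ> up_ren \<xi> = up (\<sigma> \<circ> \<xi>)"
proof
  show "(up \<sigma> \<circ> up_ren \<xi>) i = up (\<sigma> \<circ> \<xi>) i" for i by (cases i) simp_all
qed

lemma up_Var: "up Var = Var"
proof
  show "up Var i = Var i" for i by (cases i) simp_all
qed

lemma up_Var_comp: "up (Var \<circ> \<xi>) = Var \<circ> up_ren \<xi>"
proof
  show "up (Var \<circ> \<xi>) i = (Var \<circ> up_ren \<xi>) i" for i by (cases i) simp_all
qed

lemma ren_ren: "ren \<xi> (ren \<zeta> M) = ren (\<xi> \<circ> \<zeta>) M"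
  by (induction M arbitrary: \<xi> \<zeta>) (simp_all add: up_ren_comp)

lemma sub_ren: "sub \<sigma> (ren \<xi> M) = sub (\<sigma> \<circ> \<xi>) M"
  by (induction M arbitrary: \<sigma> \<xi>) (simp_all add: up_comp_up_ren)

lemma ren_comp_up: "ren (up_ren \<xi>) \<circ> up \<sigma> = up (ren \<xi> \<circ> \<sigma>)"
proof
  have "up_ren \<xi> \<circ> Suc = Suc \<circ> \<xi>" by (rule ext) simp
  then show "(ren (up_ren \<xi>) \<circ> up \<sigma>) i = up (ren \<xi> \<circ> \<sigma>) i" for i
    by (cases i) (simp_all add: ren_ren)
qed

lemma ren_sub: "ren \<xi> (sub \<sigma> M) = sub (ren \<xi> \<circ> \<sigma>) M"
  by (induction M arbitrary: \<sigma> \<xi>) (simp_all add: ren_comp_up)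

lemma sub_comp_up: "sub (up \<sigma>) \<circ> up \<rho> = up (sub \<sigma> \<circ> \<rho>)"
proof
  have "up \<sigma> \<circ> Suc = ren Suc \<circ> \<sigma>" by (rule ext) simp
  then show "(sub (up \<sigma>) \<circ> up \<rho>) i = up (sub \<sigma> \<circ> \<rho>) i" for i
    by (cases i) (simp_all add: sub_ren ren_sub)
qed

lemma sub_sub: "sub \<sigma> (sub \<rho> M) = sub (sub \<sigma> \<circ> \<rho>) M"
  by (induction M arbitrary: \<sigma> \<rho>) (simp_all add: sub_comp_up)

lemma sub_Var: "sub Var M = M"
  by (induction M) (simp_all add: up_Var map_idI)

lemma ren_eq_sub: "ren \<xi> M = sub (Var \<circ> \<xi>) M"
  by (induction M arbitrary: \<xi>) (simp_all add: up_Var_comp)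

section \<open>Substitution laws for reductions\<close>

lemma rren_emb: "rren \<xi> (emb M) = emb (ren \<xi> M)"
  by (induction M arbitrary: \<xi>) simp_all

lemma rsub_emb: "rsub \<sigma> (emb M) = emb (sub \<sigma> M)"
  by (induction M arbitrary: \<sigma>) simp_all

lemma rup_emb: "rup (emb \<circ> \<sigma>) = emb \<circ> up \<sigma>"
proof
  show "rup (emb \<circ> \<sigma>) i = (emb \<circ> up \<sigma>) i" for i by (cases i) (simp_all add: rren_emb)
qed

text \<open>Preservation of identities by M[-], as an equality of raw reductions. The identity legs
  that arise later are therefore literally of the form \<open>emb\<close>, ready for the unit laws
  of vertical composition.\<close>

lemma lsub_emb: "lsub (emb \<circ> \<sigma>) M = emb (sub \<sigma> M)"
  by (induction M arbitrary: \<sigma>) (simp_all add: rup_emb)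

lemma emb_Var: "emb \<circ> Var = RVar"
  by (rule ext) simp

lemma lsub_RVar: "lsub RVar M = emb M"
  using lsub_emb[of Var M] by (simp add: emb_Var sub_Var)

text \<open>Under a binder \<open>rsub\<close> lifts terms, not reductions, so its theory rests on
  the term calculus alone. Renaming becomes a special case, and weakening of \<open>red\<close> and
  \<open>perm\<close> will come from their closure under \<open>rsub\<close>.\<close>

lemma rren_eq_rsub: "rren \<xi> P = rsub (Var \<circ> \<xi>) P"
  by (induction P arbitrary: \<xi>) (simp_all add: up_Var_comp ren_eq_sub)

lemma rsub_rsub: "rsub \<sigma> (rsub \<rho> P) = rsub (sub \<sigma> \<circ> \<rho>) P"
  by (induction P arbitrary: \<sigma> \<rho>) (simp_all add: sub_comp_up sub_sub rsub_emb)

lemma rsub_Var: "rsub Var P = P"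
  by (induction P) (simp_all add: up_Var sub_Var map_idI)

lemma sub_Var_comp: "sub \<sigma> \<circ> (Var \<circ> \<xi>) = \<sigma> \<circ> \<xi>"
  by (rule ext) simp

lemma rsub_rren: "rsub \<sigma> (rren \<xi> P) = rsub (\<sigma> \<circ> \<xi>) P"
  by (simp add: rren_eq_rsub rsub_rsub sub_Var_comp)

lemma rren_rsub: "rren \<xi> (rsub \<sigma> P) = rsub (ren \<xi> \<circ> \<sigma>) P"
  by (simp add: rren_eq_rsub rsub_rsub ren_eq_sub[abs_def] comp_def)

lemma rup_comp_up_ren: "rup \<tau> \<circ> up_ren \<xi> = rup (\<tau> \<circ> \<xi>)"
proof
  show "(rup \<tau> \<circ> up_ren \<xi>) i = rup (\<tau> \<circ> \<xi>) i" for i by (cases i) simp_all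
qed

lemma lsub_ren: "lsub \<tau> (ren \<xi> M) = lsub (\<tau> \<circ> \<xi>) M"
  by (induction M arbitrary: \<tau> \<xi>) (simp_all add: rup_comp_up_ren)

lemma rsub_comp_rup: "rsub (up \<sigma>) \<circ> rup \<tau> = rup (rsub \<sigma> \<circ> \<tau>)"
proof
  have "up \<sigma> \<circ> Suc = ren Suc \<circ> \<sigma>" by (rule ext) simp
  then show "(rsub (up \<sigma>) \<circ> rup \<tau>) i = rup (rsub \<sigma> \<circ> \<tau>) i" for i
    by (cases i) (simp_all add: rsub_rren rren_rsub)
qed

lemma rsub_lsub: "rsub \<sigma> (lsub \<tau> M) = lsub (rsub \<sigma> \<circ> \<tau>) M"
  by (induction M arbitrary: \<sigma> \<tau>) (simp_all add: rsub_comp_rup)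

lemma rren_lsub: "rren \<xi> (lsub \<tau> M) = lsub (rren \<xi> \<circ> \<tau>) M"
  by (simp add: rren_eq_rsub[abs_def] rsub_lsub comp_def)

lemma rup_Suc: "rup \<tau> \<circ> Suc = rren Suc \<circ> \<tau>"
  by (rule ext) simp

lemma lsub_comp_up: "lsub (rup \<tau>) \<circ> up \<sigma> = rup (lsub \<tau> \<circ> \<sigma>)"
proof
  show "(lsub (rup \<tau>) \<circ> up \<sigma>) i = rup (lsub \<tau> \<circ> \<sigma>) i" for i
    by (cases i) (simp_all add: lsub_ren rup_Suc rren_lsub)
qed

lemma lsub_sub: "lsub \<tau> (sub \<sigma> M) = lsub (lsub \<tau> \<circ> \<sigma>) M"
  by (induction M arbitrary: \<sigma> \<tau>) (simp_all add: lsub_comp_up)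

section \<open>Substitution and instantiation of a bound variable\<close>

lemma sub_case_nat_up: "sub (case_nat N Var) \<circ> up \<sigma> = case_nat N \<sigma>"
proof
  have "case_nat N Var \<circ> Suc = Var" by (rule ext) simp
  then show "(sub (case_nat N Var) \<circ> up \<sigma>) i = case_nat N \<sigma> i" for i
    by (cases i) (simp_all add: sub_ren sub_Var)
qed

lemma sub_comp_case_nat: "sub \<sigma> \<circ> case_nat N Var = case_nat (sub \<sigma> N) \<sigma>"
proof
  show "(sub \<sigma> \<circ> case_nat N Var) i = case_nat (sub \<sigma> N) \<sigma> i" for i by (cases i) simp_all
qed

lemma sub_beta: "sub \<sigma> (sub (case_nat N Var) M) = sub (case_nat (sub \<sigma> N) Var) (sub (up \<sigma>) M)"
  by (simp add: sub_sub sub_case_nat_up sub_comp_case_nat)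

lemma rsub_beta: "rsub \<sigma> (rsub (case_nat N Var) P) = rsub (case_nat (sub \<sigma> N) Var) (rsub (up \<sigma>) P)"
  by (simp add: rsub_rsub sub_case_nat_up sub_comp_case_nat)

lemma rsub_comp_case_nat: "rsub \<sigma> \<circ> case_nat Q RVar = case_nat (rsub \<sigma> Q) (emb \<circ> \<sigma>)"
proof
  show "(rsub \<sigma> \<circ> case_nat Q RVar) i = case_nat (rsub \<sigma> Q) (emb \<circ> \<sigma>) i" for i
    by (cases i) simp_all
qed

lemma lsub_case_nat_up: "lsub (case_nat Q RVar) \<circ> up \<sigma> = case_nat Q (emb \<circ> \<sigma>)"
proof
  have "case_nat Q RVar \<circ> Suc = RVar" by (rule ext) simp
  then show "(lsub (case_nat Q RVar) \<circ> up \<sigma>) i = case_nat Q (emb \<circ> \<sigma>) i" for i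
    by (cases i) (simp_all add: lsub_ren lsub_RVar)
qed

text \<open>Serves the \<beta> case of \<open>perm_rsub\<close>: the contractum of
  \<open>pm_beta\<close> keeps its shape, because on both sides the tuple put into M becomes
  \<open>case_nat (rsub \<sigma> Q) (emb \<circ> \<sigma>)\<close>.\<close>

lemma rsub_hsub_beta:
  "rsub \<sigma> (hsub P M (case_nat N Var) (case_nat Q RVar)) =
   hsub (rsub (up \<sigma>) P) (sub (up \<sigma>) M) (case_nat (sub \<sigma> N) Var) (case_nat (rsub \<sigma> Q) RVar)"
  by (simp add: hsub_def rsub_beta sub_beta rsub_lsub lsub_sub rsub_comp_case_nat lsub_case_nat_up)

lemma ren_Suc_sub: "sub (up \<sigma>) (ren Suc M) = ren Suc (sub \<sigma> M)"
proof -
  have "up \<sigma> \<circ> Suc = ren Suc \<circ> \<sigma>" by (rule ext) simp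
  then show ?thesis by (simp add: sub_ren ren_sub)
qed

lemma rren_Suc_rsub: "rsub (up \<sigma>) (rren Suc P) = rren Suc (rsub \<sigma> P)"
proof -
  have "up \<sigma> \<circ> Suc = ren Suc \<circ> \<sigma>" by (rule ext) simp
  then show ?thesis by (simp add: rsub_rren rren_rsub)
qed

lemma rsub_vcomps:
  "\<lbrakk>length Ns = length Ps; length Qs = length Ps\<rbrakk> \<Longrightarrow>
   map (rsub \<sigma>) (vcomps Ps Ns Qs) = vcomps (map (rsub \<sigma>) Ps) (map (sub \<sigma>) Ns) (map (rsub \<sigma>) Qs)"
  by (simp add: vcomps_def)

lemma length_vcomps [simp]: "length (vcomps Ps Ns Qs) = length Ps"
  by (simp add: vcomps_def)

lemma nth_vcomps [simp]: "i < length Ps \<Longrightarrow> vcomps Ps Ns Qs ! i = RComp (Ps ! i) (Ns ! i) (Qs ! i)"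
  by (simp add: vcomps_def)

section \<open>Typing and conversion\<close>

text \<open>Tuples enter as \<open>nth Ms\<close>, whose values past the end of the list are
  arbitrary. Laws for composing such substitutions therefore hold only on typed terms, and this
  congruence is what restricts attention to the context.\<close>

lemma sub_cong_typed:
  "\<lbrakk>has_type X \<Gamma> M A; \<forall>i < length \<Gamma>. \<sigma> i = \<sigma>' i\<rbrakk> \<Longrightarrow> sub \<sigma> M = sub \<sigma>' M"
proof (induction arbitrary: \<sigma> \<sigma>' rule: has_type.induct)
  case (ty_Op c Ms \<Gamma>)
  then show ?case by (auto simp: in_set_conv_nth)
next
  case (ty_Lam A \<Gamma> M B)
  have "\<forall>i < length (A # \<Gamma>). up \<sigma> i = up \<sigma>' i"
    using ty_Lam.prems by (auto simp: less_Suc_eq_0_disj)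
  then show ?case using ty_Lam.IH by auto
qed auto

lemma lsub_cong_typed:
  "\<lbrakk>has_type X \<Gamma> M A; \<forall>i < length \<Gamma>. \<tau> i = \<tau>' i\<rbrakk> \<Longrightarrow> lsub \<tau> M = lsub \<tau>' M"
proof (induction arbitrary: \<tau> \<tau>' rule: has_type.induct)
  case (ty_Op c Ms \<Gamma>)
  then show ?case by (auto simp: in_set_conv_nth)
next
  case (ty_Lam A \<Gamma> M B)
  have "\<forall>i < length (A # \<Gamma>). rup \<tau> i = rup \<tau>' i"
    using ty_Lam.prems by (auto simp: less_Suc_eq_0_disj)
  then show ?case using ty_Lam.IH by auto
qed auto

lemma sub_sub_nth:
  assumes "has_type X \<Delta> M A" "length Ms = length \<Delta>"
  shows "sub \<sigma> (sub (nth Ms) M) = sub (nth (map (sub \<sigma>) Ms)) M"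
  using assms by (simp add: sub_sub) (rule sub_cong_typed, auto)

lemma rsub_lsub_nth:
  assumes "has_type X \<Delta> M A" "length Ps = length \<Delta>"
  shows "rsub \<sigma> (lsub (nth Ps) M) = lsub (nth (map (rsub \<sigma>) Ps)) M"
  using assms by (simp add: rsub_lsub) (rule lsub_cong_typed, auto)

lemma lsub_sub_nth:
  assumes "has_type X \<Delta> M A" "length Ms = length \<Delta>"
  shows "lsub \<tau> (sub (nth Ms) M) = lsub (nth (map (lsub \<tau>) Ms)) M"
  using assms by (simp add: lsub_sub) (rule lsub_cong_typed, auto)

definition wt_sub ::
  "('s, 'o, 'z) one_sig_scheme \<Rightarrow> 's ty list \<Rightarrow> 's ty list \<Rightarrow> (nat \<Rightarrow> ('s, 'o) tm) \<Rightarrow> bool" where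
  "wt_sub X \<Gamma> \<Delta> \<sigma> \<longleftrightarrow> (\<forall>i < length \<Delta>. has_type X \<Gamma> (\<sigma> i) (\<Delta> ! i))"

text \<open>Comes before substitution because \<open>up\<close> weakens the substituted terms, and
  is stated for arbitrary index maps because a binder lifts \<open>Suc\<close> to
  \<open>up_ren Suc\<close>.\<close>

lemma has_type_ren:
  "\<lbrakk>has_type X \<Delta> M A; \<forall>i < length \<Delta>. \<xi> i < length \<Gamma> \<and> \<Gamma> ! \<xi> i = \<Delta> ! i\<rbrakk>
   \<Longrightarrow> has_type X \<Gamma> (ren \<xi> M) A"
proof (induction arbitrary: \<Gamma> \<xi> rule: has_type.induct)
  case (ty_Var i \<Delta>)
  then show ?case by (metis has_type.ty_Var ren.simps(1))
next
  case (ty_Lam A \<Delta> M B)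
  have "\<forall>i < length (A # \<Delta>). up_ren \<xi> i < length (A # \<Gamma>) \<and> (A # \<Gamma>) ! up_ren \<xi> i = (A # \<Delta>) ! i"
    using ty_Lam.prems by (auto simp: less_Suc_eq_0_disj)
  then show ?case using ty_Lam by (auto intro: has_type.intros)
next
  case (ty_App \<Delta> M A B N)
  then show ?case by simp (blast intro: has_type.ty_App)
qed (auto intro: has_type.intros)

lemma has_type_ren_Suc: "has_type X \<Gamma> M A \<Longrightarrow> has_type X (B # \<Gamma>) (ren Suc M) A"
  by (rule has_type_ren) auto

lemma wt_sub_up: "wt_sub X \<Gamma> \<Delta> \<sigma> \<Longrightarrow> wt_sub X (A # \<Gamma>) (A # \<Delta>) (up \<sigma>)"
  unfolding wt_sub_def
  by (auto simp: less_Suc_eq_0_disj has_type_ren_Suc intro: has_type.ty_Var[of 0 "A # \<Gamma>", simplified])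

lemma wt_sub_Suc: "wt_sub X (A # \<Gamma>) \<Gamma> (Var \<circ> Suc)"
  using has_type.ty_Var[of "Suc _" "A # \<Gamma>"] by (auto simp: wt_sub_def)

lemma wt_sub_Var: "wt_sub X \<Gamma> \<Gamma> Var"
  by (auto simp: wt_sub_def intro: has_type.ty_Var)

lemma wt_sub_case_nat:
  "\<lbrakk>has_type X \<Gamma> N A; wt_sub X \<Gamma> \<Delta> \<sigma>\<rbrakk> \<Longrightarrow> wt_sub X \<Gamma> (A # \<Delta>) (case_nat N \<sigma>)"
  by (auto simp: wt_sub_def less_Suc_eq_0_disj)

lemma wt_sub_nth:
  "\<lbrakk>length Ms = length \<Delta>; \<forall>i < length \<Delta>. has_type X \<Gamma> (Ms ! i) (\<Delta> ! i)\<rbrakk>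
   \<Longrightarrow> wt_sub X \<Gamma> \<Delta> (nth Ms)"
  by (simp add: wt_sub_def)

lemma has_type_sub:
  "\<lbrakk>has_type X \<Delta> M A; wt_sub X \<Gamma> \<Delta> \<sigma>\<rbrakk> \<Longrightarrow> has_type X \<Gamma> (sub \<sigma> M) A"
proof (induction arbitrary: \<Gamma> \<sigma> rule: has_type.induct)
  case (ty_Lam A \<Delta> M B)
  then show ?case by (auto intro: has_type.intros wt_sub_up)
next
  case (ty_App \<Delta> M A B N)
  then show ?case by simp (blast intro: has_type.ty_App)
qed (auto intro: has_type.intros simp: wt_sub_def)

lemma has_type_beta:
  "\<lbrakk>has_type X (A # \<Gamma>) M B; has_type X \<Gamma> N A\<rbrakk> \<Longrightarrow> has_type X \<Gamma> (sub (case_nat N Var) M) B"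
  by (blast intro: has_type_sub wt_sub_case_nat wt_sub_Var)

lemma conv_has_type: "conv X \<Gamma> M N A \<Longrightarrow> has_type X \<Gamma> M A \<and> has_type X \<Gamma> N A"
proof (induction rule: conv.induct)
  case (cv_eta A \<Gamma> M B)
  have "has_type X (A # \<Gamma>) (App (ren Suc M) (Var 0)) B"
    using ty_App[OF has_type_ren_Suc[OF cv_eta(2)]] ty_Var[of 0 "A # \<Gamma>" X] by auto
  then show ?case using cv_eta by (auto intro: has_type.intros)
qed (auto intro: has_type.intros has_type_beta)

lemma conv_sub:
  "\<lbrakk>conv X \<Delta> M N A; wt_sub X \<Gamma> \<Delta> \<sigma>\<rbrakk> \<Longrightarrow> conv X \<Gamma> (sub \<sigma> M) (sub \<sigma> N) A"
proof (induction arbitrary: \<Gamma> \<sigma> rule: conv.induct)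
  case (cv_refl \<Delta> M A)
  then show ?case by (blast intro: conv.cv_refl has_type_sub)
next
  case (cv_sym \<Delta> M N A)
  then show ?case by (blast intro: conv.cv_sym)
next
  case (cv_trans \<Delta> M N A K)
  then show ?case by (blast intro: conv.cv_trans)
next
  case (cv_beta A \<Delta> M B N)
  then show ?case
    by (simp add: sub_beta) (blast intro: conv.cv_beta has_type_sub wt_sub_up)
next
  case (cv_eta A \<Delta> M B)
  then show ?case
    using conv.cv_eta[of A X \<Gamma> "sub \<sigma> M" B] by (simp add: ren_Suc_sub has_type_sub)
next
  case (cv_App \<Delta> M M' A B N N')
  then show ?case by simp (blast intro: conv.cv_App)
qed (auto intro: conv.intros has_type_sub wt_sub_up)

lemma conv_ren_Suc: "conv X \<Gamma> M N A \<Longrightarrow> conv X (B # \<Gamma>) (ren Suc M) (ren Suc N) A"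
  by (simp add: ren_eq_sub conv_sub wt_sub_Suc)

lemma conv_sub_conv:
  "\<lbrakk>has_type X \<Delta> M A; \<forall>i < length \<Delta>. conv X \<Gamma> (\<sigma> i) (\<sigma>' i) (\<Delta> ! i)\<rbrakk>
   \<Longrightarrow> conv X \<Gamma> (sub \<sigma> M) (sub \<sigma>' M) A"
proof (induction arbitrary: \<Gamma> \<sigma> \<sigma>' rule: has_type.induct)
  case (ty_Lam A \<Delta> M B)
  have "\<forall>i < length (A # \<Delta>). conv X (A # \<Gamma>) (up \<sigma> i) (up \<sigma>' i) ((A # \<Delta>) ! i)"
    using ty_Lam.prems cv_refl[OF ty_Var[of 0 "A # \<Gamma>" X]] by (auto simp: less_Suc_eq_0_disj conv_ren_Suc)
  then show ?case using ty_Lam by (auto intro: conv.intros)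
next
  case (ty_App \<Delta> M A B N)
  then show ?case by simp (blast intro: conv.cv_App)
next
  case (ty_Fst \<Delta> M A B)
  then show ?case by simp (blast intro: conv.cv_Fst)
next
  case (ty_Snd \<Delta> M A B)
  then show ?case by simp (blast intro: conv.cv_Snd)
qed (auto intro: conv.intros has_type.intros)

lemma conv_sub2:
  assumes "conv X \<Delta> M N A" "\<forall>i < length \<Delta>. conv X \<Gamma> (\<sigma> i) (\<sigma>' i) (\<Delta> ! i)"
  shows "conv X \<Gamma> (sub \<sigma> M) (sub \<sigma>' N) A"
proof -
  have "wt_sub X \<Gamma> \<Delta> \<sigma>" using assms(2) conv_has_type unfolding wt_sub_def by blast
  then show ?thesis using assms conv_sub conv_sub_conv conv_has_type cv_trans by metis
qed

section \<open>Reductions\<close>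

text \<open>The tuple judgement \<Gamma> \<turnstile> \<tau> : \<sigma> \<rightarrow> \<sigma>' :
  \<Delta>. Functions instead of lists allow all three components to be lifted under binders by
  \<open>rup\<close> and \<open>up\<close>.\<close>

definition wt_rsub ::
  "('s, 'o, 'r) two_sig \<Rightarrow> 's ty list \<Rightarrow> 's ty list \<Rightarrow> (nat \<Rightarrow> ('s, 'o, 'r) rd) \<Rightarrow>
    (nat \<Rightarrow> ('s, 'o) tm) \<Rightarrow> (nat \<Rightarrow> ('s, 'o) tm) \<Rightarrow> bool" where
  "wt_rsub X \<Gamma> \<Delta> \<tau> \<sigma> \<sigma>' \<longleftrightarrow> (\<forall>i < length \<Delta>. red X \<Gamma> (\<tau> i) (\<sigma> i) (\<sigma>' i) (\<Delta> ! i))"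

definition wt_psub ::
  "('s, 'o, 'r) two_sig \<Rightarrow> 's ty list \<Rightarrow> 's ty list \<Rightarrow> (nat \<Rightarrow> ('s, 'o, 'r) rd) \<Rightarrow>
    (nat \<Rightarrow> ('s, 'o, 'r) rd) \<Rightarrow> (nat \<Rightarrow> ('s, 'o) tm) \<Rightarrow> (nat \<Rightarrow> ('s, 'o) tm) \<Rightarrow> bool" where
  "wt_psub X \<Gamma> \<Delta> \<tau> \<tau>' \<sigma> \<sigma>' \<longleftrightarrow>
    (\<forall>i < length \<Delta>. perm X \<Gamma> (\<tau> i) (\<tau>' i) (\<sigma> i) (\<sigma>' i) (\<Delta> ! i))"

lemma red_emb: "has_type X \<Gamma> M A \<Longrightarrow> red X \<Gamma> (emb M) M M A"
proof (induction rule: has_type.induct)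
  case (ty_App \<Gamma> M A B N)
  then show ?case by simp (rule red.rd_App)
next
  case (ty_Fst \<Gamma> M A B)
  then show ?case by simp (rule red.rd_Fst)
next
  case (ty_Snd \<Gamma> M A B)
  then show ?case by simp (rule red.rd_Snd)
qed (auto intro: red.intros)

lemma conv_beta:
  "\<lbrakk>A \<in> types X; has_type X (A # \<Gamma>) M B; has_type X \<Gamma> N A\<rbrakk>
   \<Longrightarrow> conv X \<Gamma> (sub (case_nat N Var) M) (App (Lam A M) N) B"
  by (blast intro: cv_sym cv_beta)

locale wf_two_sig =
  fixes X :: "('s, 'o, 'r) two_sig"
  assumes wf: "two_signature X"
begin

lemma lhs_conv:
  assumes "r \<in> rules X" "L \<in> rule_lhs X r" "L' \<in> rule_lhs X r"
  shows "conv X (rule_ctx X r) L L' (rule_ty X r)"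
proof -
  have "rule_lhs X r \<in> terms X (rule_ctx X r) (rule_ty X r)"
    using wf assms(1) by (simp add: two_signature_def)
  then obtain M where "rule_lhs X r = conv_rel X (rule_ctx X r) (rule_ty X r) `` {M}"
    by (auto simp: terms_def quotient_def)
  then show ?thesis using assms(2,3) by (auto simp: conv_rel_def intro: cv_sym cv_trans)
qed

lemma rhs_conv:
  assumes "r \<in> rules X" "R \<in> rule_rhs X r" "R' \<in> rule_rhs X r"
  shows "conv X (rule_ctx X r) R R' (rule_ty X r)"
proof -
  have "rule_rhs X r \<in> terms X (rule_ctx X r) (rule_ty X r)"
    using wf assms(1) by (simp add: two_signature_def)
  then obtain M where "rule_rhs X r = conv_rel X (rule_ctx X r) (rule_ty X r) `` {M}"
    by (auto simp: terms_def quotient_def)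
  then show ?thesis using assms(2,3) by (auto simp: conv_rel_def intro: cv_sym cv_trans)
qed

lemma lhs_has_type:
  "\<lbrakk>r \<in> rules X; L \<in> rule_lhs X r\<rbrakk> \<Longrightarrow> has_type X (rule_ctx X r) L (rule_ty X r)"
  using lhs_conv conv_has_type by blast

lemma rhs_has_type:
  "\<lbrakk>r \<in> rules X; R \<in> rule_rhs X r\<rbrakk> \<Longrightarrow> has_type X (rule_ctx X r) R (rule_ty X r)"
  using rhs_conv conv_has_type by blast

lemma red_has_type: "red X \<Gamma> P M N A \<Longrightarrow> has_type X \<Gamma> M A \<and> has_type X \<Gamma> N A"
proof (induction rule: red.induct)
  case (rd_Rule r L R Ps Ms Ns \<Gamma>)
  then show ?case by (auto intro!: has_type_sub lhs_has_type rhs_has_type wt_sub_nth)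
next
  case (rd_conv \<Gamma> P M N A M' N')
  then show ?case using conv_has_type by blast
next
  case (rd_App \<Gamma> P M M' A B Q N N')
  then show ?case by (blast intro: has_type.ty_App)
next
  case (rd_Fst \<Gamma> P M M' A B)
  then show ?case by (blast intro: has_type.ty_Fst)
next
  case (rd_Snd \<Gamma> P M M' A B)
  then show ?case by (blast intro: has_type.ty_Snd)
qed (auto intro: has_type.intros)

lemma rsub_cong_typed:
  "\<lbrakk>red X \<Gamma> P M N A; \<forall>i < length \<Gamma>. \<sigma> i = \<sigma>' i\<rbrakk> \<Longrightarrow> rsub \<sigma> P = rsub \<sigma>' P"
proof (induction arbitrary: \<sigma> \<sigma>' rule: red.induct)
  case (rd_Op c Ps Ms Ns \<Gamma>)
  then show ?case by (auto simp: in_set_conv_nth)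
next
  case (rd_Rule r L R Ps Ms Ns \<Gamma>)
  then show ?case by (auto simp: in_set_conv_nth)
next
  case (rd_Lam A \<Gamma> P M N B)
  have "\<forall>i < length (A # \<Gamma>). up \<sigma> i = up \<sigma>' i"
    using rd_Lam.prems by (auto simp: less_Suc_eq_0_disj)
  then show ?case using rd_Lam by auto
next
  case (rd_Comp \<Gamma> P M1 M2 A Q M3)
  then have "sub \<sigma> M2 = sub \<sigma>' M2" by (blast intro: sub_cong_typed dest: red_has_type)
  with rd_Comp show ?case by auto
qed auto

lemma wt_rsub_source: "wt_rsub X \<Gamma> \<Delta> \<tau> \<sigma> \<sigma>' \<Longrightarrow> wt_sub X \<Gamma> \<Delta> \<sigma>"
  unfolding wt_rsub_def wt_sub_def using red_has_type by blast

lemma wt_rsub_target: "wt_rsub X \<Gamma> \<Delta> \<tau> \<sigma> \<sigma>' \<Longrightarrow> wt_sub X \<Gamma> \<Delta> \<sigma>'"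
  unfolding wt_rsub_def wt_sub_def using red_has_type by blast

lemma red_rsub:
  "\<lbrakk>red X \<Delta> P M N A; wt_sub X \<Gamma> \<Delta> \<sigma>\<rbrakk> \<Longrightarrow> red X \<Gamma> (rsub \<sigma> P) (sub \<sigma> M) (sub \<sigma> N) A"
proof (induction arbitrary: \<Gamma> \<sigma> rule: red.induct)
  case (rd_Var i \<Delta>)
  then show ?case by (simp add: red_emb wt_sub_def)
next
  case (rd_Op c Ps Ms Ns \<Delta>)
  then show ?case by (auto intro!: red.rd_Op)
next
  case (rd_Lam A \<Delta> P M N B)
  then show ?case by simp (blast intro: red.rd_Lam wt_sub_up)
next
  case (rd_App \<Delta> P M M' A B Q N N')
  then show ?case by simp (blast intro: red.rd_App)
next
  case (rd_Fst \<Delta> P M M' A B)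
  then show ?case by simp (blast intro: red.rd_Fst)
next
  case (rd_Snd \<Delta> P M M' A B)
  then show ?case by simp (blast intro: red.rd_Snd)
next
  case (rd_Rule r L R Ps Ms Ns \<Delta>)
  have "red X \<Gamma> (RRule r (map (rsub \<sigma>) Ps)) (sub (nth (map (sub \<sigma>) Ms)) L)
    (sub (nth (map (sub \<sigma>) Ns)) R) (rule_ty X r)"
    by (rule red.rd_Rule) (use rd_Rule in auto)
  then show ?case
    by (simp add: sub_sub_nth[OF lhs_has_type[OF rd_Rule(1,2)] rd_Rule(5)]
        sub_sub_nth[OF rhs_has_type[OF rd_Rule(1,3)] rd_Rule(6)])
next
  case (rd_Comp \<Delta> P M1 M2 A Q M3)
  then show ?case by simp (blast intro: red.rd_Comp)
next
  case (rd_conv \<Delta> P M N A M' N')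
  then show ?case by (blast intro: red.rd_conv conv_sub)
qed (auto intro: red.intros)

lemma red_rren_Suc: "red X \<Gamma> P M N A \<Longrightarrow> red X (B # \<Gamma>) (rren Suc P) (ren Suc M) (ren Suc N) A"
  by (simp add: rren_eq_rsub ren_eq_sub red_rsub wt_sub_Suc)

lemma red_RVar_0: "red X (A # \<Gamma>) (RVar 0) (Var 0) (Var 0) A"
  using rd_Var[of 0 "A # \<Gamma>" X] by simp

lemma wt_rsub_up:
  "wt_rsub X \<Gamma> \<Delta> \<tau> \<sigma> \<sigma>' \<Longrightarrow> wt_rsub X (A # \<Gamma>) (A # \<Delta>) (rup \<tau>) (up \<sigma>) (up \<sigma>')"
  unfolding wt_rsub_def by (auto simp: less_Suc_eq_0_disj red_rren_Suc red_RVar_0)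

lemma wt_rsub_case_nat:
  "\<lbrakk>red X \<Gamma> Q N N' A; wt_rsub X \<Gamma> \<Delta> \<tau> \<sigma> \<sigma>'\<rbrakk>
   \<Longrightarrow> wt_rsub X \<Gamma> (A # \<Delta>) (case_nat Q \<tau>) (case_nat N \<sigma>) (case_nat N' \<sigma>')"
  unfolding wt_rsub_def by (auto simp: less_Suc_eq_0_disj)

lemma wt_rsub_RVar: "wt_rsub X \<Gamma> \<Gamma> RVar Var Var"
  unfolding wt_rsub_def by (auto intro: rd_Var)

lemma wt_rsub_emb: "wt_sub X \<Gamma> \<Delta> \<sigma> \<Longrightarrow> wt_rsub X \<Gamma> \<Delta> (emb \<circ> \<sigma>) \<sigma> \<sigma>"
  by (auto simp: wt_rsub_def wt_sub_def red_emb)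

text \<open>By \<open>rd_conv\<close> the identity on a term is also a reduction to any convertible
  term. A conversion between tuples can thus be treated as a tuple of reductions that does nothing,
  which is how \<open>perm_rsub_conv\<close> is obtained.\<close>

lemma wt_rsub_emb_conv:
  assumes "\<forall>i < length \<Delta>. conv X \<Gamma> (\<sigma> i) (\<sigma>' i) (\<Delta> ! i)"
  shows "wt_rsub X \<Gamma> \<Delta> (emb \<circ> \<sigma>) \<sigma> \<sigma>'"
  unfolding wt_rsub_def
proof (intro allI impI)
  fix i assume "i < length \<Delta>"
  with assms have "conv X \<Gamma> (\<sigma> i) (\<sigma>' i) (\<Delta> ! i)" by blast
  then have "red X \<Gamma> (emb (\<sigma> i)) (\<sigma> i) (\<sigma>' i) (\<Delta> ! i)"
    by (meson rd_conv red_emb cv_refl conv_has_type)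
  then show "red X \<Gamma> ((emb \<circ> \<sigma>) i) (\<sigma> i) (\<sigma>' i) (\<Delta> ! i)" by simp
qed

lemma wt_rsub_nth:
  "\<lbrakk>length Ps = length \<Delta>; \<forall>i < length \<Delta>. red X \<Gamma> (Ps ! i) (Ms ! i) (Ns ! i) (\<Delta> ! i)\<rbrakk>
   \<Longrightarrow> wt_rsub X \<Gamma> \<Delta> (nth Ps) (nth Ms) (nth Ns)"
  by (simp add: wt_rsub_def)

lemma red_lsub:
  "\<lbrakk>has_type X \<Delta> M A; wt_rsub X \<Gamma> \<Delta> \<tau> \<sigma> \<sigma>'\<rbrakk> \<Longrightarrow> red X \<Gamma> (lsub \<tau> M) (sub \<sigma> M) (sub \<sigma>' M) A"
proof (induction arbitrary: \<Gamma> \<tau> \<sigma> \<sigma>' rule: has_type.induct)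
  case (ty_Lam A \<Delta> M B)
  then show ?case by simp (blast intro: red.rd_Lam wt_rsub_up)
next
  case (ty_App \<Delta> M A B N)
  then show ?case by simp (blast intro: red.rd_App)
next
  case (ty_Fst \<Delta> M A B)
  then show ?case by simp (blast intro: red.rd_Fst)
next
  case (ty_Snd \<Delta> M A B)
  then show ?case by simp (blast intro: red.rd_Snd)
qed (auto intro: red.intros simp: wt_rsub_def)

lemma red_hsub:
  assumes "red X \<Delta> P M M' A" "wt_rsub X \<Gamma> \<Delta> \<tau> \<sigma> \<sigma>'"
  shows "red X \<Gamma> (hsub P M' \<sigma> \<tau>) (sub \<sigma> M) (sub \<sigma>' M') A"
  unfolding hsub_def
  using assms red_has_type by (blast intro: rd_Comp red_rsub red_lsub wt_rsub_source)

text \<open>The \<beta>, \<eta>, product and unit equations relate reductions whose raw end points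
  agree only up to \<beta>\<eta>; \<open>rd_conv\<close> bridges the gap. The remaining equations
  are typed by the constructors directly.\<close>

lemma perm_red: "perm X \<Gamma> P Q M N A \<Longrightarrow> red X \<Gamma> P M N A \<and> red X \<Gamma> Q M N A"
proof (induction rule: perm.induct)
  case (pm_conv \<Gamma> P Q M N A M' N')
  then show ?case by (blast intro: rd_conv)
next
  case (pm_Op c Ps Qs Ms Ns \<Gamma>)
  then show ?case by (auto intro!: rd_Op)
next
  case (pm_App \<Gamma> P P' M M' A B Q Q' N N')
  then show ?case by (blast intro: rd_App)
next
  case (pm_Fst \<Gamma> P P' M M' A B)
  then show ?case by (blast intro: rd_Fst)
next
  case (pm_Snd \<Gamma> P P' M M' A B)
  then show ?case by (blast intro: rd_Snd)
next
  case (pm_Rule r L R Ps Qs Ms Ns \<Gamma>)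
  then show ?case by (auto intro!: rd_Rule)
next
  case (pm_Comp \<Gamma> P P' M1 M2 A Q Q' M3 M2')
  then show ?case using conv_has_type by (blast intro: rd_Comp rd_conv cv_refl dest: red_has_type)
next
  case (pm_assoc \<Gamma> P M1 M2 A Q M3 R M4)
  then show ?case by (blast intro: rd_Comp)
next
  case (pm_idl \<Gamma> P M N A)
  then show ?case by (blast intro: rd_Comp red_emb dest: red_has_type)
next
  case (pm_idr \<Gamma> P M N A)
  then show ?case by (blast intro: rd_Comp red_emb dest: red_has_type)
next
  case (pm_beta A \<Gamma> P M M' B Q N N')
  then have "red X \<Gamma> (RApp (RLam A P) Q) (App (Lam A M) N) (App (Lam A M') N') B"
    by (blast intro: rd_App rd_Lam)
  moreover have "conv X \<Gamma> (App (Lam A M) N) (sub (case_nat N Var) M) B"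
    "conv X \<Gamma> (App (Lam A M') N') (sub (case_nat N' Var) M') B"
    using pm_beta by (blast intro: cv_beta dest: red_has_type)+
  ultimately have "red X \<Gamma> (RApp (RLam A P) Q) (sub (case_nat N Var) M) (sub (case_nat N' Var) M') B"
    by (rule rd_conv)
  moreover have "red X \<Gamma> (hsub P M' (case_nat N Var) (case_nat Q RVar))
      (sub (case_nat N Var) M) (sub (case_nat N' Var) M') B"
    using pm_beta by (blast intro: red_hsub wt_rsub_case_nat wt_rsub_RVar)
  ultimately show ?case by blast
next
  case (pm_eta A \<Gamma> P M N B)
  then have "red X \<Gamma> (RLam A (RApp (rren Suc P) (RVar 0))) (Lam A (App (ren Suc M) (Var 0)))
      (Lam A (App (ren Suc N) (Var 0))) (Fun A B)"
    by (blast intro: rd_Lam rd_App red_rren_Suc red_RVar_0)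
  moreover have "conv X \<Gamma> (Lam A (App (ren Suc K) (Var 0))) K (Fun A B)" if "K = M \<or> K = N" for K
    using that pm_eta by (blast intro: cv_sym cv_eta dest: red_has_type)
  ultimately show ?case using pm_eta by (blast intro: rd_conv)
next
  case (pm_fst \<Gamma> P M M' A Q N N' B)
  then show ?case by (blast intro: rd_conv rd_Fst rd_Tup cv_fst dest: red_has_type)
next
  case (pm_snd \<Gamma> P M M' A Q N N' B)
  then show ?case by (blast intro: rd_conv rd_Snd rd_Tup cv_snd dest: red_has_type)
next
  case (pm_tup \<Gamma> P M N A B)
  then have "red X \<Gamma> (RTup (RFst P) (RSnd P)) (Tup (Fst M) (Snd M)) (Tup (Fst N) (Snd N)) (Prod A B)"
    by (blast intro: rd_Fst rd_Snd rd_Tup)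
  moreover have "conv X \<Gamma> (Tup (Fst K) (Snd K)) K (Prod A B)" if "K = M \<or> K = N" for K
    using that pm_tup by (blast intro: cv_sym cv_tup dest: red_has_type)
  ultimately show ?case using pm_tup by (blast intro: rd_conv)
next
  case (pm_star \<Gamma> P M N)
  then show ?case by (blast intro: rd_conv rd_Star cv_sym cv_star dest: red_has_type)
next
  case (pm_rule_left r L R Ps Qs Ns1 Ns2 Ns3 \<Gamma>)
  have "red X \<Gamma> (lsub (nth Ps) L) (sub (nth Ns1) L) (sub (nth Ns2) L) (rule_ty X r)"
    by (rule red_lsub[OF lhs_has_type wt_rsub_nth]) (use pm_rule_left in auto)
  moreover have "red X \<Gamma> (RRule r Qs) (sub (nth Ns2) L) (sub (nth Ns3) R) (rule_ty X r)"
    by (rule rd_Rule) (use pm_rule_left in auto)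
  moreover have "red X \<Gamma> (RRule r (vcomps Ps Ns2 Qs)) (sub (nth Ns1) L) (sub (nth Ns3) R) (rule_ty X r)"
    by (rule rd_Rule) (use pm_rule_left in \<open>auto intro: rd_Comp\<close>)
  ultimately show ?case by (blast intro: rd_Comp)
next
  case (pm_rule_right r L R Ps Qs Ns1 Ns2 Ns3 \<Gamma>)
  have "red X \<Gamma> (lsub (nth Qs) R) (sub (nth Ns2) R) (sub (nth Ns3) R) (rule_ty X r)"
    by (rule red_lsub[OF rhs_has_type wt_rsub_nth]) (use pm_rule_right in auto)
  moreover have "red X \<Gamma> (RRule r Ps) (sub (nth Ns1) L) (sub (nth Ns2) R) (rule_ty X r)"
    by (rule rd_Rule) (use pm_rule_right in auto)
  moreover have "red X \<Gamma> (RRule r (vcomps Ps Ns2 Qs)) (sub (nth Ns1) L) (sub (nth Ns3) R) (rule_ty X r)"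
    by (rule rd_Rule) (use pm_rule_right in \<open>auto intro: rd_Comp\<close>)
  ultimately show ?case by (blast intro: rd_Comp)
next
  case (pm_Op_Comp c Ps Qs Ns1 Ns2 Ns3 \<Gamma>)
  have "red X \<Gamma> (ROp c (vcomps Ps Ns2 Qs)) (Op c Ns1) (Op c Ns3) (op_cod X c)"
    by (rule rd_Op) (use pm_Op_Comp in \<open>auto intro: rd_Comp\<close>)
  moreover have "red X \<Gamma> (ROp c Ps) (Op c Ns1) (Op c Ns2) (op_cod X c)"
    "red X \<Gamma> (ROp c Qs) (Op c Ns2) (Op c Ns3) (op_cod X c)"
    using pm_Op_Comp by (auto intro!: rd_Op)
  ultimately show ?case by (blast intro: rd_Comp)
next
  case (pm_Lam_Comp A \<Gamma> P M1 M2 B Q M3)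
  then show ?case by (blast intro: rd_Comp rd_Lam)
next
  case (pm_App_Comp \<Gamma> P M1 M2 A B P' M3 Q N1 N2 Q' N3)
  then show ?case by (blast intro: rd_Comp rd_App)
next
  case (pm_Tup_Comp \<Gamma> P M1 M2 A P' M3 Q N1 N2 B Q' N3)
  then show ?case by (blast intro: rd_Comp rd_Tup)
next
  case (pm_Fst_Comp \<Gamma> P M1 M2 A B Q M3)
  then show ?case by (blast intro: rd_Comp rd_Fst)
next
  case (pm_Snd_Comp \<Gamma> P M1 M2 A B Q M3)
  then show ?case by (blast intro: rd_Comp rd_Snd)
qed (auto intro: red.intros)

section \<open>Permutation equivalence and substitution\<close>

text \<open>Each generating equation is stable under substitution of terms. Binders cost nothing
  extra, since the induction quantifies over all well-typed substitutions and
  \<open>wt_sub_up\<close> lifts them.\<close>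

lemma perm_rsub:
  "\<lbrakk>perm X \<Delta> P Q M N A; wt_sub X \<Gamma> \<Delta> \<sigma>\<rbrakk>
   \<Longrightarrow> perm X \<Gamma> (rsub \<sigma> P) (rsub \<sigma> Q) (sub \<sigma> M) (sub \<sigma> N) A"
proof (induction arbitrary: \<Gamma> \<sigma> rule: perm.induct)
  case (pm_refl \<Delta> P M N A)
  then show ?case by (blast intro: perm.pm_refl red_rsub)
next
  case (pm_sym \<Delta> P Q M N A)
  then show ?case by (blast intro: perm.pm_sym)
next
  case (pm_trans \<Delta> P Q M N A R)
  then show ?case by (blast intro: perm.pm_trans)
next
  case (pm_conv \<Delta> P Q M N A M' N')
  then show ?case by (blast intro: perm.pm_conv conv_sub)
next
  case (pm_Op c Ps Qs Ms Ns \<Delta>)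
  then show ?case by (auto intro!: perm.pm_Op)
next
  case (pm_Lam A \<Delta> P Q M N B)
  then show ?case by simp (blast intro: perm.pm_Lam wt_sub_up)
next
  case (pm_App \<Delta> P P' M M' A B Q Q' N N')
  then show ?case by simp (blast intro: perm.pm_App)
next
  case (pm_Tup \<Delta> P P' M M' A Q Q' N N' B)
  then show ?case by simp (blast intro: perm.pm_Tup)
next
  case (pm_Fst \<Delta> P P' M M' A B)
  then show ?case by simp (blast intro: perm.pm_Fst)
next
  case (pm_Snd \<Delta> P P' M M' A B)
  then show ?case by simp (blast intro: perm.pm_Snd)
next
  case (pm_Rule r L R Ps Qs Ms Ns \<Delta>)
  have "perm X \<Gamma> (RRule r (map (rsub \<sigma>) Ps)) (RRule r (map (rsub \<sigma>) Qs))
    (sub (nth (map (sub \<sigma>) Ms)) L) (sub (nth (map (sub \<sigma>) Ns)) R) (rule_ty X r)"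
    by (rule perm.pm_Rule) (use pm_Rule in auto)
  then show ?case
    using pm_Rule by (simp add: sub_sub_nth[OF lhs_has_type] sub_sub_nth[OF rhs_has_type])
next
  case (pm_Comp \<Delta> P P' M1 M2 A Q Q' M3 M2')
  then show ?case by simp (blast intro: perm.pm_Comp conv_sub)
next
  case (pm_assoc \<Delta> P M1 M2 A Q M3 R M4)
  then show ?case by simp (blast intro: perm.pm_assoc red_rsub)
next
  case (pm_idl \<Delta> P M N A)
  then show ?case by (simp add: rsub_emb) (blast intro: perm.pm_idl red_rsub)
next
  case (pm_idr \<Delta> P M N A)
  then show ?case by (simp add: rsub_emb) (blast intro: perm.pm_idr red_rsub)
next
  case (pm_beta A \<Delta> P M M' B Q N N')
  then show ?case
    by (simp add: rsub_hsub_beta sub_beta) (blast intro: perm.pm_beta red_rsub wt_sub_up)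
next
  case (pm_eta A \<Delta> P M N B)
  then show ?case by (simp add: rren_Suc_rsub) (blast intro: perm.pm_eta red_rsub)
next
  case (pm_fst \<Delta> P M M' A Q N N' B)
  then show ?case by simp (blast intro: perm.pm_fst red_rsub)
next
  case (pm_snd \<Delta> P M M' A Q N N' B)
  then show ?case by simp (blast intro: perm.pm_snd red_rsub)
next
  case (pm_tup \<Delta> P M N A B)
  then show ?case by simp (blast intro: perm.pm_tup red_rsub)
next
  case (pm_star \<Delta> P M N)
  then show ?case by simp (blast intro: perm.pm_star red_rsub)
next
  case (pm_rule_left r L R Ps Qs Ns1 Ns2 Ns3 \<Delta>)
  have "perm X \<Gamma> (RRule r (vcomps (map (rsub \<sigma>) Ps) (map (sub \<sigma>) Ns2) (map (rsub \<sigma>) Qs)))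
    (RComp (lsub (nth (map (rsub \<sigma>) Ps)) L) (sub (nth (map (sub \<sigma>) Ns2)) L)
      (RRule r (map (rsub \<sigma>) Qs)))
    (sub (nth (map (sub \<sigma>) Ns1)) L) (sub (nth (map (sub \<sigma>) Ns3)) R) (rule_ty X r)"
    by (rule perm.pm_rule_left) (use pm_rule_left red_rsub in auto)
  then show ?case
    using pm_rule_left
    by (simp add: sub_sub_nth[OF lhs_has_type] sub_sub_nth[OF rhs_has_type]
        rsub_lsub_nth[OF lhs_has_type] rsub_vcomps)
next
  case (pm_rule_right r L R Ps Qs Ns1 Ns2 Ns3 \<Delta>)
  have "perm X \<Gamma> (RRule r (vcomps (map (rsub \<sigma>) Ps) (map (sub \<sigma>) Ns2) (map (rsub \<sigma>) Qs)))
    (RComp (RRule r (map (rsub \<sigma>) Ps)) (sub (nth (map (sub \<sigma>) Ns2)) R)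
      (lsub (nth (map (rsub \<sigma>) Qs)) R))
    (sub (nth (map (sub \<sigma>) Ns1)) L) (sub (nth (map (sub \<sigma>) Ns3)) R) (rule_ty X r)"
    by (rule perm.pm_rule_right) (use pm_rule_right red_rsub in auto)
  then show ?case
    using pm_rule_right
    by (simp add: sub_sub_nth[OF lhs_has_type] sub_sub_nth[OF rhs_has_type]
        rsub_lsub_nth[OF rhs_has_type] rsub_vcomps)
next
  case (pm_Op_Comp c Ps Qs Ns1 Ns2 Ns3 \<Delta>)
  have "perm X \<Gamma> (ROp c (vcomps (map (rsub \<sigma>) Ps) (map (sub \<sigma>) Ns2) (map (rsub \<sigma>) Qs)))
    (RComp (ROp c (map (rsub \<sigma>) Ps)) (Op c (map (sub \<sigma>) Ns2)) (ROp c (map (rsub \<sigma>) Qs)))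
    (Op c (map (sub \<sigma>) Ns1)) (Op c (map (sub \<sigma>) Ns3)) (op_cod X c)"
    by (rule perm.pm_Op_Comp) (use pm_Op_Comp red_rsub in auto)
  then show ?case using pm_Op_Comp by (simp add: rsub_vcomps)
next
  case (pm_Lam_Comp A \<Delta> P M1 M2 B Q M3)
  then show ?case by simp (blast intro: perm.pm_Lam_Comp red_rsub wt_sub_up)
next
  case (pm_App_Comp \<Delta> P M1 M2 A B P' M3 Q N1 N2 Q' N3)
  then show ?case by simp (blast intro: perm.pm_App_Comp red_rsub)
next
  case (pm_Tup_Comp \<Delta> P M1 M2 A P' M3 Q N1 N2 B Q' N3)
  then show ?case by simp (blast intro: perm.pm_Tup_Comp red_rsub)
next
  case (pm_Fst_Comp \<Delta> P M1 M2 A B Q M3)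
  then show ?case by simp (blast intro: perm.pm_Fst_Comp red_rsub)
next
  case (pm_Snd_Comp \<Delta> P M1 M2 A B Q M3)
  then show ?case by simp (blast intro: perm.pm_Snd_Comp red_rsub)
qed

lemma perm_rren_Suc:
  "perm X \<Gamma> P Q M N A \<Longrightarrow> perm X (B # \<Gamma>) (rren Suc P) (rren Suc Q) (ren Suc M) (ren Suc N) A"
  by (simp add: rren_eq_rsub ren_eq_sub perm_rsub wt_sub_Suc)

section \<open>Substitution of reductions into terms\<close>

lemma wt_psub_up:
  "wt_psub X \<Gamma> \<Delta> \<tau> \<tau>' \<sigma> \<sigma>' \<Longrightarrow> wt_psub X (A # \<Gamma>) (A # \<Delta>) (rup \<tau>) (rup \<tau>') (up \<sigma>) (up \<sigma>')"
  unfolding wt_psub_def by (auto simp: less_Suc_eq_0_disj perm_rren_Suc red_RVar_0 intro: pm_refl)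

lemma perm_lsub_cong:
  "\<lbrakk>has_type X \<Delta> M A; wt_psub X \<Gamma> \<Delta> \<tau> \<tau>' \<sigma> \<sigma>'\<rbrakk>
   \<Longrightarrow> perm X \<Gamma> (lsub \<tau> M) (lsub \<tau>' M) (sub \<sigma> M) (sub \<sigma>' M) A"
proof (induction arbitrary: \<Gamma> \<tau> \<tau>' \<sigma> \<sigma>' rule: has_type.induct)
  case (ty_Star \<Delta>)
  then show ?case by (simp add: pm_refl rd_Star)
next
  case (ty_Op c Ms \<Delta>)
  then show ?case by (auto intro!: pm_Op)
next
  case (ty_Lam A \<Delta> M B)
  then show ?case by simp (blast intro: pm_Lam wt_psub_up)
next
  case (ty_App \<Delta> M A B N)
  then show ?case by simp (blast intro: pm_App)
next
  case (ty_Tup \<Delta> M A N B)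
  then show ?case by simp (blast intro: pm_Tup)
next
  case (ty_Fst \<Delta> M A B)
  then show ?case by simp (blast intro: pm_Fst)
next
  case (ty_Snd \<Delta> M A B)
  then show ?case by simp (blast intro: pm_Snd)
qed (simp add: wt_psub_def)

text \<open>Functoriality of M[-] for vertical composition: every term constructor commutes with
  composition, and the induction on M pushes the composite down to the variables.\<close>

lemma perm_lsub_comp:
  "\<lbrakk>has_type X \<Delta> M A; wt_rsub X \<Gamma> \<Delta> \<tau> \<sigma> \<sigma>'; wt_rsub X \<Gamma> \<Delta> \<tau>' \<sigma>' \<sigma>''\<rbrakk>
   \<Longrightarrow> perm X \<Gamma> (lsub (\<lambda>i. RComp (\<tau> i) (\<sigma>' i) (\<tau>' i)) M)
         (RComp (lsub \<tau> M) (sub \<sigma>' M) (lsub \<tau>' M)) (sub \<sigma> M) (sub \<sigma>'' M) A"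
proof (induction arbitrary: \<Gamma> \<tau> \<tau>' \<sigma> \<sigma>' \<sigma>'' rule: has_type.induct)
  case (ty_Var i \<Delta>)
  then have "red X \<Gamma> (\<tau> i) (\<sigma> i) (\<sigma>' i) (\<Delta> ! i)" "red X \<Gamma> (\<tau>' i) (\<sigma>' i) (\<sigma>'' i) (\<Delta> ! i)"
    by (simp_all add: wt_rsub_def)
  then show ?case by (simp add: pm_refl rd_Comp)
next
  case (ty_Star \<Delta>)
  show ?case using pm_sym[OF pm_idl[OF rd_Star[of X \<Gamma>]]] by simp
next
  case (ty_Op c Ms \<Delta>)
  let ?\<rho> = "\<lambda>i. RComp (\<tau> i) (\<sigma>' i) (\<tau>' i)"
  have "perm X \<Gamma> (ROp c (map (lsub ?\<rho>) Ms))
      (ROp c (vcomps (map (lsub \<tau>) Ms) (map (sub \<sigma>') Ms) (map (lsub \<tau>') Ms)))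
      (Op c (map (sub \<sigma>) Ms)) (Op c (map (sub \<sigma>'') Ms)) (op_cod X c)"
    by (rule pm_Op) (use ty_Op in auto)
  moreover have "perm X \<Gamma>
      (ROp c (vcomps (map (lsub \<tau>) Ms) (map (sub \<sigma>') Ms) (map (lsub \<tau>') Ms)))
      (RComp (ROp c (map (lsub \<tau>) Ms)) (Op c (map (sub \<sigma>') Ms)) (ROp c (map (lsub \<tau>') Ms)))
      (Op c (map (sub \<sigma>) Ms)) (Op c (map (sub \<sigma>'') Ms)) (op_cod X c)"
    by (rule pm_Op_Comp) (use ty_Op red_lsub in auto)
  ultimately show ?case by simp (rule pm_trans)
next
  case (ty_Lam A \<Delta> M B)
  let ?\<rho> = "\<lambda>i. RComp (\<tau> i) (\<sigma>' i) (\<tau>' i)"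
  let ?\<rho>' = "\<lambda>i. RComp (rup \<tau> i) (up \<sigma>' i) (rup \<tau>' i)"
  \<comment> \<open>Lifting and composing tuples commute only up to equivalence: at the bound
    variable the lifted composite is \<open>RVar 0\<close>, while the composite of the lifted tuples
    is \<open>RVar 0\<close> composed with itself. A unit law relates them.\<close>
  have "perm X (A # \<Gamma>) (rup ?\<rho> i) (?\<rho>' i) (up \<sigma> i) (up \<sigma>'' i) ((A # \<Delta>) ! i)"
    if "i < length (A # \<Delta>)" for i
  proof (cases i)
    case 0
    then show ?thesis using pm_sym[OF pm_idl[OF red_RVar_0[of A \<Gamma>]]] by simp
  next
    case (Suc j)
    then have "red X (A # \<Gamma>) (rup \<tau> i) (up \<sigma> i) (up \<sigma>' i) ((A # \<Delta>) ! i)"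
      "red X (A # \<Gamma>) (rup \<tau>' i) (up \<sigma>' i) (up \<sigma>'' i) ((A # \<Delta>) ! i)"
      using that wt_rsub_up ty_Lam.prems unfolding wt_rsub_def by blast+
    then show ?thesis using Suc by (simp add: pm_refl rd_Comp)
  qed
  then have *: "wt_psub X (A # \<Gamma>) (A # \<Delta>) (rup ?\<rho>) ?\<rho>' (up \<sigma>) (up \<sigma>'')"
    by (simp add: wt_psub_def)
  have up: "wt_rsub X (A # \<Gamma>) (A # \<Delta>) (rup \<tau>) (up \<sigma>) (up \<sigma>')"
    "wt_rsub X (A # \<Gamma>) (A # \<Delta>) (rup \<tau>') (up \<sigma>') (up \<sigma>'')"
    using ty_Lam.prems wt_rsub_up by blast+
  have "perm X (A # \<Gamma>) (lsub (rup ?\<rho>) M)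
      (RComp (lsub (rup \<tau>) M) (sub (up \<sigma>') M) (lsub (rup \<tau>') M))
      (sub (up \<sigma>) M) (sub (up \<sigma>'') M) B"
    by (rule pm_trans[OF perm_lsub_cong[OF ty_Lam(2) *] ty_Lam.IH[OF up]])
  then have "perm X \<Gamma> (RLam A (lsub (rup ?\<rho>) M))
      (RLam A (RComp (lsub (rup \<tau>) M) (sub (up \<sigma>') M) (lsub (rup \<tau>') M)))
      (Lam A (sub (up \<sigma>) M)) (Lam A (sub (up \<sigma>'') M)) (Fun A B)"
    using ty_Lam by (blast intro: pm_Lam)
  moreover have "perm X \<Gamma> (RLam A (RComp (lsub (rup \<tau>) M) (sub (up \<sigma>') M) (lsub (rup \<tau>') M)))
      (RComp (RLam A (lsub (rup \<tau>) M)) (Lam A (sub (up \<sigma>') M)) (RLam A (lsub (rup \<tau>') M)))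
      (Lam A (sub (up \<sigma>) M)) (Lam A (sub (up \<sigma>'') M)) (Fun A B)"
    using ty_Lam up by (blast intro: pm_Lam_Comp red_lsub)
  ultimately show ?case by simp (rule pm_trans)
next
  case (ty_App \<Delta> M A B N)
  then show ?case by simp (blast intro: pm_trans pm_App pm_App_Comp red_lsub)
next
  case (ty_Tup \<Delta> M A N B)
  then show ?case by simp (blast intro: pm_trans pm_Tup pm_Tup_Comp red_lsub)
next
  case (ty_Fst \<Delta> M A B)
  then show ?case by simp (blast intro: pm_trans pm_Fst pm_Fst_Comp red_lsub)
next
  case (ty_Snd \<Delta> M A B)
  then show ?case by simp (blast intro: pm_trans pm_Snd pm_Snd_Comp red_lsub)
qed

lemma rsub_case_nat_rup: "rsub (case_nat N Var) \<circ> rup \<tau> = case_nat (emb N) \<tau>"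
proof
  have "case_nat N Var \<circ> Suc = Var" by (rule ext) simp
  then show "(rsub (case_nat N Var) \<circ> rup \<tau>) i = case_nat (emb N) \<tau> i" for i
    by (cases i) (simp_all add: rsub_rren rsub_Var)
qed

lemma lsub_comp_case_nat: "lsub \<tau> \<circ> case_nat N Var = case_nat (lsub \<tau> N) \<tau>"
proof
  show "(lsub \<tau> \<circ> case_nat N Var) i = case_nat (lsub \<tau> N) \<tau> i" for i by (cases i) simp_all
qed

text \<open>\<open>pm_beta\<close> yields a composite that reduces the body first and the argument
  afterwards, whereas the right-hand side reduces both at once. Up to unit laws the tuple
  \<open>case_nat ?Q \<tau>\<close> factors as \<open>?t1\<close>, which keeps the argument fixed,
  followed by \<open>?t2\<close>, which moves only the argument; \<open>perm_lsub_comp\<close> then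
  joins the two stages.\<close>

lemma perm_lsub_beta:
  assumes A: "A \<in> types X" and M: "has_type X (A # \<Delta>) M B" and N: "has_type X \<Delta> N A"
    and \<tau>: "wt_rsub X \<Gamma> \<Delta> \<tau> \<sigma> \<sigma>'"
  shows "perm X \<Gamma> (lsub \<tau> (App (Lam A M) N)) (lsub \<tau> (sub (case_nat N Var) M))
    (sub \<sigma> (sub (case_nat N Var) M)) (sub \<sigma>' (sub (case_nat N Var) M)) B"
proof -
  let ?Q = "lsub \<tau> N" and ?N = "sub \<sigma> N" and ?N' = "sub \<sigma>' N"
  let ?t1 = "case_nat (emb ?N) \<tau>" and ?t2 = "case_nat ?Q (emb \<circ> \<sigma>')"
  let ?s = "case_nat ?N \<sigma>" and ?s1 = "case_nat ?N \<sigma>'" and ?s' = "case_nat ?N' \<sigma>'"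
  have Q: "red X \<Gamma> ?Q ?N ?N' A" using N \<tau> by (rule red_lsub)
  have "red X \<Gamma> (emb ?N) ?N ?N A" using red_emb red_has_type Q by blast
  then have t1: "wt_rsub X \<Gamma> (A # \<Delta>) ?t1 ?s ?s1" using \<tau> by (rule wt_rsub_case_nat)
  have t2: "wt_rsub X \<Gamma> (A # \<Delta>) ?t2 ?s1 ?s'"
    by (rule wt_rsub_case_nat[OF Q wt_rsub_emb[OF wt_rsub_target[OF \<tau>]]])
  have "perm X \<Gamma> (RApp (RLam A (lsub (rup \<tau>) M)) ?Q)
      (hsub (lsub (rup \<tau>) M) (sub (up \<sigma>') M) (case_nat ?N Var) (case_nat ?Q RVar))
      (sub (case_nat ?N Var) (sub (up \<sigma>) M)) (sub (case_nat ?N' Var) (sub (up \<sigma>') M)) B"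
    by (rule pm_beta[OF A red_lsub[OF M wt_rsub_up[OF \<tau>]] Q])
  then have 1: "perm X \<Gamma> (RApp (RLam A (lsub (rup \<tau>) M)) ?Q)
      (RComp (lsub ?t1 M) (sub ?s1 M) (lsub ?t2 M)) (sub ?s M) (sub ?s' M) B"
    by (simp add: hsub_def rsub_lsub rsub_case_nat_rup sub_sub sub_case_nat_up lsub_sub
        lsub_case_nat_up)
  have 2: "perm X \<Gamma> (lsub (\<lambda>i. RComp (?t1 i) (?s1 i) (?t2 i)) M)
      (RComp (lsub ?t1 M) (sub ?s1 M) (lsub ?t2 M)) (sub ?s M) (sub ?s' M) B"
    by (rule perm_lsub_comp[OF M t1 t2])
  have "perm X \<Gamma> (RComp (?t1 i) (?s1 i) (?t2 i)) (case_nat ?Q \<tau> i) (?s i) (?s' i) ((A # \<Delta>) ! i)"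
    if "i < length (A # \<Delta>)" for i
  proof (cases i)
    case 0
    then show ?thesis using pm_idl[OF Q] by simp
  next
    case (Suc j)
    then have "red X \<Gamma> (\<tau> j) (\<sigma> j) (\<sigma>' j) (\<Delta> ! j)" using that \<tau> by (simp add: wt_rsub_def)
    from pm_idr[OF this] show ?thesis using Suc by simp
  qed
  then have 3: "wt_psub X \<Gamma> (A # \<Delta>) (\<lambda>i. RComp (?t1 i) (?s1 i) (?t2 i)) (case_nat ?Q \<tau>) ?s ?s'"
    by (simp add: wt_psub_def)
  have "perm X \<Gamma> (RApp (RLam A (lsub (rup \<tau>) M)) ?Q) (lsub (case_nat ?Q \<tau>) M) (sub ?s M) (sub ?s' M) B"
    by (rule pm_trans[OF pm_trans[OF 1 pm_sym[OF 2]] perm_lsub_cong[OF M 3]])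
  then show ?thesis by (simp add: sub_sub sub_comp_case_nat lsub_sub lsub_comp_case_nat)
qed

text \<open>Every \<beta>\<eta> axiom for terms has a counterpart among the equations for
  reductions; only \<beta> needs more than that counterpart. As \<open>perm\<close> records raw end
  points, the cases that change the left term, such as symmetry and transitivity, pass through
  \<open>pm_conv\<close>.\<close>

lemma perm_lsub_conv:
  "\<lbrakk>conv X \<Delta> M N A; wt_rsub X \<Gamma> \<Delta> \<tau> \<sigma> \<sigma>'\<rbrakk>
   \<Longrightarrow> perm X \<Gamma> (lsub \<tau> M) (lsub \<tau> N) (sub \<sigma> M) (sub \<sigma>' M) A"
proof (induction arbitrary: \<Gamma> \<tau> \<sigma> \<sigma>' rule: conv.induct)
  case (cv_refl \<Delta> M A)
  then show ?case by (blast intro: pm_refl red_lsub)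
next
  case (cv_sym \<Delta> M N A)
  then show ?case
    by (blast intro: pm_conv pm_sym conv_sub wt_rsub_source wt_rsub_target)
next
  case (cv_trans \<Delta> M N A K)
  have "conv X \<Gamma> (sub \<sigma> N) (sub \<sigma> M) A" "conv X \<Gamma> (sub \<sigma>' N) (sub \<sigma>' M) A"
    using cv_trans by (blast intro: conv.cv_sym conv_sub wt_rsub_source wt_rsub_target)+
  then show ?case using cv_trans by (blast intro: pm_conv pm_trans)
next
  case (cv_Op c Ms Ns \<Delta>)
  then show ?case by (auto intro!: pm_Op)
next
  case (cv_Lam A \<Delta> M N B)
  then show ?case by simp (blast intro: pm_Lam wt_rsub_up)
next
  case (cv_App \<Delta> M M' A B N N')
  then show ?case by simp (blast intro: pm_App)
next
  case (cv_Tup \<Delta> M M' A N N' B)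
  then show ?case by simp (blast intro: pm_Tup)
next
  case (cv_Fst \<Delta> M M' A B)
  then show ?case by simp (blast intro: pm_Fst)
next
  case (cv_Snd \<Delta> M M' A B)
  then show ?case by simp (blast intro: pm_Snd)
next
  case (cv_beta A \<Delta> M B N)
  then have "conv X \<Delta> (sub (case_nat N Var) M) (App (Lam A M) N) B" by (blast intro: conv_beta)
  then show ?case
    using perm_lsub_beta[OF cv_beta]
    by (blast intro: pm_conv conv_sub wt_rsub_source wt_rsub_target cv_beta.prems)
next
  case (cv_eta A \<Delta> M B)
  have "lsub (rup \<tau>) (ren Suc M) = rren Suc (lsub \<tau> M)"
    by (simp add: lsub_ren rup_Suc rren_lsub)
  then show ?case
    using pm_eta[OF cv_eta(1) red_lsub[OF cv_eta(2,3)]] by simp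
next
  case (cv_fst \<Delta> M A N B)
  then have "perm X \<Gamma> (lsub \<tau> (Fst (Tup M N))) (lsub \<tau> M) (sub \<sigma> M) (sub \<sigma>' M) A"
    by simp (blast intro: pm_fst red_lsub)
  moreover have "conv X \<Delta> M (Fst (Tup M N)) A" using cv_fst by (blast intro: conv.cv_sym conv.cv_fst)
  ultimately show ?case using cv_fst(3)
    by (blast intro: pm_conv conv_sub wt_rsub_source wt_rsub_target)
next
  case (cv_snd \<Delta> M A N B)
  then have "perm X \<Gamma> (lsub \<tau> (Snd (Tup M N))) (lsub \<tau> N) (sub \<sigma> N) (sub \<sigma>' N) B"
    by simp (blast intro: pm_snd red_lsub)
  moreover have "conv X \<Delta> N (Snd (Tup M N)) B" using cv_snd by (blast intro: conv.cv_sym conv.cv_snd)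
  ultimately show ?case using cv_snd(3)
    by (blast intro: pm_conv conv_sub wt_rsub_source wt_rsub_target)
next
  case (cv_tup \<Delta> M A B)
  then show ?case by simp (blast intro: pm_tup red_lsub)
next
  case (cv_star \<Delta> M)
  then show ?case by simp (blast intro: pm_star red_lsub)
qed

text \<open>The identity tuple as a special case. It makes the identity 2-cell depend only on the
  class of its term.\<close>

lemma perm_emb: "conv X \<Gamma> M N A \<Longrightarrow> perm X \<Gamma> (emb M) (emb N) M M A"
  using perm_lsub_conv[OF _ wt_rsub_RVar] by (simp add: lsub_RVar sub_Var)

lemma perm_Comp:
  "\<lbrakk>perm X \<Gamma> P P' M1 M2 A; perm X \<Gamma> Q Q' M2 M3 A\<rbrakk>
   \<Longrightarrow> perm X \<Gamma> (RComp P M2 Q) (RComp P' M2 Q') M1 M3 A"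
  by (meson pm_Comp cv_refl perm_red red_has_type)

text \<open>Naturality of the substituted tuple with respect to P, the source of the interchange
  law. For a rule, both sides are decompositions of one application of \<open>r\<close>:
  \<open>pm_rule_right\<close> lets the rule fire first, \<open>pm_rule_left\<close> lets it fire
  last, and the induction hypotheses identify the two argument tuples. Operations, abstraction,
  application, pairing and projections follow the same pattern through their commutation with
  composition.\<close>

lemma perm_exchange:
  "\<lbrakk>red X \<Delta> P M M' A; wt_rsub X \<Gamma> \<Delta> \<tau> \<sigma> \<sigma>'\<rbrakk>
   \<Longrightarrow> perm X \<Gamma> (RComp (rsub \<sigma> P) (sub \<sigma> M') (lsub \<tau> M')) (RComp (lsub \<tau> M) (sub \<sigma>' M) (rsub \<sigma>' P))
         (sub \<sigma> M) (sub \<sigma>' M') A"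
proof (induction arbitrary: \<Gamma> \<tau> \<sigma> \<sigma>' rule: red.induct)
  case (rd_Var i \<Delta>)
  then have "red X \<Gamma> (\<tau> i) (\<sigma> i) (\<sigma>' i) (\<Delta> ! i)" by (simp add: wt_rsub_def)
  then show ?case by simp (blast intro: pm_idl pm_idr pm_sym pm_trans)
next
  case (rd_Star \<Delta>)
  show ?case by (simp add: pm_refl rd_Comp red.rd_Star)
next
  case (rd_Op c Ps Ms Ns \<Delta>)
  note ty = rd_Op.prems[THEN wt_rsub_source] rd_Op.prems[THEN wt_rsub_target]
  let ?P = "map (rsub \<sigma>) Ps" and ?P' = "map (rsub \<sigma>') Ps"
  let ?M = "map (lsub \<tau>) Ms" and ?N = "map (lsub \<tau>) Ns"
  let ?n = "map (sub \<sigma>) Ns" and ?m = "map (sub \<sigma>') Ms"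
  let ?s = "Op c (map (sub \<sigma>) Ms)" and ?t = "Op c (map (sub \<sigma>') Ns)"
  have h: "\<forall>i < length (op_dom X c). has_type X \<Delta> (Ms ! i) (op_dom X c ! i) \<and> has_type X \<Delta> (Ns ! i) (op_dom X c ! i)"
    using rd_Op red_has_type by blast
  have red: "\<forall>i < length (op_dom X c). red X \<Gamma> (?P ! i) (map (sub \<sigma>) Ms ! i) (?n ! i) (op_dom X c ! i)"
    "\<forall>i < length (op_dom X c). red X \<Gamma> (?P' ! i) (?m ! i) (map (sub \<sigma>') Ns ! i) (op_dom X c ! i)"
    "\<forall>i < length (op_dom X c). red X \<Gamma> (?N ! i) (?n ! i) (map (sub \<sigma>') Ns ! i) (op_dom X c ! i)"
    "\<forall>i < length (op_dom X c). red X \<Gamma> (?M ! i) (map (sub \<sigma>) Ms ! i) (?m ! i) (op_dom X c ! i)"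
    using rd_Op h ty by (auto intro: red_rsub red_lsub)
  have "perm X \<Gamma> (ROp c (vcomps ?P ?n ?N)) (RComp (ROp c ?P) (Op c ?n) (ROp c ?N)) ?s ?t (op_cod X c)"
    by (rule pm_Op_Comp) (use rd_Op red in auto)
  moreover have "perm X \<Gamma> (ROp c (vcomps ?M ?m ?P')) (RComp (ROp c ?M) (Op c ?m) (ROp c ?P')) ?s ?t
      (op_cod X c)"
    by (rule pm_Op_Comp) (use rd_Op red in auto)
  moreover have "perm X \<Gamma> (ROp c (vcomps ?P ?n ?N)) (ROp c (vcomps ?M ?m ?P')) ?s ?t (op_cod X c)"
    by (rule pm_Op) (use rd_Op in auto)
  ultimately show ?case by simp (blast intro: pm_sym pm_trans)
next
  case (rd_Lam A \<Delta> P M N B)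
  note up = wt_rsub_up[OF rd_Lam.prems, of A]
  note ty = up[THEN wt_rsub_source] up[THEN wt_rsub_target]
  have "perm X \<Gamma> (RLam A (RComp (rsub (up \<sigma>) P) (sub (up \<sigma>) N) (lsub (rup \<tau>) N)))
      (RComp (RLam A (rsub (up \<sigma>) P)) (Lam A (sub (up \<sigma>) N)) (RLam A (lsub (rup \<tau>) N)))
      (Lam A (sub (up \<sigma>) M)) (Lam A (sub (up \<sigma>') N)) (Fun A B)"
    using rd_Lam(1,2) up ty red_has_type by (blast intro: pm_Lam_Comp red_rsub red_lsub)
  moreover have "perm X \<Gamma> (RLam A (RComp (lsub (rup \<tau>) M) (sub (up \<sigma>') M) (rsub (up \<sigma>') P)))
      (RComp (RLam A (lsub (rup \<tau>) M)) (Lam A (sub (up \<sigma>') M)) (RLam A (rsub (up \<sigma>') P)))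
      (Lam A (sub (up \<sigma>) M)) (Lam A (sub (up \<sigma>') N)) (Fun A B)"
    using rd_Lam(1,2) up ty red_has_type by (blast intro: pm_Lam_Comp red_rsub red_lsub)
  moreover have "perm X \<Gamma> (RLam A (RComp (rsub (up \<sigma>) P) (sub (up \<sigma>) N) (lsub (rup \<tau>) N)))
      (RLam A (RComp (lsub (rup \<tau>) M) (sub (up \<sigma>') M) (rsub (up \<sigma>') P)))
      (Lam A (sub (up \<sigma>) M)) (Lam A (sub (up \<sigma>') N)) (Fun A B)"
    using rd_Lam.IH[OF up] rd_Lam(1) by (blast intro: pm_Lam)
  ultimately show ?case by simp (blast intro: pm_sym pm_trans)
next
  case (rd_App \<Delta> P M M' A B Q N N')
  note ty = rd_App.prems rd_App.prems[THEN wt_rsub_source] rd_App.prems[THEN wt_rsub_target]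
  note rds = red_rsub[OF rd_App(1)] red_rsub[OF rd_App(2)]
    red_lsub[of _ M "Fun A B"] red_lsub[of _ M' "Fun A B"] red_lsub[of _ N A] red_lsub[of _ N' A]
  have h: "has_type X \<Delta> M (Fun A B)" "has_type X \<Delta> M' (Fun A B)" "has_type X \<Delta> N A" "has_type X \<Delta> N' A"
    using rd_App(1,2) red_has_type by blast+
  have "perm X \<Gamma> (RApp (RComp (rsub \<sigma> P) (sub \<sigma> M') (lsub \<tau> M')) (RComp (rsub \<sigma> Q) (sub \<sigma> N') (lsub \<tau> N')))
      (RComp (RApp (rsub \<sigma> P) (rsub \<sigma> Q)) (App (sub \<sigma> M') (sub \<sigma> N')) (RApp (lsub \<tau> M') (lsub \<tau> N')))
      (App (sub \<sigma> M) (sub \<sigma> N)) (App (sub \<sigma>' M') (sub \<sigma>' N')) B"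
    using ty h by (blast intro: pm_App_Comp rds)
  moreover have "perm X \<Gamma> (RApp (RComp (lsub \<tau> M) (sub \<sigma>' M) (rsub \<sigma>' P)) (RComp (lsub \<tau> N) (sub \<sigma>' N) (rsub \<sigma>' Q)))
      (RComp (RApp (lsub \<tau> M) (lsub \<tau> N)) (App (sub \<sigma>' M) (sub \<sigma>' N)) (RApp (rsub \<sigma>' P) (rsub \<sigma>' Q)))
      (App (sub \<sigma> M) (sub \<sigma> N)) (App (sub \<sigma>' M') (sub \<sigma>' N')) B"
    using ty h by (blast intro: pm_App_Comp rds)
  moreover have "perm X \<Gamma>
      (RApp (RComp (rsub \<sigma> P) (sub \<sigma> M') (lsub \<tau> M')) (RComp (rsub \<sigma> Q) (sub \<sigma> N') (lsub \<tau> N')))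
      (RApp (RComp (lsub \<tau> M) (sub \<sigma>' M) (rsub \<sigma>' P)) (RComp (lsub \<tau> N) (sub \<sigma>' N) (rsub \<sigma>' Q)))
      (App (sub \<sigma> M) (sub \<sigma> N)) (App (sub \<sigma>' M') (sub \<sigma>' N')) B"
    using rd_App by (blast intro: pm_App)
  ultimately show ?case by simp (blast intro: pm_sym pm_trans)
next
  case (rd_Tup \<Delta> P M M' A Q N N' B)
  note ty = rd_Tup.prems rd_Tup.prems[THEN wt_rsub_source] rd_Tup.prems[THEN wt_rsub_target]
  note rds = red_rsub[OF rd_Tup(1)] red_rsub[OF rd_Tup(2)]
    red_lsub[of _ M A] red_lsub[of _ M' A] red_lsub[of _ N B] red_lsub[of _ N' B]
  have h: "has_type X \<Delta> M A" "has_type X \<Delta> M' A" "has_type X \<Delta> N B" "has_type X \<Delta> N' B"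
    using rd_Tup(1,2) red_has_type by blast+
  have "perm X \<Gamma> (RTup (RComp (rsub \<sigma> P) (sub \<sigma> M') (lsub \<tau> M')) (RComp (rsub \<sigma> Q) (sub \<sigma> N') (lsub \<tau> N')))
      (RComp (RTup (rsub \<sigma> P) (rsub \<sigma> Q)) (Tup (sub \<sigma> M') (sub \<sigma> N')) (RTup (lsub \<tau> M') (lsub \<tau> N')))
      (Tup (sub \<sigma> M) (sub \<sigma> N)) (Tup (sub \<sigma>' M') (sub \<sigma>' N')) (Prod A B)"
    using ty h by (blast intro: pm_Tup_Comp rds)
  moreover have "perm X \<Gamma> (RTup (RComp (lsub \<tau> M) (sub \<sigma>' M) (rsub \<sigma>' P)) (RComp (lsub \<tau> N) (sub \<sigma>' N) (rsub \<sigma>' Q)))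
      (RComp (RTup (lsub \<tau> M) (lsub \<tau> N)) (Tup (sub \<sigma>' M) (sub \<sigma>' N)) (RTup (rsub \<sigma>' P) (rsub \<sigma>' Q)))
      (Tup (sub \<sigma> M) (sub \<sigma> N)) (Tup (sub \<sigma>' M') (sub \<sigma>' N')) (Prod A B)"
    using ty h by (blast intro: pm_Tup_Comp rds)
  moreover have "perm X \<Gamma>
      (RTup (RComp (rsub \<sigma> P) (sub \<sigma> M') (lsub \<tau> M')) (RComp (rsub \<sigma> Q) (sub \<sigma> N') (lsub \<tau> N')))
      (RTup (RComp (lsub \<tau> M) (sub \<sigma>' M) (rsub \<sigma>' P)) (RComp (lsub \<tau> N) (sub \<sigma>' N) (rsub \<sigma>' Q)))
      (Tup (sub \<sigma> M) (sub \<sigma> N)) (Tup (sub \<sigma>' M') (sub \<sigma>' N')) (Prod A B)"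
    using rd_Tup by (blast intro: pm_Tup)
  ultimately show ?case by simp (blast intro: pm_sym pm_trans)
next
  case (rd_Fst \<Delta> P M M' A B)
  note ty = rd_Fst.prems rd_Fst.prems[THEN wt_rsub_source] rd_Fst.prems[THEN wt_rsub_target]
  have h: "has_type X \<Delta> M (Prod A B)" "has_type X \<Delta> M' (Prod A B)"
    using rd_Fst(1) red_has_type by blast+
  note rds = red_rsub[OF rd_Fst(1)] h[THEN red_lsub]
  have "perm X \<Gamma> (RFst (RComp (rsub \<sigma> P) (sub \<sigma> M') (lsub \<tau> M')))
      (RComp (RFst (rsub \<sigma> P)) (Fst (sub \<sigma> M')) (RFst (lsub \<tau> M'))) (Fst (sub \<sigma> M)) (Fst (sub \<sigma>' M')) A"
    using ty by (blast intro: pm_Fst_Comp rds)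
  moreover have "perm X \<Gamma> (RFst (RComp (lsub \<tau> M) (sub \<sigma>' M) (rsub \<sigma>' P)))
      (RComp (RFst (lsub \<tau> M)) (Fst (sub \<sigma>' M)) (RFst (rsub \<sigma>' P))) (Fst (sub \<sigma> M)) (Fst (sub \<sigma>' M')) A"
    using ty by (blast intro: pm_Fst_Comp rds)
  moreover have "perm X \<Gamma> (RFst (RComp (rsub \<sigma> P) (sub \<sigma> M') (lsub \<tau> M')))
      (RFst (RComp (lsub \<tau> M) (sub \<sigma>' M) (rsub \<sigma>' P))) (Fst (sub \<sigma> M)) (Fst (sub \<sigma>' M')) A"
    using rd_Fst by (blast intro: pm_Fst)
  ultimately show ?case by simp (blast intro: pm_sym pm_trans)
next
  case (rd_Snd \<Delta> P M M' A B)
  note ty = rd_Snd.prems rd_Snd.prems[THEN wt_rsub_source] rd_Snd.prems[THEN wt_rsub_target]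
  have h: "has_type X \<Delta> M (Prod A B)" "has_type X \<Delta> M' (Prod A B)"
    using rd_Snd(1) red_has_type by blast+
  note rds = red_rsub[OF rd_Snd(1)] h[THEN red_lsub]
  have "perm X \<Gamma> (RSnd (RComp (rsub \<sigma> P) (sub \<sigma> M') (lsub \<tau> M')))
      (RComp (RSnd (rsub \<sigma> P)) (Snd (sub \<sigma> M')) (RSnd (lsub \<tau> M'))) (Snd (sub \<sigma> M)) (Snd (sub \<sigma>' M')) B"
    using ty by (blast intro: pm_Snd_Comp rds)
  moreover have "perm X \<Gamma> (RSnd (RComp (lsub \<tau> M) (sub \<sigma>' M) (rsub \<sigma>' P)))
      (RComp (RSnd (lsub \<tau> M)) (Snd (sub \<sigma>' M)) (RSnd (rsub \<sigma>' P))) (Snd (sub \<sigma> M)) (Snd (sub \<sigma>' M')) B"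
    using ty by (blast intro: pm_Snd_Comp rds)
  moreover have "perm X \<Gamma> (RSnd (RComp (rsub \<sigma> P) (sub \<sigma> M') (lsub \<tau> M')))
      (RSnd (RComp (lsub \<tau> M) (sub \<sigma>' M) (rsub \<sigma>' P))) (Snd (sub \<sigma> M)) (Snd (sub \<sigma>' M')) B"
    using rd_Snd by (blast intro: pm_Snd)
  ultimately show ?case by simp (blast intro: pm_sym pm_trans)
next
  case (rd_Rule r L R Ps Ms Ns \<Delta>)
  note ty = rd_Rule.prems[THEN wt_rsub_source] rd_Rule.prems[THEN wt_rsub_target]
  let ?P = "map (rsub \<sigma>) Ps" and ?P' = "map (rsub \<sigma>') Ps"
  let ?M = "map (lsub \<tau>) Ms" and ?N = "map (lsub \<tau>) Ns"
  let ?n = "map (sub \<sigma>) Ns" and ?m = "map (sub \<sigma>') Ms"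
  let ?s = "sub (nth (map (sub \<sigma>) Ms)) L" and ?t = "sub (nth (map (sub \<sigma>') Ns)) R"
  have h: "\<forall>i < length (rule_ctx X r). has_type X \<Delta> (Ms ! i) (rule_ctx X r ! i) \<and> has_type X \<Delta> (Ns ! i) (rule_ctx X r ! i)"
    using rd_Rule red_has_type by blast
  have red: "\<forall>i < length (rule_ctx X r). red X \<Gamma> (?P ! i) (map (sub \<sigma>) Ms ! i) (?n ! i) (rule_ctx X r ! i)"
    "\<forall>i < length (rule_ctx X r). red X \<Gamma> (?P' ! i) (?m ! i) (map (sub \<sigma>') Ns ! i) (rule_ctx X r ! i)"
    "\<forall>i < length (rule_ctx X r). red X \<Gamma> (?N ! i) (?n ! i) (map (sub \<sigma>') Ns ! i) (rule_ctx X r ! i)"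
    "\<forall>i < length (rule_ctx X r). red X \<Gamma> (?M ! i) (map (sub \<sigma>) Ms ! i) (?m ! i) (rule_ctx X r ! i)"
    using rd_Rule h ty by (auto intro: red_rsub red_lsub)
  \<comment> \<open>Rule first: the arguments do \<open>?P\<close> inside the rule, and
    \<open>?N\<close> is pulled out to act in R. The next decomposition pulls \<open>?M\<close> out
    in front, to act in L.\<close>
  have "perm X \<Gamma> (RRule r (vcomps ?P ?n ?N)) (RComp (RRule r ?P) (sub (nth ?n) R) (lsub (nth ?N) R))
      ?s ?t (rule_ty X r)"
    by (rule pm_rule_right) (use rd_Rule red in auto)
  moreover have "perm X \<Gamma> (RRule r (vcomps ?M ?m ?P')) (RComp (lsub (nth ?M) L) (sub (nth ?m) L) (RRule r ?P'))
      ?s ?t (rule_ty X r)"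
    by (rule pm_rule_left) (use rd_Rule red in auto)
  moreover have "perm X \<Gamma> (RRule r (vcomps ?P ?n ?N)) (RRule r (vcomps ?M ?m ?P')) ?s ?t (rule_ty X r)"
    by (rule pm_Rule) (use rd_Rule in auto)
  ultimately have "perm X \<Gamma> (RComp (RRule r ?P) (sub (nth ?n) R) (lsub (nth ?N) R))
      (RComp (lsub (nth ?M) L) (sub (nth ?m) L) (RRule r ?P')) ?s ?t (rule_ty X r)"
    by (blast intro: pm_sym pm_trans)
  then show ?case
    using rd_Rule(1-6)
    by (simp add: sub_sub_nth[OF lhs_has_type] sub_sub_nth[OF rhs_has_type]
        lsub_sub_nth[OF lhs_has_type] lsub_sub_nth[OF rhs_has_type])
next
  case (rd_Comp \<Delta> P M1 M2 A Q M3)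
  note ty = rd_Comp.prems[THEN wt_rsub_source] rd_Comp.prems[THEN wt_rsub_target]
  have h: "has_type X \<Delta> M1 A" "has_type X \<Delta> M2 A" "has_type X \<Delta> M3 A"
    using rd_Comp(1,2) red_has_type by blast+
  note rds = red_rsub[OF rd_Comp(1)] red_rsub[OF rd_Comp(2)] h[THEN red_lsub]
  let ?P = "rsub \<sigma> P" and ?Q = "rsub \<sigma> Q" and ?P' = "rsub \<sigma>' P" and ?Q' = "rsub \<sigma>' Q"
  have r: "red X \<Gamma> ?P (sub \<sigma> M1) (sub \<sigma> M2) A" "red X \<Gamma> ?Q (sub \<sigma> M2) (sub \<sigma> M3) A"
    "red X \<Gamma> ?P' (sub \<sigma>' M1) (sub \<sigma>' M2) A" "red X \<Gamma> ?Q' (sub \<sigma>' M2) (sub \<sigma>' M3) A"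
    "red X \<Gamma> (lsub \<tau> M1) (sub \<sigma> M1) (sub \<sigma>' M1) A" "red X \<Gamma> (lsub \<tau> M2) (sub \<sigma> M2) (sub \<sigma>' M2) A"
    "red X \<Gamma> (lsub \<tau> M3) (sub \<sigma> M3) (sub \<sigma>' M3) A"
    using rds ty rd_Comp.prems by blast+
  \<comment> \<open>The exchange squares of P and Q are pasted along their common side
    \<open>lsub \<tau> M2\<close>; the rest is reassociation.\<close>
  have "perm X \<Gamma> (RComp (RComp ?P (sub \<sigma> M2) ?Q) (sub \<sigma> M3) (lsub \<tau> M3))
      (RComp ?P (sub \<sigma> M2) (RComp ?Q (sub \<sigma> M3) (lsub \<tau> M3))) (sub \<sigma> M1) (sub \<sigma>' M3) A"
    using r by (blast intro: pm_assoc)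
  moreover have "perm X \<Gamma> (RComp ?P (sub \<sigma> M2) (RComp ?Q (sub \<sigma> M3) (lsub \<tau> M3)))
      (RComp ?P (sub \<sigma> M2) (RComp (lsub \<tau> M2) (sub \<sigma>' M2) ?Q')) (sub \<sigma> M1) (sub \<sigma>' M3) A"
    using r rd_Comp by (blast intro: perm_Comp pm_refl)
  moreover have "perm X \<Gamma> (RComp (RComp ?P (sub \<sigma> M2) (lsub \<tau> M2)) (sub \<sigma>' M2) ?Q')
      (RComp ?P (sub \<sigma> M2) (RComp (lsub \<tau> M2) (sub \<sigma>' M2) ?Q')) (sub \<sigma> M1) (sub \<sigma>' M3) A"
    using r by (blast intro: pm_assoc)
  moreover have "perm X \<Gamma> (RComp (RComp ?P (sub \<sigma> M2) (lsub \<tau> M2)) (sub \<sigma>' M2) ?Q')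
      (RComp (RComp (lsub \<tau> M1) (sub \<sigma>' M1) ?P') (sub \<sigma>' M2) ?Q') (sub \<sigma> M1) (sub \<sigma>' M3) A"
    using r rd_Comp by (blast intro: perm_Comp pm_refl)
  moreover have "perm X \<Gamma> (RComp (RComp (lsub \<tau> M1) (sub \<sigma>' M1) ?P') (sub \<sigma>' M2) ?Q')
      (RComp (lsub \<tau> M1) (sub \<sigma>' M1) (RComp ?P' (sub \<sigma>' M2) ?Q')) (sub \<sigma> M1) (sub \<sigma>' M3) A"
    using r by (blast intro: pm_assoc)
  ultimately show ?case by simp (meson pm_sym pm_trans)
next
  case (rd_conv \<Delta> P M N A M' N')
  note ty = rd_conv.prems[THEN wt_rsub_source] rd_conv.prems[THEN wt_rsub_target]
  have c: "conv X \<Gamma> (sub \<sigma> M) (sub \<sigma> M') A" "conv X \<Gamma> (sub \<sigma>' M) (sub \<sigma>' M') A"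
    "conv X \<Gamma> (sub \<sigma> N) (sub \<sigma> N') A" "conv X \<Gamma> (sub \<sigma>' N) (sub \<sigma>' N') A"
    using rd_conv(2,3) ty conv_sub by blast+
  have r: "red X \<Gamma> (rsub \<sigma> P) (sub \<sigma> M) (sub \<sigma> N) A" "red X \<Gamma> (rsub \<sigma>' P) (sub \<sigma>' M) (sub \<sigma>' N) A"
    using rd_conv(1) ty red_rsub by blast+
  \<comment> \<open>P itself is unchanged here; only the legs \<open>lsub \<tau> N\<close> and
    \<open>lsub \<tau> M\<close> and the annotations depend on the chosen end points.\<close>
  have "perm X \<Gamma> (RComp (rsub \<sigma> P) (sub \<sigma> N) (lsub \<tau> N)) (RComp (rsub \<sigma> P) (sub \<sigma> N') (lsub \<tau> N'))
      (sub \<sigma> M) (sub \<sigma>' N) A"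
    using pm_Comp[OF pm_refl[OF r(1)] perm_lsub_conv[OF rd_conv(3) rd_conv.prems] c(3)] .
  moreover have "perm X \<Gamma> (RComp (lsub \<tau> M) (sub \<sigma>' M) (rsub \<sigma>' P)) (RComp (lsub \<tau> M') (sub \<sigma>' M') (rsub \<sigma>' P))
      (sub \<sigma> M) (sub \<sigma>' N) A"
    using pm_Comp[OF perm_lsub_conv[OF rd_conv(2) rd_conv.prems] pm_refl[OF r(2)] c(2)] .
  ultimately have "perm X \<Gamma> (RComp (rsub \<sigma> P) (sub \<sigma> N') (lsub \<tau> N'))
      (RComp (lsub \<tau> M') (sub \<sigma>' M') (rsub \<sigma>' P)) (sub \<sigma> M) (sub \<sigma>' N) A"
    using rd_conv by (meson pm_sym pm_trans)
  then show ?case using c by (blast intro: pm_conv)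
qed

text \<open>Exchange P with the identities \<open>emb \<circ> \<sigma>\<close>, typed as a tuple of
  reductions from \<sigma> to \<sigma>'. Both \<open>lsub\<close> legs become identities, and the
  unit laws leave exactly the two substituted reductions.\<close>

lemma perm_rsub_conv:
  assumes P: "red X \<Delta> P M M' A" and \<sigma>: "\<forall>i < length \<Delta>. conv X \<Gamma> (\<sigma> i) (\<sigma>' i) (\<Delta> ! i)"
  shows "perm X \<Gamma> (rsub \<sigma> P) (rsub \<sigma>' P) (sub \<sigma> M) (sub \<sigma> M') A"
proof -
  have \<tau>: "wt_rsub X \<Gamma> \<Delta> (emb \<circ> \<sigma>) \<sigma> \<sigma>'" using \<sigma> by (rule wt_rsub_emb_conv)
  have h: "has_type X \<Delta> M A" "has_type X \<Delta> M' A" using P red_has_type by blast+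
  have c: "conv X \<Gamma> (sub \<sigma>' M) (sub \<sigma> M) A" "conv X \<Gamma> (sub \<sigma>' M') (sub \<sigma> M') A"
    using h \<sigma> conv_sub_conv by (blast intro: cv_sym)+
  have r: "red X \<Gamma> (rsub \<sigma> P) (sub \<sigma> M) (sub \<sigma> M') A" "red X \<Gamma> (rsub \<sigma>' P) (sub \<sigma> M) (sub \<sigma> M') A"
    using red_rsub[OF P wt_rsub_source[OF \<tau>]] red_rsub[OF P wt_rsub_target[OF \<tau>]] c
    by (blast intro: rd_conv)+
  have e: "red X \<Gamma> (emb (sub \<sigma> M)) (sub \<sigma> M) (sub \<sigma> M) A"
    using r(1) red_has_type red_emb by blast
  have "perm X \<Gamma> (RComp (rsub \<sigma> P) (sub \<sigma> M') (emb (sub \<sigma> M')))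
      (RComp (emb (sub \<sigma> M)) (sub \<sigma>' M) (rsub \<sigma>' P)) (sub \<sigma> M) (sub \<sigma> M') A"
    using perm_exchange[OF P \<tau>] r(1) c
    by (simp add: lsub_emb) (meson pm_conv cv_refl red_has_type)
  \<comment> \<open>Exchange leaves the annotation \<open>sub \<sigma>' M\<close>, while
    \<open>pm_idl\<close> requires the same term as in the identity; \<open>pm_Comp\<close> permits
    the change.\<close>
  moreover have "perm X \<Gamma> (RComp (emb (sub \<sigma> M)) (sub \<sigma> M) (rsub \<sigma>' P))
      (RComp (emb (sub \<sigma> M)) (sub \<sigma>' M) (rsub \<sigma>' P)) (sub \<sigma> M) (sub \<sigma> M') A"
    by (rule pm_Comp[OF pm_refl[OF e] pm_refl[OF r(2)] cv_sym[OF c(1)]])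
  ultimately show ?thesis using pm_idr[OF r(1)] pm_idl[OF r(2)] by (meson pm_sym pm_trans)
qed

section \<open>Reductions and rewriting\<close>

lemma rew_red: "rew X \<Gamma> M N A \<Longrightarrow> \<exists>P. red X \<Gamma> P M N A"
proof (induction rule: rew.induct)
  case (rw_Rule r L R Ms \<Gamma>)
  then have "red X \<Gamma> (RRule r (map emb Ms)) (sub (nth Ms) L) (sub (nth Ms) R) (rule_ty X r)"
    by (intro rd_Rule) (auto intro: red_emb)
  then show ?case by blast
next
  case (rw_Op c Ms \<Gamma> j N)
  then obtain P where P: "red X \<Gamma> P (Ms ! j) N (op_dom X c ! j)" by blast
  have "red X \<Gamma> (ROp c ((map emb Ms)[j := P])) (Op c Ms) (Op c (Ms[j := N])) (op_cod X c)"
    by (rule rd_Op) (use rw_Op P in \<open>auto simp: nth_list_update red_emb\<close>)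
  then show ?case by blast
qed (blast intro: red_emb red.intros)+

lemma rew_has_type: "rew X \<Gamma> M N A \<Longrightarrow> has_type X \<Gamma> M A \<and> has_type X \<Gamma> N A"
  using rew_red red_has_type by blast

lemma rew_sub: "\<lbrakk>rew X \<Delta> M N A; wt_sub X \<Gamma> \<Delta> \<sigma>\<rbrakk> \<Longrightarrow> rew X \<Gamma> (sub \<sigma> M) (sub \<sigma> N) A"
proof (induction arbitrary: \<Gamma> \<sigma> rule: rew.induct)
  case (rw_Rule r L R Ms \<Delta>)
  have "rew X \<Gamma> (sub (nth (map (sub \<sigma>) Ms)) L) (sub (nth (map (sub \<sigma>) Ms)) R) (rule_ty X r)"
    by (rule rew.rw_Rule) (use rw_Rule in \<open>auto intro: has_type_sub\<close>)
  then show ?case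
    using rw_Rule by (simp add: sub_sub_nth[OF lhs_has_type] sub_sub_nth[OF rhs_has_type])
next
  case (rw_Op c Ms \<Delta> j N)
  have "rew X \<Gamma> (Op c (map (sub \<sigma>) Ms)) (Op c ((map (sub \<sigma>) Ms)[j := sub \<sigma> N])) (op_cod X c)"
    by (rule rew.rw_Op) (use rw_Op in \<open>auto intro: has_type_sub\<close>)
  then show ?case by (simp add: map_update)
next
  case (rw_conv \<Delta> M N A M' N')
  then show ?case by (blast intro: rew.rw_conv conv_sub)
qed (simp, blast intro: rew.intros has_type_sub wt_sub_up)+

text \<open>A step that may also be a bare conversion. On \<beta>\<eta>-classes the conversions
  become equalities, so the closure of this relation on raw terms corresponds to rewriting of
  classes.\<close>

abbreviation crew :: "'s ty list \<Rightarrow> 's ty \<Rightarrow> ('s, 'o) tm \<Rightarrow> ('s, 'o) tm \<Rightarrow> bool" where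
  "crew \<Gamma> A M N \<equiv> conv X \<Gamma> M N A \<or> rew X \<Gamma> M N A"

lemma rtranclp_mapI:
  assumes "r\<^sup>*\<^sup>* x y" "\<And>x y. r x y \<Longrightarrow> s (f x) (f y)"
  shows "s\<^sup>*\<^sup>* (f x) (f y)"
  using assms(1) by induction (auto intro: rtranclp.rtrancl_into_rtrancl assms(2))

text \<open>The typing premise is there for the reflexive part of the closure, which relates every
  raw term to itself, typed or not.\<close>

lemma crews_has_type: "\<lbrakk>(crew \<Gamma> A)\<^sup>*\<^sup>* M N; has_type X \<Gamma> M A\<rbrakk> \<Longrightarrow> has_type X \<Gamma> N A"
  by (induction rule: rtranclp_induct) (use conv_has_type rew_has_type in blast)+

section \<open>Sequentialising parallel steps\<close>

lemma crews_ren_Suc: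
  "(crew \<Gamma> A)\<^sup>*\<^sup>* M N \<Longrightarrow> (crew (B # \<Gamma>) A)\<^sup>*\<^sup>* (ren Suc M) (ren Suc N)"
  by (erule rtranclp_mapI) (auto simp: ren_eq_sub intro: conv_sub rew_sub wt_sub_Suc)

lemma crews_Lam:
  "\<lbrakk>A \<in> types X; (crew (A # \<Gamma>) B)\<^sup>*\<^sup>* M N\<rbrakk> \<Longrightarrow> (crew \<Gamma> (Fun A B))\<^sup>*\<^sup>* (Lam A M) (Lam A N)"
  by (erule rtranclp_mapI[where f = "Lam A"]) (auto intro: cv_Lam rw_Lam)

lemma crews_Fst: "(crew \<Gamma> (Prod A B))\<^sup>*\<^sup>* M N \<Longrightarrow> (crew \<Gamma> A)\<^sup>*\<^sup>* (Fst M) (Fst N)"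
  by (erule rtranclp_mapI[where f = Fst]) (blast intro: cv_Fst rw_Fst)

lemma crews_Snd: "(crew \<Gamma> (Prod A B))\<^sup>*\<^sup>* M N \<Longrightarrow> (crew \<Gamma> B)\<^sup>*\<^sup>* (Snd M) (Snd N)"
  by (erule rtranclp_mapI[where f = Snd]) (blast intro: cv_Snd rw_Snd)

text \<open>The function moves while the argument is still N, then the argument moves while the
  function is already M'; this is why these two terms carry the typing premises.\<close>

lemma crews_App:
  assumes "(crew \<Gamma> (Fun A B))\<^sup>*\<^sup>* M M'" "(crew \<Gamma> A)\<^sup>*\<^sup>* N N'" "has_type X \<Gamma> M' (Fun A B)" "has_type X \<Gamma> N A"
  shows "(crew \<Gamma> B)\<^sup>*\<^sup>* (App M N) (App M' N')"
proof -
  have "(crew \<Gamma> B)\<^sup>*\<^sup>* (App M N) (App M' N)"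
    using assms(1) by (rule rtranclp_mapI) (use assms(4) in \<open>blast intro: cv_App cv_refl rw_App1\<close>)
  moreover have "(crew \<Gamma> B)\<^sup>*\<^sup>* (App M' N) (App M' N')"
    using assms(2) by (rule rtranclp_mapI) (use assms(3) in \<open>blast intro: cv_App cv_refl rw_App2\<close>)
  ultimately show ?thesis by (rule rtranclp_trans)
qed

lemma crews_Tup:
  assumes "(crew \<Gamma> A)\<^sup>*\<^sup>* M M'" "(crew \<Gamma> B)\<^sup>*\<^sup>* N N'" "has_type X \<Gamma> M' A" "has_type X \<Gamma> N B"
  shows "(crew \<Gamma> (Prod A B))\<^sup>*\<^sup>* (Tup M N) (Tup M' N')"
proof -
  have "(crew \<Gamma> (Prod A B))\<^sup>*\<^sup>* (Tup M N) (Tup M' N)"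
    using assms(1) by (rule rtranclp_mapI) (use assms(4) in \<open>blast intro: cv_Tup cv_refl rw_Tup1\<close>)
  moreover have "(crew \<Gamma> (Prod A B))\<^sup>*\<^sup>* (Tup M' N) (Tup M' N')"
    using assms(2) by (rule rtranclp_mapI) (use assms(3) in \<open>blast intro: cv_Tup cv_refl rw_Tup2\<close>)
  ultimately show ?thesis by (rule rtranclp_trans)
qed

lemma crew_Op_update:
  assumes c: "c \<in> ops X" and len: "length Ks = length (op_dom X c)" and k: "k < length (op_dom X c)"
    and Ks: "\<forall>i < length (op_dom X c). has_type X \<Gamma> (Ks ! i) (op_dom X c ! i)"
    and r: "crew \<Gamma> (op_dom X c ! k) M N"
  shows "crew \<Gamma> (op_cod X c) (Op c (Ks[k := M])) (Op c (Ks[k := N]))"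
  using r
proof
  assume "conv X \<Gamma> M N (op_dom X c ! k)"
  then have "conv X \<Gamma> (Op c (Ks[k := M])) (Op c (Ks[k := N])) (op_cod X c)"
    using c len k Ks by (intro cv_Op) (auto simp: nth_list_update cv_refl)
  then show ?thesis by blast
next
  assume M: "rew X \<Gamma> M N (op_dom X c ! k)"
  then have "has_type X \<Gamma> M (op_dom X c ! k)" using rew_has_type by blast
  then have "rew X \<Gamma> (Op c (Ks[k := M])) (Op c ((Ks[k := M])[k := N])) (op_cod X c)"
    using c len k Ks M by (intro rw_Op) (auto simp: nth_list_update)
  then show ?thesis by simp
qed

lemma crews_Op:
  assumes c: "c \<in> ops X" and Ms: "length Ms = length (op_dom X c)" and Ns: "length Ns = length (op_dom X c)"
    and ty: "\<forall>i < length (op_dom X c). has_type X \<Gamma> (Ms ! i) (op_dom X c ! i)"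
    and r: "\<forall>i < length (op_dom X c). (crew \<Gamma> (op_dom X c ! i))\<^sup>*\<^sup>* (Ms ! i) (Ns ! i)"
  shows "(crew \<Gamma> (op_cod X c))\<^sup>*\<^sup>* (Op c Ms) (Op c Ns)"
proof -
  have Ns_ty: "\<forall>i < length (op_dom X c). has_type X \<Gamma> (Ns ! i) (op_dom X c ! i)"
    using ty r crews_has_type by blast
  \<comment> \<open>The arguments move one at a time from left to right; after k rounds the first k
    of them have reached their targets.\<close>
  have "(crew \<Gamma> (op_cod X c))\<^sup>*\<^sup>* (Op c Ms) (Op c (take k Ns @ drop k Ms))"
    if "k \<le> length (op_dom X c)" for k
    using that
  proof (induction k)
    case 0
    then show ?case by simp
  next
    case (Suc k)
    let ?K = "take k Ns @ drop k Ms"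
    have "(crew \<Gamma> (op_cod X c))\<^sup>*\<^sup>* (Op c (?K[k := Ms ! k])) (Op c (?K[k := Ns ! k]))"
    proof (rule rtranclp_mapI[where f = "\<lambda>x. Op c (?K[k := x])"])
      show "(crew \<Gamma> (op_dom X c ! k))\<^sup>*\<^sup>* (Ms ! k) (Ns ! k)" using r Suc by simp
      have "\<forall>i < length (op_dom X c). has_type X \<Gamma> (?K ! i) (op_dom X c ! i)"
        using Suc.prems Ms Ns ty Ns_ty by (auto simp: nth_append)
      then show "crew \<Gamma> (op_cod X c) (Op c (?K[k := M])) (Op c (?K[k := N]))"
        if "crew \<Gamma> (op_dom X c ! k) M N" for M N
        using c Suc Ms Ns that by (intro crew_Op_update) auto
    qed
    moreover have "?K[k := Ms ! k] = ?K" using Suc Ms Ns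
      by (simp add: list_update_same_conv nth_append)
    moreover have "?K[k := Ns ! k] = take (Suc k) Ns @ drop (Suc k) Ms" using Suc Ms Ns
      by (simp add: list_update_append take_Suc_conv_app_nth flip: Cons_nth_drop_Suc)
    ultimately show ?case using Suc by simp
  qed
  from this[of "length (op_dom X c)"] show ?thesis using Ms Ns by simp
qed

text \<open>In \<open>RRule r Ps\<close> the arguments reduce inside the left-hand side, where a
  variable may occur several times or under a binder. Induction on the term distributes the
  reduction of each \<sigma> i to all its occurrences.\<close>

lemma crews_sub:
  "\<lbrakk>has_type X \<Delta> M A; wt_sub X \<Gamma> \<Delta> \<sigma>; \<forall>i < length \<Delta>. (crew \<Gamma> (\<Delta> ! i))\<^sup>*\<^sup>* (\<sigma> i) (\<sigma>' i)\<rbrakk>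
   \<Longrightarrow> (crew \<Gamma> A)\<^sup>*\<^sup>* (sub \<sigma> M) (sub \<sigma>' M)"
proof (induction arbitrary: \<Gamma> \<sigma> \<sigma>' rule: has_type.induct)
  case (ty_Op c Ms \<Delta>)
  have "(crew \<Gamma> (op_cod X c))\<^sup>*\<^sup>* (Op c (map (sub \<sigma>) Ms)) (Op c (map (sub \<sigma>') Ms))"
    by (rule crews_Op) (use ty_Op in \<open>auto intro: has_type_sub\<close>)
  then show ?case by simp
next
  case (ty_Lam A \<Delta> M B)
  have "\<forall>i < length (A # \<Delta>). (crew (A # \<Gamma>) ((A # \<Delta>) ! i))\<^sup>*\<^sup>* (up \<sigma> i) (up \<sigma>' i)"
    using ty_Lam.prems by (auto simp: less_Suc_eq_0_disj crews_ren_Suc)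
  with ty_Lam have "(crew (A # \<Gamma>) B)\<^sup>*\<^sup>* (sub (up \<sigma>) M) (sub (up \<sigma>') M)"
    by (blast intro: wt_sub_up)
  then show ?case using ty_Lam(1) by simp (rule crews_Lam)
next
  case (ty_App \<Delta> M A B N)
  have "(crew \<Gamma> (Fun A B))\<^sup>*\<^sup>* (sub \<sigma> M) (sub \<sigma>' M)" "(crew \<Gamma> A)\<^sup>*\<^sup>* (sub \<sigma> N) (sub \<sigma>' N)"
    using ty_App by blast+
  then show ?case using ty_App(1,2) ty_App.prems
    by (simp) (blast intro: crews_App crews_has_type has_type_sub)
next
  case (ty_Tup \<Delta> M A N B)
  have "(crew \<Gamma> A)\<^sup>*\<^sup>* (sub \<sigma> M) (sub \<sigma>' M)" "(crew \<Gamma> B)\<^sup>*\<^sup>* (sub \<sigma> N) (sub \<sigma>' N)"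
    using ty_Tup by blast+
  then show ?case using ty_Tup(1,2) ty_Tup.prems
    by (simp) (blast intro: crews_Tup crews_has_type has_type_sub)
next
  case (ty_Fst \<Delta> M A B)
  then show ?case by simp (blast intro: crews_Fst)
next
  case (ty_Snd \<Delta> M A B)
  then show ?case by simp (blast intro: crews_Snd)
qed simp_all

lemma red_crews: "red X \<Gamma> P M N A \<Longrightarrow> (crew \<Gamma> A)\<^sup>*\<^sup>* M N"
proof (induction rule: red.induct)
  case (rd_Op c Ps Ms Ns \<Gamma>)
  then show ?case using red_has_type by (intro crews_Op) auto
next
  case (rd_Lam A \<Gamma> P M N B)
  then show ?case by (blast intro: crews_Lam)
next
  case (rd_App \<Gamma> P M M' A B Q N N')
  then show ?case using red_has_type by (blast intro: crews_App)
next
  case (rd_Tup \<Gamma> P M M' A Q N N' B)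
  then show ?case using red_has_type by (blast intro: crews_Tup)
next
  case (rd_Fst \<Gamma> P M M' A B)
  then show ?case by (blast intro: crews_Fst)
next
  case (rd_Snd \<Gamma> P M M' A B)
  then show ?case by (blast intro: crews_Snd)
next
  case (rd_Rule r L R Ps Ms Ns \<Gamma>)
  have "wt_sub X \<Gamma> (rule_ctx X r) (nth Ms)"
    using rd_Rule red_has_type by (auto simp: wt_sub_def)
  \<comment> \<open>A rule applied to reductions is serialised as arguments first, inside L,
    followed by a single root step at their targets.\<close>
  then have "(crew \<Gamma> (rule_ty X r))\<^sup>*\<^sup>* (sub (nth Ms) L) (sub (nth Ns) L)"
    using rd_Rule by (intro crews_sub[OF lhs_has_type]) auto
  moreover have "rew X \<Gamma> (sub (nth Ns) L) (sub (nth Ns) R) (rule_ty X r)"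
    by (rule rw_Rule) (use rd_Rule red_has_type in auto)
  then have "crew \<Gamma> (rule_ty X r) (sub (nth Ns) L) (sub (nth Ns) R)" by blast
  ultimately show ?case by (rule rtranclp.rtrancl_into_rtrancl)
next
  case (rd_Comp \<Gamma> P M1 M2 A Q M3)
  then show ?case by (meson rtranclp_trans)
next
  case (rd_conv \<Gamma> P M N A M' N')
  have M: "crew \<Gamma> A M' M" and N: "crew \<Gamma> A N N'" using rd_conv by (blast intro: cv_sym)+
  have "(crew \<Gamma> A)\<^sup>*\<^sup>* M' N"
    using M rd_conv.IH by (rule converse_rtranclp_into_rtranclp)
  then show ?case using N by (rule rtranclp.rtrancl_into_rtrancl)
qed simp_all

section \<open>Rewriting of \<beta>\<eta>-classes\<close>

abbreviation cls :: "'s ty list \<Rightarrow> 's ty \<Rightarrow> ('s, 'o) tm \<Rightarrow> ('s, 'o) tm set" where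
  "cls \<Gamma> A M \<equiv> conv_rel X \<Gamma> A `` {M}"

lemma cls_in_terms: "has_type X \<Gamma> M A \<Longrightarrow> cls \<Gamma> A M \<in> terms X \<Gamma> A"
  by (auto simp: terms_def intro: quotientI)

lemma in_cls: "N \<in> cls \<Gamma> A M \<longleftrightarrow> conv X \<Gamma> M N A"
  by (simp add: conv_rel_def)

lemma cls_eq: "conv X \<Gamma> M N A \<Longrightarrow> cls \<Gamma> A M = cls \<Gamma> A N"
  by (auto simp: conv_rel_def intro: cv_sym cv_trans)

lemma rew_rel_iff_red:
  assumes M: "has_type X \<Gamma> M A" and N: "has_type X \<Gamma> N A"
  shows "(cls \<Gamma> A M, cls \<Gamma> A N) \<in> (rew_rel X \<Gamma> A)\<^sup>* \<longleftrightarrow> (\<exists>P. red X \<Gamma> P M N A)"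
proof
  \<comment> \<open>All representatives of n are covered at once, because the next step may leave
    the class from a representative other than the one just reached.\<close>
  have "\<forall>N \<in> n. \<exists>P. red X \<Gamma> P M N A" if "(cls \<Gamma> A M, n) \<in> (rew_rel X \<Gamma> A)\<^sup>*" for n
    using that
  proof induction
    case base
    show ?case
    proof
      fix N assume "N \<in> cls \<Gamma> A M"
      then show "\<exists>P. red X \<Gamma> P M N A"
        unfolding in_cls using rd_conv[OF red_emb[OF M] cv_refl[OF M]] by blast
    qed
  next
    case (step n k)
    then obtain N K where NK: "N \<in> n" "K \<in> k" "rew X \<Gamma> N K A" and k: "k \<in> terms X \<Gamma> A"
      by (auto simp: rew_rel_def)
    obtain P Q where PQ: "red X \<Gamma> P M N A" "red X \<Gamma> Q N K A"
      using step NK rew_red by blast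
    then have PQ': "red X \<Gamma> (RComp P N Q) M K A" by (rule rd_Comp)
    show ?case
    proof
      fix K' assume "K' \<in> k"
      then have "conv X \<Gamma> K K' A"
        using k NK(2) by (auto simp: terms_def quotient_def conv_rel_def intro: cv_sym cv_trans)
      then show "\<exists>P. red X \<Gamma> P M K' A" using PQ' M by (blast intro: rd_conv cv_refl)
    qed
  qed
  then show "(cls \<Gamma> A M, cls \<Gamma> A N) \<in> (rew_rel X \<Gamma> A)\<^sup>* \<Longrightarrow> \<exists>P. red X \<Gamma> P M N A"
    using N by (metis in_cls cv_refl)
next
  assume "\<exists>P. red X \<Gamma> P M N A"
  then have "(crew \<Gamma> A)\<^sup>*\<^sup>* M N" using red_crews by blast
  then show "(cls \<Gamma> A M, cls \<Gamma> A N) \<in> (rew_rel X \<Gamma> A)\<^sup>*"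
  proof induction
    case (step N K)
    have "(cls \<Gamma> A N, cls \<Gamma> A K) \<in> (rew_rel X \<Gamma> A)\<^sup>*" using step(2)
    proof
      assume "conv X \<Gamma> N K A"
      then show ?thesis using cls_eq by simp
    next
      assume r: "rew X \<Gamma> N K A"
      then have "has_type X \<Gamma> N A" "has_type X \<Gamma> K A" using rew_has_type by blast+
      then have "(cls \<Gamma> A N, cls \<Gamma> A K) \<in> rew_rel X \<Gamma> A"
        using r cls_in_terms unfolding rew_rel_def by (auto simp: conv_rel_def intro!: exI cv_refl)
      then show ?thesis by blast
    qed
    then show ?case using step by (meson rtrancl_trans)
  qed simp
qed

section \<open>The 2-category of reductions\<close>

text \<open>Every 2-cell between represented morphisms has this form (\<open>hcellsE\<close>), so a
  law between 2-cells comes down to one \<open>perm\<close> judgement through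
  \<open>hc_eqI\<close>.\<close>

abbreviation hc ::
  "'s ty \<Rightarrow> 's ty \<Rightarrow> ('s, 'o) tm \<Rightarrow> ('s, 'o) tm \<Rightarrow> ('s, 'o, 'r) rd \<Rightarrow> ('s, 'o, 'r) hcell" where
  "hc A B M N P \<equiv> (mor_of X A M B, perm_rel X [A] M N B `` {P}, mor_of X A N B)"

section \<open>Substitution for a single variable\<close>

lemma wt_sub_single: "has_type X \<Gamma> M A \<Longrightarrow> wt_sub X \<Gamma> [A] (nth [M])"
  by (simp add: wt_sub_def)

lemma wt_rsub_single: "red X \<Gamma> P M N A \<Longrightarrow> wt_rsub X \<Gamma> [A] (nth [P]) (nth [M]) (nth [N])"
  by (simp add: wt_rsub_def)

lemma wt_psub_single:
  "perm X \<Gamma> P Q M N A \<Longrightarrow> wt_psub X \<Gamma> [A] (nth [P]) (nth [Q]) (nth [M]) (nth [N])"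
  by (simp add: wt_psub_def)

lemma has_type_single: "\<lbrakk>has_type X [B] N D; has_type X \<Gamma> M B\<rbrakk> \<Longrightarrow> has_type X \<Gamma> (sub (nth [M]) N) D"
  by (blast intro: has_type_sub wt_sub_single)

lemma has_type_Var_0: "has_type X (A # \<Gamma>) (Var 0) A"
  using ty_Var[of 0 "A # \<Gamma>" X] by simp

lemma has_type_Var_1: "has_type X (A # B # \<Gamma>) (Var (Suc 0)) B"
  using ty_Var[of "Suc 0" "A # B # \<Gamma>" X] by simp

lemma has_type_Fst_0: "has_type X (Prod A B # \<Gamma>) (Fst (Var 0)) A"
  by (rule ty_Fst[OF has_type_Var_0])

lemma has_type_Snd_0: "has_type X (Prod A B # \<Gamma>) (Snd (Var 0)) B"
  by (rule ty_Snd[OF has_type_Var_0])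

lemma has_type_swap: "has_type X (A # B # \<Gamma>) (Tup (Var (Suc 0)) (Var 0)) (Prod B A)"
  by (rule ty_Tup[OF has_type_Var_1 has_type_Var_0])

lemma sub_single_Var: "has_type X [A] M B \<Longrightarrow> sub (nth [Var 0]) M = M"
  using sub_cong_typed[of X "[A]" M B "nth [Var 0]" Var] by (simp add: sub_Var)

lemma sub_single_sub:
  "has_type X [B] N D \<Longrightarrow> sub \<sigma> (sub (nth [M]) N) = sub (nth [sub \<sigma> M]) N"
  by (subst sub_sub_nth) auto

lemma rsub_single_Var: "red X [A] P M N B \<Longrightarrow> rsub (nth [Var 0]) P = P"
  using rsub_cong_typed[of "[A]" P M N B "nth [Var 0]" Var] by (simp add: rsub_Var)

lemma rsub_single_rsub:
  "red X [B] P M N D \<Longrightarrow> rsub \<sigma> (rsub (nth [K]) P) = rsub (nth [sub \<sigma> K]) P"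
  by (simp add: rsub_rsub) (rule rsub_cong_typed, auto)

lemma lsub_single_emb: "has_type X [B] N D \<Longrightarrow> lsub (nth [emb M]) N = emb (sub (nth [M]) N)"
  using lsub_cong_typed[of X "[B]" N D "nth [emb M]" "emb \<circ> nth [M]"] by (simp add: lsub_emb)

text \<open>Makes horizontal composition well defined on classes. \<open>hsub\<close> mentions P,
  its target, the tuple and the source of the tuple, and all four may vary: the first leg uses
  \<open>perm_rsub\<close> and \<open>perm_rsub_conv\<close>, the second
  \<open>perm_lsub_cong\<close> and \<open>perm_lsub_conv\<close>.\<close>

lemma perm_hsub:
  assumes P: "perm X \<Delta> P P' M M' A" and M: "conv X \<Delta> M' M1 A"
    and \<tau>: "wt_psub X \<Gamma> \<Delta> \<tau> \<tau>' \<sigma> \<sigma>'" and \<sigma>: "\<forall>i < length \<Delta>. conv X \<Gamma> (\<sigma> i) (\<sigma>1 i) (\<Delta> ! i)"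
  shows "perm X \<Gamma> (hsub P M' \<sigma> \<tau>) (hsub P' M1 \<sigma>1 \<tau>') (sub \<sigma> M) (sub \<sigma>' M') A"
proof -
  have r: "red X \<Delta> P' M M' A" using P perm_red by blast
  have s: "wt_sub X \<Gamma> \<Delta> \<sigma>" using \<sigma> conv_has_type unfolding wt_sub_def by blast
  have t: "wt_rsub X \<Gamma> \<Delta> \<tau>' \<sigma> \<sigma>'" using \<tau> perm_red unfolding wt_psub_def wt_rsub_def by blast
  have 1: "perm X \<Gamma> (rsub \<sigma> P) (rsub \<sigma>1 P') (sub \<sigma> M) (sub \<sigma> M') A"
    by (rule pm_trans[OF perm_rsub[OF P s] perm_rsub_conv[OF r \<sigma>]])
  have "has_type X \<Delta> M' A" using M conv_has_type by blast
  then have 2: "perm X \<Gamma> (lsub \<tau> M') (lsub \<tau>' M1) (sub \<sigma> M') (sub \<sigma>' M') A"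
    by (rule pm_trans[OF perm_lsub_cong[OF _ \<tau>] perm_lsub_conv[OF M t]])
  show ?thesis
    unfolding hsub_def by (rule pm_Comp[OF 1 2 conv_sub2[OF M \<sigma>]])
qed

section \<open>Morphisms represented by terms\<close>

lemma mhomI: "has_type X [A] M B \<Longrightarrow> mor_of X A M B \<in> mhom X A B"
  by (auto simp: mhom_def mor_of_def cls_in_terms)

lemma mhomE:
  assumes "f \<in> mhom X A B"
  obtains M where "has_type X [A] M B" "f = mor_of X A M B"
  using assms by (auto simp: mhom_def mor_of_def terms_def quotient_def)

lemma mor_eq_iff:
  assumes "has_type X [A] M B" "has_type X [A] N B"
  shows "mor_of X A M B = mor_of X A N B \<longleftrightarrow> conv X [A] M N B"
proof
  assume "mor_of X A M B = mor_of X A N B"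
  then have "N \<in> cls [A] B M" using assms(2) by (simp add: mor_of_def conv_rel_def cv_refl)
  then show "conv X [A] M N B" by (simp only: in_cls)
qed (simp add: mor_of_def cls_eq)

lemma mor_eqI: "conv X [A] M N B \<Longrightarrow> mor_of X A M B = mor_of X A N B"
  by (simp add: mor_of_def cls_eq)

lemma mcomp_mor:
  assumes M: "has_type X [A] M B" and N: "has_type X [B] N D"
  shows "mcomp X (mor_of X B N D) (mor_of X A M B) = mor_of X A (sub (nth [M]) N) D"
proof -
  let ?S = "{sub (nth [M']) N' | M' N'. M' \<in> cls [A] B M \<and> N' \<in> cls [B] D N}"
  have 1: "conv X [A] (sub (nth [M]) N) (sub (nth [M']) N') D"
    if "conv X [A] M M' B" "conv X [B] N N' D" for M' N'
    by (rule conv_sub2[OF that(2)]) (use that(1) in simp)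
  have "conv_rel X [A] D `` ?S = cls [A] D (sub (nth [M]) N)"
  proof
    show "conv_rel X [A] D `` ?S \<subseteq> cls [A] D (sub (nth [M]) N)"
      using 1 by (auto simp: conv_rel_def intro: cv_trans)
    have "M \<in> cls [A] B M" "N \<in> cls [B] D N"
      using M N by (simp_all only: in_cls cv_refl)
    then have "sub (nth [M]) N \<in> ?S" by blast
    then show "cls [A] D (sub (nth [M]) N) \<subseteq> conv_rel X [A] D `` ?S" by blast
  qed
  then show ?thesis by (simp add: mor_of_def)
qed

section \<open>2-cells represented by reductions\<close>

lemma in_perm_rel: "Q \<in> perm_rel X \<Gamma> M N A `` {P} \<longleftrightarrow> perm X \<Gamma> P Q M N A"
  by (simp add: perm_rel_def)

lemma perm_rel_conv:
  assumes "conv X \<Gamma> M M' A" "conv X \<Gamma> N N' A"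
  shows "perm_rel X \<Gamma> M N A = perm_rel X \<Gamma> M' N' A"
  using assms unfolding perm_rel_def by (blast intro: pm_conv cv_sym)

lemma hc_conv: "\<lbrakk>conv X [A] M M' B; conv X [A] N N' B\<rbrakk> \<Longrightarrow> hc A B M N P = hc A B M' N' P"
  using perm_rel_conv[of "[A]" M M' B N N'] by (simp add: mor_eqI)

lemma hc_eqI: "perm X [A] P Q M N B \<Longrightarrow> hc A B M N P = hc A B M N Q"
  by (auto simp: perm_rel_def intro: pm_sym pm_trans)

text \<open>Typing of Q guarantees that its class is inhabited; for two ill-typed reductions both
  classes would be empty and hence equal.\<close>

lemma hc_eqD:
  assumes "hc A B M N P = hc A B M N Q" "red X [A] Q M N B"
  shows "perm X [A] P Q M N B"
proof -
  have "Q \<in> perm_rel X [A] M N B `` {Q}" using assms(2) by (simp add: perm_rel_def pm_refl)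
  with assms(1) have "Q \<in> perm_rel X [A] M N B `` {P}" by simp
  then show ?thesis by (simp add: perm_rel_def)
qed

lemma hcellsI: "red X [A] P M N B \<Longrightarrow> hc A B M N P \<in> hcells X (mor_of X A M B) (mor_of X A N B)"
  by (auto simp: mor_of_def conv_rel_def intro!: exI quotientI cv_refl dest: red_has_type)

lemma hcellsE:
  assumes "\<alpha> \<in> hcells X (mor_of X A M B) (mor_of X A N B)"
  obtains P where "red X [A] P M N B" "\<alpha> = hc A B M N P"
proof -
  from assms obtain p M' N' where \<alpha>: "\<alpha> = (mor_of X A M B, p, mor_of X A N B)"
    and c: "conv X [A] M M' B" "conv X [A] N N' B"
    and p: "p \<in> {P. red X [A] P M' N' B} // perm_rel X [A] M' N' B"
    by (auto simp: mor_of_def conv_rel_def)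
  from p obtain P where P: "red X [A] P M' N' B" "p = perm_rel X [A] M' N' B `` {P}"
    by (auto elim: quotientE)
  show thesis
  proof (rule that)
    show "red X [A] P M N B" using P c by (blast intro: rd_conv cv_sym)
    show "\<alpha> = hc A B M N P" using \<alpha> P perm_rel_conv[OF c] by simp
  qed
qed

text \<open>The operations on 2-cells are unions over all representatives. Here, and in the
  computations of vertical and horizontal composites below, independence of the choices shows that
  the union is a single class.\<close>

lemma hid_mor:
  assumes "has_type X [A] M B"
  shows "hid X (mor_of X A M B) = hc A B M M (emb M)"
proof -
  have "perm X [A] (emb M) Q M M B" if "conv X [A] M M' B" "perm X [A] (emb M') Q M' M' B" for M' Q
    using that perm_emb by (meson pm_trans pm_conv cv_sym)
  then have "{Q. \<exists>M' \<in> cls [A] B M. perm X [A] (emb M') Q M' M' B} = perm_rel X [A] M M B `` {emb M}"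
    using cv_refl[OF assms] by (intro set_eqI) (simp only: mem_Collect_eq Bex_def in_cls in_perm_rel, blast)
  then show ?thesis by (simp add: mor_of_def)
qed

lemma hvert_hc:
  assumes P: "red X [A] P M N B" and Q: "red X [A] Q N K B"
  shows "hvert X (hc A B M N P) (hc A B N K Q) = hc A B M K (RComp P N Q)"
proof -
  have h: "has_type X [A] M B" "has_type X [A] N B" "has_type X [A] K B"
    using P Q red_has_type by blast+
  have "perm X [A] (RComp P N Q) S M K B"
    if S: "perm X [A] (RComp P' N' Q') S M' K' B"
      and c: "conv X [A] M M' B" "conv X [A] N N' B" "conv X [A] K K' B"
      and p: "perm X [A] P P' M N B" "perm X [A] Q Q' N K B" for M' N' K' P' Q' S
  proof -
    have "perm X [A] (RComp P N Q) (RComp P' N' Q') M K B" using p c by (blast intro: pm_Comp)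
    then show ?thesis using S c by (meson cv_sym pm_conv pm_trans)
  qed
  then have "{S. \<exists>M1 \<in> cls [A] B M. \<exists>M2 \<in> cls [A] B N. \<exists>M3 \<in> cls [A] B K.
      \<exists>P' \<in> perm_rel X [A] M N B `` {P}. \<exists>Q' \<in> perm_rel X [A] N K B `` {Q}.
        perm X [A] (RComp P' M2 Q') S M1 M3 B} = perm_rel X [A] M K B `` {RComp P N Q}"
    using h[THEN cv_refl] pm_refl[OF P] pm_refl[OF Q]
    by (intro set_eqI) (simp only: mem_Collect_eq Bex_def in_cls in_perm_rel, blast)
  then show ?thesis by (simp add: mor_of_def)
qed

lemma hhor_hc:
  assumes P: "red X [B] P M M' D" and Q: "red X [A] Q N N' B"
  shows "hhor X (hc B D M M' P) (hc A B N N' Q) =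
    hc A D (sub (nth [N]) M) (sub (nth [N']) M') (hsub P M' (nth [N]) (nth [Q]))"
proof -
  have h: "has_type X [B] M D" "has_type X [B] M' D" "has_type X [A] N B" "has_type X [A] N' B"
    using P Q red_has_type by blast+
  have "perm X [A] (hsub P M' (nth [N]) (nth [Q])) S (sub (nth [N]) M) (sub (nth [N']) M') D"
    if S: "perm X [A] (hsub P1 M1' (nth [N1]) (nth [Q1])) S (sub (nth [N1]) M1) (sub (nth [N1']) M1') D"
      and c: "conv X [B] M M1 D" "conv X [B] M' M1' D" "conv X [A] N N1 B" "conv X [A] N' N1' B"
      and p: "perm X [B] P P1 M M' D" "perm X [A] Q Q1 N N' B" for M1 M1' N1 N1' P1 Q1 S
  proof -
    have "perm X [A] (hsub P M' (nth [N]) (nth [Q])) (hsub P1 M1' (nth [N1]) (nth [Q1]))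
        (sub (nth [N]) M) (sub (nth [N']) M') D"
      by (rule perm_hsub[OF p(1) c(2) wt_psub_single[OF p(2)]]) (use c in simp)
    moreover have "conv X [A] (sub (nth [N]) M) (sub (nth [N1]) M1) D"
      "conv X [A] (sub (nth [N']) M') (sub (nth [N1']) M1') D"
      using c by (auto intro!: conv_sub2)
    ultimately show ?thesis using S by (meson cv_sym pm_conv pm_trans)
  qed
  then have "{S. \<exists>M1 \<in> cls [B] D M. \<exists>M1' \<in> cls [B] D M'. \<exists>N1 \<in> cls [A] B N. \<exists>N1' \<in> cls [A] B N'.
      \<exists>P1 \<in> perm_rel X [B] M M' D `` {P}. \<exists>Q1 \<in> perm_rel X [A] N N' B `` {Q}.
        perm X [A] (hsub P1 M1' (nth [N1]) (nth [Q1])) S (sub (nth [N1]) M1) (sub (nth [N1']) M1') D} =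
      perm_rel X [A] (sub (nth [N]) M) (sub (nth [N']) M') D `` {hsub P M' (nth [N]) (nth [Q])}"
    using h[THEN cv_refl] pm_refl[OF P] pm_refl[OF Q]
    by (intro set_eqI) (simp only: mem_Collect_eq Bex_def in_cls in_perm_rel, blast)
  moreover have "mcomp X (mor_of X B M D) (mor_of X A N B) = mor_of X A (sub (nth [N]) M) D"
    "mcomp X (mor_of X B M' D) (mor_of X A N' B) = mor_of X A (sub (nth [N']) M') D"
    using h mcomp_mor by blast+
  ultimately show ?thesis by (simp add: mor_of_def del: mcomp.simps)
qed

lemma red_hsub_single:
  "\<lbrakk>red X [B] P M M' D; red X \<Gamma> Q N N' B\<rbrakk>
   \<Longrightarrow> red X \<Gamma> (hsub P M' (nth [N]) (nth [Q])) (sub (nth [N]) M) (sub (nth [N']) M') D"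
  by (blast intro: red_hsub wt_rsub_single)

text \<open>When one factor is an identity, the corresponding leg of \<open>hsub\<close> is an
  identity and disappears by a unit law. Projections and evaluation act on 2-cells in this
  way.\<close>

lemma hhor_whisker_left:
  assumes M: "has_type X [B] M D" and Q: "red X [A] Q N N' B"
  shows "hhor X (hid X (mor_of X B M D)) (hc A B N N' Q) =
    hc A D (sub (nth [N]) M) (sub (nth [N']) M) (lsub (nth [Q]) M)"
proof -
  have "perm X [A] (RComp (emb (sub (nth [N]) M)) (sub (nth [N]) M) (lsub (nth [Q]) M)) (lsub (nth [Q]) M)
      (sub (nth [N]) M) (sub (nth [N']) M) D"
    by (rule pm_idl[OF red_lsub[OF M wt_rsub_single[OF Q]]])
  then show ?thesis
    by (simp add: hid_mor[OF M] hhor_hc[OF red_emb[OF M] Q] hsub_def rsub_emb hc_eqI)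
qed

lemma hhor_whisker_right:
  assumes P: "red X [B] P M M' D" and N: "has_type X [A] N B"
  shows "hhor X (hc B D M M' P) (hid X (mor_of X A N B)) =
    hc A D (sub (nth [N]) M) (sub (nth [N]) M') (rsub (nth [N]) P)"
proof -
  have "has_type X [B] M' D" using P red_has_type by blast
  then have "hsub P M' (nth [N]) (nth [emb N]) =
      RComp (rsub (nth [N]) P) (sub (nth [N]) M') (emb (sub (nth [N]) M'))"
    by (simp add: hsub_def lsub_single_emb)
  moreover have "perm X [A] (RComp (rsub (nth [N]) P) (sub (nth [N]) M') (emb (sub (nth [N]) M')))
      (rsub (nth [N]) P) (sub (nth [N]) M) (sub (nth [N]) M') D"
    by (rule pm_idr[OF red_rsub[OF P wt_sub_single[OF N]]])
  ultimately show ?thesis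
    by (simp add: hid_mor[OF N] hhor_hc[OF P red_emb[OF N]] hc_eqI)
qed

section \<open>Laws of a 2-category for H(X)\<close>

lemma HCat_simps [simp]:
  "obj (HCat X) = types X" "hom (HCat X) = mhom X" "cell (HCat X) = hcells X"
  "idm (HCat X) = (\<lambda>A. mor_of X A (Var 0) A)" "comp (HCat X) = mcomp X"
  "idc (HCat X) = hid X" "vcomp (HCat X) = hvert X" "hcomp (HCat X) = hhor X"
  "one (HCat X) = One" "prd (HCat X) = Prod"
  "prj1 (HCat X) = (\<lambda>A B. mor_of X (Prod A B) (Fst (Var 0)) A)"
  "prj2 (HCat X) = (\<lambda>A B. mor_of X (Prod A B) (Snd (Var 0)) B)"
  "expo (HCat X) = Fun" "evl (HCat X) = mev X"
  by (simp_all add: HCat_def)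

lemma HCat_two_category: "two_category (HCat X)"
proof (unfold_locales, unfold HCat_simps)
  show "mor_of X A (Var 0) A \<in> mhom X A A" for A
    by (rule mhomI[OF has_type_Var_0])
next
  fix A B D f g
  assume "f \<in> mhom X A B" "g \<in> mhom X B D"
  then show "mcomp X g f \<in> mhom X A D"
    by (elim mhomE) (simp add: mcomp_mor mhomI has_type_single)
next
  fix A B f
  assume "f \<in> mhom X A B"
  then show "mcomp X (mor_of X B (Var 0) B) f = f"
    by (elim mhomE) (simp add: mcomp_mor has_type_Var_0)
next
  fix A B f
  assume "f \<in> mhom X A B"
  then show "mcomp X f (mor_of X A (Var 0) A) = f"
    by (elim mhomE) (simp add: mcomp_mor has_type_Var_0 sub_single_Var)
next
  fix A B D E f g h
  assume "f \<in> mhom X A B" "g \<in> mhom X B D" "h \<in> mhom X D E"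
  then show "mcomp X (mcomp X h g) f = mcomp X h (mcomp X g f)"
    by (elim mhomE) (simp add: mcomp_mor has_type_single sub_single_sub)
next
  fix A B f
  assume "f \<in> mhom X A B"
  then show "hid X f \<in> hcells X f f"
    by (elim mhomE) (metis hid_mor hcellsI red_emb)
next
  fix A B f g h \<alpha> \<beta>
  assume "f \<in> mhom X A B" "g \<in> mhom X A B" "h \<in> mhom X A B" "\<alpha> \<in> hcells X f g" "\<beta> \<in> hcells X g h"
  then obtain M1 M2 M3 P Q where f: "f = mor_of X A M1 B" "h = mor_of X A M3 B"
    and P: "red X [A] P M1 M2 B" and \<alpha>: "\<alpha> = hc A B M1 M2 P"
    and Q: "red X [A] Q M2 M3 B" and \<beta>: "\<beta> = hc A B M2 M3 Q"
    by (metis mhomE hcellsE)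
  show "hvert X \<alpha> \<beta> \<in> hcells X f h"
    unfolding f \<alpha> \<beta> hvert_hc[OF P Q] by (rule hcellsI[OF rd_Comp[OF P Q]])
next
  fix A B f g \<alpha>
  assume "f \<in> mhom X A B" "g \<in> mhom X A B" "\<alpha> \<in> hcells X f g"
  then obtain M N P where M: "has_type X [A] M B" and f: "f = mor_of X A M B"
    and P: "red X [A] P M N B" and \<alpha>: "\<alpha> = hc A B M N P"
    by (metis mhomE hcellsE)
  show "hvert X (hid X f) \<alpha> = \<alpha>"
    unfolding f \<alpha> hid_mor[OF M] hvert_hc[OF red_emb[OF M] P] by (rule hc_eqI[OF pm_idl[OF P]])
next
  fix A B f g \<alpha>
  assume "f \<in> mhom X A B" "g \<in> mhom X A B" "\<alpha> \<in> hcells X f g"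
  then obtain M N P where N: "has_type X [A] N B" and g: "g = mor_of X A N B"
    and P: "red X [A] P M N B" and \<alpha>: "\<alpha> = hc A B M N P"
    by (metis mhomE hcellsE)
  show "hvert X \<alpha> (hid X g) = \<alpha>"
    unfolding g \<alpha> hid_mor[OF N] hvert_hc[OF P red_emb[OF N]] by (rule hc_eqI[OF pm_idr[OF P]])
next
  fix A B f g h k \<alpha> \<beta> \<gamma>
  assume "f \<in> mhom X A B" "g \<in> mhom X A B" "h \<in> mhom X A B" "k \<in> mhom X A B"
    "\<alpha> \<in> hcells X f g" "\<beta> \<in> hcells X g h" "\<gamma> \<in> hcells X h k"
  then obtain M1 M2 M3 M4 P Q R where P: "red X [A] P M1 M2 B" and \<alpha>: "\<alpha> = hc A B M1 M2 P"
    and Q: "red X [A] Q M2 M3 B" and \<beta>: "\<beta> = hc A B M2 M3 Q"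
    and R: "red X [A] R M3 M4 B" and \<gamma>: "\<gamma> = hc A B M3 M4 R"
    by (metis mhomE hcellsE)
  show "hvert X (hvert X \<alpha> \<beta>) \<gamma> = hvert X \<alpha> (hvert X \<beta> \<gamma>)"
    unfolding \<alpha> \<beta> \<gamma> hvert_hc[OF P Q] hvert_hc[OF Q R] hvert_hc[OF rd_Comp[OF P Q] R]
      hvert_hc[OF P rd_Comp[OF Q R]]
    by (rule hc_eqI[OF pm_assoc[OF P Q R]])
next
  fix A B D f f' g g' \<alpha> \<beta>
  assume "f \<in> mhom X A B" "f' \<in> mhom X A B" "g \<in> mhom X B D" "g' \<in> mhom X B D"
    "\<alpha> \<in> hcells X f f'" "\<beta> \<in> hcells X g g'"
  then obtain N N' M M' P Q where h: "has_type X [A] N B" "has_type X [A] N' B" "has_type X [B] M D"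
      "has_type X [B] M' D"
    and f: "f = mor_of X A N B" "f' = mor_of X A N' B" "g = mor_of X B M D" "g' = mor_of X B M' D"
    and Q: "red X [A] Q N N' B" and \<alpha>: "\<alpha> = hc A B N N' Q"
    and P: "red X [B] P M M' D" and \<beta>: "\<beta> = hc B D M M' P"
    by (metis mhomE hcellsE)
  show "hhor X \<beta> \<alpha> \<in> hcells X (mcomp X g f) (mcomp X g' f')"
    unfolding \<alpha> \<beta> hhor_hc[OF P Q] f mcomp_mor[OF h(1,3)] mcomp_mor[OF h(2,4)]
    by (rule hcellsI[OF red_hsub_single[OF P Q]])
next
  fix A B f g \<alpha>
  assume "f \<in> mhom X A B" "g \<in> mhom X A B" "\<alpha> \<in> hcells X f g"
  then obtain M N P where P: "red X [A] P M N B" and \<alpha>: "\<alpha> = hc A B M N P"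
    by (metis mhomE hcellsE)
  show "hhor X (hid X (mor_of X B (Var 0) B)) \<alpha> = \<alpha>"
    by (simp add: \<alpha> hhor_whisker_left[OF has_type_Var_0 P])
next
  fix A B f g \<alpha>
  assume "f \<in> mhom X A B" "g \<in> mhom X A B" "\<alpha> \<in> hcells X f g"
  then obtain M N P where h: "has_type X [A] M B" "has_type X [A] N B"
    and P: "red X [A] P M N B" and \<alpha>: "\<alpha> = hc A B M N P"
    by (metis mhomE hcellsE)
  show "hhor X \<alpha> (hid X (mor_of X A (Var 0) A)) = \<alpha>"
    using h P by (simp add: \<alpha> hhor_whisker_right[OF P has_type_Var_0] sub_single_Var rsub_single_Var)
next
  fix A B D E f f' g g' h h' \<alpha> \<beta> \<gamma>
  assume "f \<in> mhom X A B" "f' \<in> mhom X A B" "g \<in> mhom X B D" "g' \<in> mhom X B D"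
    "h \<in> mhom X D E" "h' \<in> mhom X D E"
    "\<alpha> \<in> hcells X f f'" "\<beta> \<in> hcells X g g'" "\<gamma> \<in> hcells X h h'"
  then obtain N N' M M' K K' P Q R where Q: "red X [A] Q N N' B" and \<alpha>: "\<alpha> = hc A B N N' Q"
    and P: "red X [B] P M M' D" and \<beta>: "\<beta> = hc B D M M' P"
    and R: "red X [D] R K K' E" and \<gamma>: "\<gamma> = hc D E K K' R"
    by (metis mhomE hcellsE)
  have h: "has_type X [A] N B" "has_type X [A] N' B" "has_type X [B] M D" "has_type X [B] M' D"
    "has_type X [D] K E" "has_type X [D] K' E"
    using P Q R red_has_type by blast+
  \<comment> \<open>Horizontal associativity: both bracketings run \<open>?R\<close>, then K'
    applied to \<open>?p\<close>, then K' applied to \<open>?q\<close>. One side needs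
    reassociation; the other applies K' to the composite of \<open>?p\<close> and \<open>?q\<close>,
    which functoriality of \<open>lsub\<close> splits.\<close>
  let ?R = "rsub (nth [sub (nth [N]) M]) R"
  let ?p = "rsub (nth [N]) P" and ?q = "lsub (nth [Q]) M'"
  have rR: "red X [A] ?R (sub (nth [sub (nth [N]) M]) K) (sub (nth [sub (nth [N]) M]) K') E"
    using R h by (blast intro: red_rsub wt_sub_single has_type_single)
  have rp: "red X [A] ?p (sub (nth [N]) M) (sub (nth [N]) M') D"
    using P h by (blast intro: red_rsub wt_sub_single)
  have rq: "red X [A] ?q (sub (nth [N]) M') (sub (nth [N']) M') D"
    using Q h by (blast intro: red_lsub wt_rsub_single)
  have rKp: "red X [A] (lsub (nth [?p]) K') (sub (nth [sub (nth [N]) M]) K') (sub (nth [sub (nth [N]) M']) K') E"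
    using rp h by (blast intro: red_lsub wt_rsub_single)
  have rKq: "red X [A] (lsub (nth [?q]) K') (sub (nth [sub (nth [N]) M']) K') (sub (nth [sub (nth [N']) M']) K') E"
    using rq h by (blast intro: red_lsub wt_rsub_single)
  have e1: "lsub (nth [?p]) K' = rsub (nth [N]) (lsub (nth [P]) K')"
    using h by (simp add: rsub_lsub_nth[of X "[D]" _ E])
  have e2: "lsub (nth [?q]) K' = lsub (nth [Q]) (sub (nth [M']) K')"
    using h by (simp add: lsub_sub_nth[of X "[D]" _ E])
  have e3: "lsub (\<lambda>i. RComp ([?p] ! i) ([sub (nth [N]) M'] ! i) ([?q] ! i)) K' =
      lsub (nth [RComp ?p (sub (nth [N]) M') ?q]) K'"
    by (rule lsub_cong_typed[OF h(6)]) simp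
  have l: "hsub (hsub R K' (nth [M]) (nth [P])) (sub (nth [M']) K') (nth [N]) (nth [Q]) =
      RComp (RComp ?R (sub (nth [sub (nth [N]) M]) K') (lsub (nth [?p]) K'))
        (sub (nth [sub (nth [N]) M']) K') (lsub (nth [?q]) K')"
    unfolding hsub_def rsub.simps e1 e2 using R h
    by (simp add: sub_single_sub[OF h(6)] rsub_single_rsub[OF R])
  have "perm X [A] (RComp (RComp ?R (sub (nth [sub (nth [N]) M]) K') (lsub (nth [?p]) K'))
        (sub (nth [sub (nth [N]) M']) K') (lsub (nth [?q]) K'))
      (RComp ?R (sub (nth [sub (nth [N]) M]) K') (RComp (lsub (nth [?p]) K')
        (sub (nth [sub (nth [N]) M']) K') (lsub (nth [?q]) K')))
      (sub (nth [sub (nth [N]) M]) K) (sub (nth [sub (nth [N']) M']) K') E"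
    by (rule pm_assoc[OF rR rKp rKq])
  moreover have "perm X [A] (RComp ?R (sub (nth [sub (nth [N]) M]) K') (lsub (nth [RComp ?p (sub (nth [N]) M') ?q]) K'))
      (RComp ?R (sub (nth [sub (nth [N]) M]) K') (RComp (lsub (nth [?p]) K')
        (sub (nth [sub (nth [N]) M']) K') (lsub (nth [?q]) K')))
      (sub (nth [sub (nth [N]) M]) K) (sub (nth [sub (nth [N']) M']) K') E"
    using perm_lsub_comp[OF h(6) wt_rsub_single[OF rp] wt_rsub_single[OF rq]] rR
    unfolding e3 by (blast intro: perm_Comp pm_refl)
  ultimately have "perm X [A] (hsub (hsub R K' (nth [M]) (nth [P])) (sub (nth [M']) K') (nth [N]) (nth [Q]))
      (hsub R K' (nth [sub (nth [N]) M]) (nth [hsub P M' (nth [N]) (nth [Q])]))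
      (sub (nth [sub (nth [N]) M]) K) (sub (nth [sub (nth [N']) M']) K') E"
    unfolding l by (simp add: hsub_def) (blast intro: pm_trans pm_sym)
  from hc_eqI[OF this] show "hhor X (hhor X \<gamma> \<beta>) \<alpha> = hhor X \<gamma> (hhor X \<beta> \<alpha>)"
    unfolding \<alpha> \<beta> \<gamma> hhor_hc[OF R P] hhor_hc[OF P Q] hhor_hc[OF red_hsub_single[OF R P] Q]
      hhor_hc[OF R red_hsub_single[OF P Q]]
    by (simp add: sub_single_sub[OF h(5)] sub_single_sub[OF h(6)])
next
  fix A B D f g
  assume "f \<in> mhom X A B" "g \<in> mhom X B D"
  then obtain M N where N: "has_type X [A] N B" "f = mor_of X A N B"
    and M: "has_type X [B] M D" "g = mor_of X B M D"
    by (metis mhomE)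
  have "hhor X (hid X g) (hid X f) = hc A D (sub (nth [N]) M) (sub (nth [N]) M) (emb (sub (nth [N]) M))"
    using hhor_whisker_left[OF M(1) red_emb[OF N(1)]] M N by (simp add: hid_mor lsub_single_emb)
  then show "hhor X (hid X g) (hid X f) = hid X (mcomp X g f)"
    using M N by (simp add: mcomp_mor hid_mor has_type_single)
next
  fix A B D f f' f'' g g' g'' \<alpha> \<alpha>' \<beta> \<beta>'
  assume "f \<in> mhom X A B" "f' \<in> mhom X A B" "f'' \<in> mhom X A B"
    "g \<in> mhom X B D" "g' \<in> mhom X B D" "g'' \<in> mhom X B D"
    "\<alpha> \<in> hcells X f f'" "\<alpha>' \<in> hcells X f' f''" "\<beta> \<in> hcells X g g'" "\<beta>' \<in> hcells X g' g''"
  then obtain N N' N'' M M' M'' P P' Q Q' where Q: "red X [A] Q N N' B" and \<alpha>: "\<alpha> = hc A B N N' Q"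
    and Q': "red X [A] Q' N' N'' B" and \<alpha>': "\<alpha>' = hc A B N' N'' Q'"
    and P: "red X [B] P M M' D" and \<beta>: "\<beta> = hc B D M M' P"
    and P': "red X [B] P' M' M'' D" and \<beta>': "\<beta>' = hc B D M' M'' P'"
    by (elim mhomE) (metis hcellsE)
  have h: "has_type X [A] N B" "has_type X [A] N' B" "has_type X [A] N'' B"
     "has_type X [B] M D" "has_type X [B] M' D" "has_type X [B] M'' D"
    using P Q P' Q' red_has_type by blast+
  note w = wt_sub_single[OF h(1)] wt_sub_single[OF h(2)]
  note v = wt_rsub_single[OF Q] wt_rsub_single[OF Q']
  \<comment> \<open>Interchange: one side runs \<open>?p\<close>, \<open>?p'\<close>,
    \<open>?q\<close>, \<open>?q'\<close>, the other \<open>?p\<close>, \<open>?q''\<close>,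
    \<open>?p''\<close>, \<open>?q'\<close>. The middle pairs are the two paths around the exchange
    square of P' and Q; everything else is associativity.\<close>
  let ?p = "rsub (nth [N]) P" and ?p' = "rsub (nth [N]) P'" and ?p'' = "rsub (nth [N']) P'"
  let ?q = "lsub (nth [Q]) M''" and ?q' = "lsub (nth [Q']) M''" and ?q'' = "lsub (nth [Q]) M'"
  let ?a = "sub (nth [N]) M" and ?b = "sub (nth [N]) M'" and ?c = "sub (nth [N]) M''"
  let ?d = "sub (nth [N']) M''" and ?e = "sub (nth [N'']) M''" and ?b' = "sub (nth [N']) M'"
  have r: "red X [A] ?p ?a ?b D" "red X [A] ?p' ?b ?c D" "red X [A] ?q ?c ?d D" "red X [A] ?q' ?d ?e D"
    "red X [A] ?q'' ?b ?b' D" "red X [A] ?p'' ?b' ?d D"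
    using red_rsub[OF P w(1)] red_rsub[OF P' w(1)] red_rsub[OF P' w(2)]
      red_lsub[OF h(6) v(1)] red_lsub[OF h(6) v(2)] red_lsub[OF h(5) v(1)] by blast+
  have e: "lsub (\<lambda>i. RComp ([Q] ! i) ([N'] ! i) ([Q'] ! i)) M'' = lsub (nth [RComp Q N' Q']) M''"
    by (rule lsub_cong_typed[OF h(6)]) simp
  have "perm X [A] (lsub (nth [RComp Q N' Q']) M'') (RComp ?q ?d ?q') ?c ?e D"
    using perm_lsub_comp[OF h(6) v] unfolding e .
  then have "perm X [A] (RComp (RComp ?p ?b ?p') ?c (lsub (nth [RComp Q N' Q']) M''))
      (RComp (RComp ?p ?b ?p') ?c (RComp ?q ?d ?q')) ?a ?e D"
    using r by (blast intro: perm_Comp pm_refl rd_Comp)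
  moreover have "perm X [A] (RComp (RComp ?p ?b ?p') ?c (RComp ?q ?d ?q'))
      (RComp ?p ?b (RComp ?p' ?c (RComp ?q ?d ?q'))) ?a ?e D"
    using r by (blast intro: pm_assoc rd_Comp)
  moreover have "perm X [A] (RComp ?p ?b (RComp (RComp ?p' ?c ?q) ?d ?q'))
      (RComp ?p ?b (RComp ?p' ?c (RComp ?q ?d ?q'))) ?a ?e D"
    using r by (blast intro: pm_assoc perm_Comp pm_refl)
  moreover have "perm X [A] (RComp ?p ?b (RComp (RComp ?p' ?c ?q) ?d ?q'))
      (RComp ?p ?b (RComp (RComp ?q'' ?b' ?p'') ?d ?q')) ?a ?e D"
    using r perm_exchange[OF P' v(1)] by (blast intro: perm_Comp pm_refl)
  moreover have "perm X [A] (RComp ?p ?b (RComp (RComp ?q'' ?b' ?p'') ?d ?q'))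
      (RComp ?p ?b (RComp ?q'' ?b' (RComp ?p'' ?d ?q'))) ?a ?e D"
    using r by (blast intro: pm_assoc perm_Comp pm_refl)
  moreover have "perm X [A] (RComp (RComp ?p ?b ?q'') ?b' (RComp ?p'' ?d ?q'))
      (RComp ?p ?b (RComp ?q'' ?b' (RComp ?p'' ?d ?q'))) ?a ?e D"
    using r by (blast intro: pm_assoc rd_Comp)
  ultimately have "perm X [A] (RComp (RComp ?p ?b ?p') ?c (lsub (nth [RComp Q N' Q']) M''))
      (RComp (RComp ?p ?b ?q'') ?b' (RComp ?p'' ?d ?q')) ?a ?e D"
    by (meson pm_sym pm_trans)
  then have "perm X [A] (hsub (RComp P M' P') M'' (nth [N]) (nth [RComp Q N' Q']))
      (RComp (hsub P M' (nth [N]) (nth [Q])) ?b' (hsub P' M'' (nth [N']) (nth [Q']))) ?a ?e D"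
    by (simp add: hsub_def)
  from hc_eqI[OF this]
  show "hhor X (hvert X \<beta> \<beta>') (hvert X \<alpha> \<alpha>') = hvert X (hhor X \<beta> \<alpha>) (hhor X \<beta>' \<alpha>')"
    unfolding \<alpha> \<alpha>' \<beta> \<beta>' hvert_hc[OF Q Q'] hvert_hc[OF P P'] hhor_hc[OF P Q] hhor_hc[OF P' Q']
      hhor_hc[OF rd_Comp[OF P P'] rd_Comp[OF Q Q']]
      hvert_hc[OF red_hsub_single[OF P Q] red_hsub_single[OF P' Q']] .
qed

section \<open>Cartesian closed structure\<close>

abbreviation wk :: "nat \<Rightarrow> ('s, 'o) tm" where
  "wk \<equiv> nth [Fst (Var 0)]"

text \<open>
  Substituting \<open>sw\<close> turns a term in one variable of type \<open>Z \<times> A\<close> into a term in the context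
  \<open>[A, Z]\<close>, ready to be abstracted over \<open>A\<close>.
\<close>

abbreviation sw :: "nat \<Rightarrow> ('s, 'o) tm" where
  "sw \<equiv> nth [Tup (Var (Suc 0)) (Var 0)]"

text \<open>Represents evaluation after H \<times> A, with the projections of the pair already
  contracted (\<open>mcomp_eval\<close>).\<close>

abbreviation uncurried :: "('s, 'o) tm \<Rightarrow> ('s, 'o) tm" where
  "uncurried H \<equiv> App (sub wk H) (Snd (Var 0))"

lemma wt_sub_wk: "wt_sub X (Prod Z A # \<Gamma>) [Z] wk"
  by (rule wt_sub_single[OF has_type_Fst_0])

lemma wt_sub_sw: "wt_sub X (A # Z # \<Gamma>) [Prod Z A] sw"
  by (rule wt_sub_single[OF has_type_swap])

lemma has_type_mtimes:
  "has_type X [Z] M W \<Longrightarrow> has_type X [Prod Z A] (Tup (sub wk M) (Snd (Var 0))) (Prod W A)"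
  by (blast intro: ty_Tup has_type_sub wt_sub_wk has_type_Snd_0)

lemma has_type_uncurried: "has_type X [Z] H (Fun A B) \<Longrightarrow> has_type X [Prod Z A] (uncurried H) B"
  by (blast intro: ty_App has_type_sub wt_sub_wk has_type_Snd_0)

lemma has_type_eval: "has_type X [Prod (Fun A B) A] (App (Fst (Var 0)) (Snd (Var 0))) B"
  by (rule ty_App[OF has_type_Fst_0 has_type_Snd_0])

section \<open>Binary products\<close>

lemma mcomp_prj1:
  "has_type X [Z] K (Prod A B) \<Longrightarrow>
   mcomp X (mor_of X (Prod A B) (Fst (Var 0)) A) (mor_of X Z K (Prod A B)) = mor_of X Z (Fst K) A"
  using mcomp_mor[OF _ has_type_Fst_0[of A B]] by simp

lemma mcomp_prj2:
  "has_type X [Z] K (Prod A B) \<Longrightarrow>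
   mcomp X (mor_of X (Prod A B) (Snd (Var 0)) B) (mor_of X Z K (Prod A B)) = mor_of X Z (Snd K) B"
  using mcomp_mor[OF _ has_type_Snd_0[of A B]] by simp

text \<open>Stated as an equivalence so that it yields the unique existence in the universal
  property and also evaluates the description in \<open>mtimes\<close>. Uniqueness is surjective
  pairing.\<close>

lemma prd_hom_iff:
  assumes M: "has_type X [Z] M A" and N: "has_type X [Z] N B"
  shows "h \<in> mhom X Z (Prod A B) \<and>
      mcomp X (mor_of X (Prod A B) (Fst (Var 0)) A) h = mor_of X Z M A \<and>
      mcomp X (mor_of X (Prod A B) (Snd (Var 0)) B) h = mor_of X Z N B \<longleftrightarrow>
    h = mor_of X Z (Tup M N) (Prod A B)" (is "?L \<longleftrightarrow> ?R")
proof
  assume L: ?L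
  then obtain K where K: "has_type X [Z] K (Prod A B)" and h: "h = mor_of X Z K (Prod A B)"
    using mhomE by blast
  have "conv X [Z] (Fst K) M A" "conv X [Z] (Snd K) N B"
    using L M N K unfolding h mcomp_prj1[OF K] mcomp_prj2[OF K]
    by (metis mor_eq_iff ty_Fst, metis mor_eq_iff ty_Snd)
  then have "conv X [Z] K (Tup M N) (Prod A B)"
    using cv_tup[OF K] by (blast intro: cv_trans cv_Tup)
  then show ?R unfolding h by (rule mor_eqI)
next
  assume ?R
  have "has_type X [Z] (Tup M N) (Prod A B)" using M N by (rule ty_Tup)
  with \<open>?R\<close> show ?L
    using mor_eqI[OF cv_fst[OF M N]] mor_eqI[OF cv_snd[OF M N]]
    by (simp add: mcomp_prj1 mcomp_prj2 mhomI)
qed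

lemma mtimes_mor:
  assumes M: "has_type X [Z] M W"
  shows "mtimes (HCat X) Z W (mor_of X Z M W) A =
    mor_of X (Prod Z A) (Tup (sub wk M) (Snd (Var 0))) (Prod W A)"
proof -
  have "mcomp X (mor_of X Z M W) (mor_of X (Prod Z A) (Fst (Var 0)) Z) = mor_of X (Prod Z A) (sub wk M) W"
    by (rule mcomp_mor[OF has_type_Fst_0 M])
  then show ?thesis
    using prd_hom_iff[OF has_type_sub[OF M wt_sub_wk] has_type_Snd_0[of Z A]]
    by (simp add: mtimes_def)
qed

text \<open>The equivalence again serves both the universal property and the description in
  \<open>ctimes\<close>. The raw end points of \<open>RTup P Q\<close> are pairs of projections,
  aligned with K and K' by surjective pairing; uniqueness is \<open>pm_tup\<close>.\<close>

lemma prd_cell_iff: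
  assumes K: "has_type X [Z] K (Prod A B)" and K': "has_type X [Z] K' (Prod A B)"
    and P: "red X [Z] P (Fst K) (Fst K') A" and Q: "red X [Z] Q (Snd K) (Snd K') B"
  shows "\<gamma> \<in> hcells X (mor_of X Z K (Prod A B)) (mor_of X Z K' (Prod A B)) \<and>
      hhor X (hid X (mor_of X (Prod A B) (Fst (Var 0)) A)) \<gamma> = hc Z A (Fst K) (Fst K') P \<and>
      hhor X (hid X (mor_of X (Prod A B) (Snd (Var 0)) B)) \<gamma> = hc Z B (Snd K) (Snd K') Q \<longleftrightarrow>
    \<gamma> = hc Z (Prod A B) K K' (RTup P Q)" (is "?L \<longleftrightarrow> ?R")
proof -
  have c: "conv X [Z] (Tup (Fst K) (Snd K)) K (Prod A B)" "conv X [Z] (Tup (Fst K') (Snd K')) K' (Prod A B)"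
    using K K' by (blast intro: cv_sym cv_tup)+
  have prj1: "hhor X (hid X (mor_of X (Prod A B) (Fst (Var 0)) A)) (hc Z (Prod A B) K K' G) =
      hc Z A (Fst K) (Fst K') (RFst G)" if "red X [Z] G K K' (Prod A B)" for G
    using hhor_whisker_left[OF has_type_Fst_0 that] by simp
  have prj2: "hhor X (hid X (mor_of X (Prod A B) (Snd (Var 0)) B)) (hc Z (Prod A B) K K' G) =
      hc Z B (Snd K) (Snd K') (RSnd G)" if "red X [Z] G K K' (Prod A B)" for G
    using hhor_whisker_left[OF has_type_Snd_0 that] by simp
  show ?thesis
  proof
    assume L: ?L
    then obtain G where G: "red X [Z] G K K' (Prod A B)" and \<gamma>: "\<gamma> = hc Z (Prod A B) K K' G"
      using hcellsE by blast
    have "perm X [Z] (RFst G) P (Fst K) (Fst K') A" "perm X [Z] (RSnd G) Q (Snd K) (Snd K') B"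
      using L unfolding \<gamma> prj1[OF G] prj2[OF G] by (blast intro: hc_eqD P Q)+
    then have "perm X [Z] (RTup (RFst G) (RSnd G)) (RTup P Q) K K' (Prod A B)"
      using c by (blast intro: pm_Tup pm_conv)
    then have "perm X [Z] G (RTup P Q) K K' (Prod A B)" using pm_tup[OF G] by (blast intro: pm_trans)
    then show ?R unfolding \<gamma> by (rule hc_eqI)
  next
    assume R: ?R
    have G: "red X [Z] (RTup P Q) K K' (Prod A B)" using P Q c by (blast intro: rd_Tup rd_conv)
    show ?L
      unfolding R prj1[OF G] prj2[OF G] using hcellsI[OF G] hc_eqI[OF pm_fst[OF P Q]] hc_eqI[OF pm_snd[OF P Q]]
      by blast
  qed
qed

lemma ctimes_hc:
  assumes P: "red X [Z] P M M' W"
  shows "ctimes (HCat X) Z W (mor_of X Z M W) (mor_of X Z M' W) (hc Z W M M' P) A =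
    hc (Prod Z A) (Prod W A) (Tup (sub wk M) (Snd (Var 0))) (Tup (sub wk M') (Snd (Var 0)))
      (RTup (rsub wk P) (RSnd (RVar 0)))"
proof -
  let ?T = "Tup (sub wk M) (Snd (Var 0))" and ?T' = "Tup (sub wk M') (Snd (Var 0))"
  have M: "has_type X [Z] M W" "has_type X [Z] M' W" using P red_has_type by blast+
  have T: "has_type X [Prod Z A] ?T (Prod W A)" "has_type X [Prod Z A] ?T' (Prod W A)"
    using M by (simp_all add: has_type_mtimes)
  have s: "has_type X [Prod Z A] (sub wk M) W" "has_type X [Prod Z A] (sub wk M') W"
    using M by (blast intro: has_type_sub wt_sub_wk)+
  \<comment> \<open>The projections demanded by \<open>ctimes\<close> have end points
    \<open>sub wk M\<close> and \<open>Snd (Var 0)\<close>, whereas \<open>prd_cell_iff\<close>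
    speaks of \<open>Fst ?T\<close> and \<open>Snd ?T\<close>; the same cells are re-indexed along
    these conversions.\<close>
  have c1: "conv X [Prod Z A] (sub wk M) (Fst ?T) W" "conv X [Prod Z A] (sub wk M') (Fst ?T') W"
    and c2: "conv X [Prod Z A] (Snd (Var 0)) (Snd ?T) A" "conv X [Prod Z A] (Snd (Var 0)) (Snd ?T') A"
    using s has_type_Snd_0 by (blast intro: cv_sym cv_fst cv_snd)+
  have 1: "red X [Prod Z A] (rsub wk P) (Fst ?T) (Fst ?T') W"
    using c1 P by (blast intro: rd_conv red_rsub wt_sub_wk)
  have "red X [Prod Z A] (emb (Snd (Var 0))) (Snd ?T) (Snd ?T') A"
    by (rule rd_conv[OF red_emb[OF has_type_Snd_0] c2])
  then have 2: "red X [Prod Z A] (RSnd (RVar 0)) (Snd ?T) (Snd ?T') A" by simp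
  have "hhor X (hc Z W M M' P) (hid X (mor_of X (Prod Z A) (Fst (Var 0)) Z)) =
      hc (Prod Z A) W (Fst ?T) (Fst ?T') (rsub wk P)"
    unfolding hhor_whisker_right[OF P has_type_Fst_0] by (rule hc_conv[OF c1])
  moreover have "hid X (mor_of X (Prod Z A) (Snd (Var 0)) A) =
      hc (Prod Z A) A (Snd ?T) (Snd ?T') (RSnd (RVar 0))"
    unfolding hid_mor[OF has_type_Snd_0] hc_conv[OF c2] by simp
  ultimately show ?thesis
    using prd_cell_iff[OF T 1 2] M by (simp add: ctimes_def mtimes_mor)
qed

section \<open>Exponential transposition\<close>

lemma uncurried_conv:
  "has_type X [Z] H (Fun A B) \<Longrightarrow>
   conv X [Prod Z A] (App (Fst (Tup (sub wk H) (Snd (Var 0)))) (Snd (Tup (sub wk H) (Snd (Var 0)))))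
     (uncurried H) B"
  by (blast intro: cv_App cv_fst cv_snd has_type_sub wt_sub_wk has_type_Snd_0)

lemma mcomp_eval:
  assumes H: "has_type X [Z] H (Fun A B)"
  shows "mcomp X (mev X A B) (mtimes (HCat X) Z (Fun A B) (mor_of X Z H (Fun A B)) A) =
    mor_of X (Prod Z A) (uncurried H) B"
  unfolding mtimes_mor[OF H] mev_def mcomp_mor[OF has_type_mtimes[OF H] has_type_eval]
  using mor_eqI[OF uncurried_conv[OF H]] by simp

text \<open>Evaluation projects the two components back out of the paired reduction, and
  \<open>pm_fst\<close> and \<open>pm_snd\<close> erase the projections. What is left is the
  uncurrying of P.\<close>

lemma hhor_eval:
  assumes P: "red X [Z] P H H' (Fun A B)"
  shows "hhor X (hid X (mev X A B))
      (ctimes (HCat X) Z (Fun A B) (mor_of X Z H (Fun A B)) (mor_of X Z H' (Fun A B)) (hc Z (Fun A B) H H' P) A) =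
    hc (Prod Z A) B (uncurried H) (uncurried H') (RApp (rsub wk P) (RSnd (RVar 0)))"
proof -
  let ?G = "RTup (rsub wk P) (RSnd (RVar 0))"
  have H: "has_type X [Z] H (Fun A B)" "has_type X [Z] H' (Fun A B)" using P red_has_type by blast+
  have p: "red X [Prod Z A] (rsub wk P) (sub wk H) (sub wk H') (Fun A B)"
    by (rule red_rsub[OF P wt_sub_wk])
  have q: "red X [Prod Z A] (RSnd (RVar 0)) (Snd (Var 0)) (Snd (Var 0)) A"
    using red_emb[OF has_type_Snd_0[of Z A "[]"]] by simp
  have "perm X [Prod Z A] (RApp (RFst ?G) (RSnd ?G)) (RApp (rsub wk P) (RSnd (RVar 0)))
      (uncurried H) (uncurried H') B"
    by (rule pm_App[OF pm_fst[OF p q] pm_snd[OF p q]])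
  then show ?thesis
    unfolding ctimes_hc[OF P] mev_def hhor_whisker_left[OF has_type_eval rd_Tup[OF p q]]
    using hc_conv[OF uncurried_conv[OF H(1)] uncurried_conv[OF H(2)]] hc_eqI by simp
qed

text \<open>The pair in \<open>sw\<close> cancels the projections in \<open>uncurried\<close>,
  leaving the body of the \<eta>-expansion of H.\<close>

lemma curry_conv:
  assumes H: "has_type X [Z] H (Fun A B)"
  shows "conv X [A, Z] (sub sw (uncurried H)) (App (ren Suc H) (Var 0)) B"
proof -
  have "conv X [A, Z] (Fst (Tup (Var (Suc 0)) (Var 0))) (Var (Suc 0)) Z"
    "conv X [A, Z] (Snd (Tup (Var (Suc 0)) (Var 0))) (Var 0) A"
    using has_type_Var_0 has_type_Var_1 by (blast intro: cv_fst cv_snd)+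
  moreover have "sub (nth [Var (Suc 0)]) H = ren Suc H"
    unfolding ren_eq_sub by (rule sub_cong_typed[OF H]) simp
  moreover have "conv X [A, Z] (sub (nth [Fst (Tup (Var (Suc 0)) (Var 0))]) H) (sub (nth [Var (Suc 0)]) H) (Fun A B)"
    by (rule conv_sub_conv[OF H]) (use calculation(1) in simp)
  ultimately show ?thesis
    by (simp add: sub_single_sub[OF H] cv_App)
qed

lemma conv_Lam_sw_uncurried:
  assumes A: "A \<in> types X" and H: "has_type X [Z] H (Fun A B)"
  shows "conv X [Z] (Lam A (sub sw (uncurried H))) H (Fun A B)"
  using cv_Lam[OF A curry_conv[OF H]] cv_eta[OF A H] by (blast intro: cv_sym cv_trans)

lemma conv_surjective_pair: "conv X [Prod Z A] (Tup (Fst (Var 0)) (Snd (Var 0))) (Var 0) (Prod Z A)"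
  by (rule cv_sym[OF cv_tup[OF has_type_Var_0]])

text \<open>The \<beta>-contractum is F at the pair of the two projections of its variable, and
  surjective pairing turns that pair back into the variable.\<close>

lemma conv_uncurried_Lam:
  assumes A: "A \<in> types X" and F: "has_type X [Prod Z A] F B"
  shows "conv X [Prod Z A] (uncurried (Lam A (sub sw F))) F B"
proof -
  have ty: "has_type X [A, Prod Z A] (sub (up wk) (sub sw F)) B"
    using F by (blast intro: has_type_sub wt_sub_up wt_sub_wk wt_sub_sw)
  have "conv X [Prod Z A] (uncurried (Lam A (sub sw F)))
      (sub (case_nat (Snd (Var 0)) Var) (sub (up wk) (sub sw F))) B"
    using cv_beta[OF A ty has_type_Snd_0] by simp
  moreover have "sub (case_nat (Snd (Var 0)) Var) (sub (up wk) (sub sw F)) =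
      sub (nth [Tup (Fst (Var 0)) (Snd (Var 0))]) F"
    using F by (simp add: sub_single_sub)
  moreover have "conv X [Prod Z A] (sub (nth [Tup (Fst (Var 0)) (Snd (Var 0))]) F) (sub (nth [Var 0]) F) B"
    by (rule conv_sub_conv[OF F]) (use conv_surjective_pair in simp)
  ultimately show ?thesis using sub_single_Var[OF F] by (metis cv_trans)
qed

text \<open>The \<beta> law of transposition for 2-cells. The argument is the identity on the second
  projection, so the second leg of the contractum is an identity and drops out. The first leg is Q
  at a pair convertible to the variable, which is a case for \<open>perm_rsub_conv\<close>.\<close>

lemma perm_uncurried_RLam:
  assumes A: "A \<in> types X" and Q: "red X [Prod Z A] Q F F' B"
  shows "perm X [Prod Z A] (RApp (rsub wk (RLam A (rsub sw Q))) (RSnd (RVar 0))) Q F F' B"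
proof -
  let ?Q = "rsub (up wk) (rsub sw Q)" and ?F = "sub (up wk) (sub sw F)" and ?F' = "sub (up wk) (sub sw F')"
  let ?\<sigma> = "case_nat (Snd (Var 0)) Var :: nat \<Rightarrow> ('s, 'o) tm"
  have F: "has_type X [Prod Z A] F B" "has_type X [Prod Z A] F' B" using Q red_has_type by blast+
  have q: "red X [A, Prod Z A] ?Q ?F ?F' B"
    using Q by (blast intro: red_rsub wt_sub_up wt_sub_wk wt_sub_sw)
  have w: "wt_sub X [Prod Z A] [A, Prod Z A] ?\<sigma>"
    by (rule wt_sub_case_nat[OF has_type_Snd_0 wt_sub_Var])
  have s: "red X [Prod Z A] (RSnd (RVar 0)) (Snd (Var 0)) (Snd (Var 0)) A"
    using red_emb[OF has_type_Snd_0[of Z A "[]"]] by simp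
  have "case_nat (RSnd (RVar 0)) RVar = (emb \<circ> ?\<sigma> :: nat \<Rightarrow> ('s, 'o, 'r) rd)"
    by (rule ext) (simp split: nat.split)
  then have hs: "hsub ?Q ?F' ?\<sigma> (case_nat (RSnd (RVar 0)) RVar) = RComp (rsub ?\<sigma> ?Q) (sub ?\<sigma> ?F') (emb (sub ?\<sigma> ?F'))"
    by (simp only: hsub_def lsub_emb)
  have 1: "perm X [Prod Z A] (RApp (RLam A ?Q) (RSnd (RVar 0))) (rsub ?\<sigma> ?Q) (sub ?\<sigma> ?F) (sub ?\<sigma> ?F') B"
    by (rule pm_trans[OF pm_beta[OF A q s, unfolded hs] pm_idr[OF red_rsub[OF q w]]])
  have e: "rsub ?\<sigma> ?Q = rsub (nth [Tup (Fst (Var 0)) (Snd (Var 0))]) Q"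
    using Q by (simp add: rsub_single_rsub)
  have f: "sub ?\<sigma> (sub (up wk) (sub sw G)) = sub (nth [Tup (Fst (Var 0)) (Snd (Var 0))]) G"
    if "has_type X [Prod Z A] G B" for G
    using that by (simp add: sub_single_sub)
  have c: "\<forall>i < length [Prod Z A]. conv X [Prod Z A] ([Tup (Fst (Var 0)) (Snd (Var 0))] ! i) ([Var 0] ! i) ([Prod Z A] ! i)"
    using conv_surjective_pair by simp
  have "perm X [Prod Z A] (rsub (nth [Tup (Fst (Var 0)) (Snd (Var 0))]) Q) (rsub (nth [Var 0]) Q)
      (sub (nth [Tup (Fst (Var 0)) (Snd (Var 0))]) F) (sub (nth [Tup (Fst (Var 0)) (Snd (Var 0))]) F') B"
    by (rule perm_rsub_conv[OF Q c])
  then have "perm X [Prod Z A] (RApp (RLam A ?Q) (RSnd (RVar 0))) Q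
      (sub (nth [Tup (Fst (Var 0)) (Snd (Var 0))]) F) (sub (nth [Tup (Fst (Var 0)) (Snd (Var 0))]) F') B"
    using 1 F unfolding e rsub_single_Var[OF Q] by (simp add: f) (rule pm_trans)
  moreover have "conv X [Prod Z A] (sub (nth [Tup (Fst (Var 0)) (Snd (Var 0))]) F) F B"
    "conv X [Prod Z A] (sub (nth [Tup (Fst (Var 0)) (Snd (Var 0))]) F') F' B"
    using conv_sub_conv[OF F(1) c] conv_sub_conv[OF F(2) c] F by (simp_all add: sub_single_Var)
  ultimately show ?thesis by simp (rule pm_conv)
qed

text \<open>The \<eta> law of transposition for 2-cells. The term put into P is a first projection
  convertible to \<open>Var (Suc 0)\<close>, so \<open>perm_rsub_conv\<close> replaces it by
  weakening, and \<open>pm_eta\<close> removes the abstraction.\<close>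

lemma perm_RLam_uncurried:
  assumes A: "A \<in> types X" and P: "red X [Z] P H H' (Fun A B)"
  shows "perm X [Z] (RLam A (rsub sw (RApp (rsub wk P) (RSnd (RVar 0))))) P H H' (Fun A B)"
proof -
  have H: "has_type X [Z] H (Fun A B)" "has_type X [Z] H' (Fun A B)" using P red_has_type by blast+
  let ?K = "Fst (Tup (Var (Suc 0)) (Var 0)) :: ('s, 'o) tm"
  have c: "conv X [A, Z] ?K (Var (Suc 0)) Z"
    using has_type_Var_0 has_type_Var_1 by (blast intro: cv_fst)
  have k: "\<forall>i < length [Z]. conv X [A, Z] ([?K] ! i) ([Var (Suc 0)] ! i) ([Z] ! i)"
    using c by simp
  have e: "rsub (nth [Var (Suc 0)]) P = rren Suc P"
    unfolding rren_eq_rsub by (rule rsub_cong_typed[OF P]) simp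
  have r0: "red X [A, Z] (RVar (Suc 0)) (Var (Suc 0)) (Var (Suc 0)) Z"
    using red_emb[OF has_type_Var_1[of A Z "[]"]] by simp
  have "perm X [A, Z] (rsub (nth [?K]) P) (rren Suc P) (sub (nth [?K]) H) (sub (nth [?K]) H') (Fun A B)"
    using perm_rsub_conv[OF P k] unfolding e .
  moreover have "conv X [A, Z] (sub (nth [?K]) G) (ren Suc G) (Fun A B)" if "has_type X [Z] G (Fun A B)" for G
  proof -
    have "sub (nth [Var (Suc 0)]) G = ren Suc G"
      unfolding ren_eq_sub by (rule sub_cong_typed[OF that]) simp
    then show ?thesis using conv_sub_conv[OF that k] by simp
  qed
  ultimately have "perm X [A, Z] (rsub (nth [?K]) P) (rren Suc P) (ren Suc H) (ren Suc H') (Fun A B)"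
    using H by (blast intro: pm_conv)
  moreover have "perm X [A, Z] (RSnd (RTup (RVar (Suc 0)) (RVar 0))) (RVar 0) (Var 0) (Var 0) A"
    by (rule pm_snd[OF r0 red_RVar_0])
  ultimately have "perm X [A, Z] (RApp (rsub (nth [?K]) P) (RSnd (RTup (RVar (Suc 0)) (RVar 0))))
      (RApp (rren Suc P) (RVar 0)) (App (ren Suc H) (Var 0)) (App (ren Suc H') (Var 0)) B"
    by (rule pm_App)
  then have "perm X [Z] (RLam A (RApp (rsub (nth [?K]) P) (RSnd (RTup (RVar (Suc 0)) (RVar 0)))))
      (RLam A (RApp (rren Suc P) (RVar 0))) (Lam A (App (ren Suc H) (Var 0)))
      (Lam A (App (ren Suc H') (Var 0))) (Fun A B)"
    by (rule pm_Lam[OF A])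
  moreover have "conv X [Z] (Lam A (App (ren Suc G) (Var 0))) G (Fun A B)" if "has_type X [Z] G (Fun A B)" for G
    by (rule cv_sym[OF cv_eta[OF A that]])
  ultimately have "perm X [Z] (RLam A (RApp (rsub (nth [?K]) P) (RSnd (RTup (RVar (Suc 0)) (RVar 0)))))
      (RLam A (RApp (rren Suc P) (RVar 0))) H H' (Fun A B)"
    using H by (blast intro: pm_conv)
  then have "perm X [Z] (RLam A (RApp (rsub (nth [?K]) P) (RSnd (RTup (RVar (Suc 0)) (RVar 0))))) P H H' (Fun A B)"
    using pm_eta[OF A P] by (blast intro: pm_trans pm_sym)
  then show ?thesis by (simp add: rsub_single_rsub[OF P])
qed

section \<open>Universal properties in H(X)\<close>

lemma HCat_cc_two_category: "cc_two_category (HCat X)"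
proof (intro cc_two_category.intro HCat_two_category cc_two_category_axioms.intro, unfold HCat_simps)
  show "One \<in> types X" by (simp add: types_def)
next
  show "Prod A B \<in> types X" if "A \<in> types X" "B \<in> types X" for A B
    using that by (simp add: types_def)
next
  show "mor_of X (Prod A B) (Fst (Var 0)) A \<in> mhom X (Prod A B) A" for A B
    by (rule mhomI[OF has_type_Fst_0])
next
  show "mor_of X (Prod A B) (Snd (Var 0)) B \<in> mhom X (Prod A B) B" for A B
    by (rule mhomI[OF has_type_Snd_0])
next
  show "Fun A B \<in> types X" if "A \<in> types X" "B \<in> types X" for A B
    using that by (simp add: types_def)
next
  show "mev X A B \<in> mhom X (Prod (Fun A B) A) B" for A B
    unfolding mev_def by (rule mhomI[OF has_type_eval])
next
  fix Z
  have "f = mor_of X Z Star One" if "f \<in> mhom X Z One" for f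
    using that by (elim mhomE) (simp add: mor_eqI cv_star)
  then show "\<exists>!f. f \<in> mhom X Z One"
    using mhomI[OF ty_Star] by blast
next
  fix Z f f'
  assume "f \<in> mhom X Z One" "f' \<in> mhom X Z One"
  then obtain M M' where M: "has_type X [Z] M One" "has_type X [Z] M' One"
    and f: "f = mor_of X Z M One" "f' = mor_of X Z M' One"
    by (metis mhomE)
  have "red X [Z] RStar M M' One"
    using M by (blast intro: rd_conv rd_Star cv_sym cv_star)
  moreover have "\<alpha> = hc Z One M M' RStar" if "\<alpha> \<in> hcells X f f'" for \<alpha>
    using that unfolding f by (elim hcellsE) (metis hc_eqI pm_star)
  ultimately show "\<exists>!\<alpha>. \<alpha> \<in> hcells X f f'"
    unfolding f by (intro ex1I[of _ "hc Z One M M' RStar"] hcellsI)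
next
  fix Z A B f g
  assume "f \<in> mhom X Z A" "g \<in> mhom X Z B"
  then show "\<exists>!h. h \<in> mhom X Z (Prod A B) \<and> mcomp X (mor_of X (Prod A B) (Fst (Var 0)) A) h = f \<and>
      mcomp X (mor_of X (Prod A B) (Snd (Var 0)) B) h = g"
    by (elim mhomE) (simp add: prd_hom_iff)
next
  fix Z A B h h' \<alpha> \<beta>
  assume "h \<in> mhom X Z (Prod A B)" "h' \<in> mhom X Z (Prod A B)"
    and \<alpha>: "\<alpha> \<in> hcells X (mcomp X (mor_of X (Prod A B) (Fst (Var 0)) A) h)
      (mcomp X (mor_of X (Prod A B) (Fst (Var 0)) A) h')"
    and \<beta>: "\<beta> \<in> hcells X (mcomp X (mor_of X (Prod A B) (Snd (Var 0)) B) h)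
      (mcomp X (mor_of X (Prod A B) (Snd (Var 0)) B) h')"
  then obtain K K' where K: "has_type X [Z] K (Prod A B)" "has_type X [Z] K' (Prod A B)"
    and h: "h = mor_of X Z K (Prod A B)" "h' = mor_of X Z K' (Prod A B)"
    by (metis mhomE)
  obtain P Q where PQ: "red X [Z] P (Fst K) (Fst K') A" "red X [Z] Q (Snd K) (Snd K') B"
    and "\<alpha> = hc Z A (Fst K) (Fst K') P" "\<beta> = hc Z B (Snd K) (Snd K') Q"
    using \<alpha> \<beta> unfolding h mcomp_prj1[OF K(1)] mcomp_prj1[OF K(2)] mcomp_prj2[OF K(1)] mcomp_prj2[OF K(2)]
    by (metis hcellsE)
  then show "\<exists>!\<gamma>. \<gamma> \<in> hcells X h h' \<and> hhor X (hid X (mor_of X (Prod A B) (Fst (Var 0)) A)) \<gamma> = \<alpha> \<and>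
      hhor X (hid X (mor_of X (Prod A B) (Snd (Var 0)) B)) \<gamma> = \<beta>"
    using prd_cell_iff[OF K PQ] unfolding h by simp
next
  fix Z A B f
  assume A: "A \<in> types X" and "f \<in> mhom X (Prod Z A) B"
  then obtain F where F: "has_type X [Prod Z A] F B" and f: "f = mor_of X (Prod Z A) F B"
    by (metis mhomE)
  let ?H = "Lam A (sub sw F)"
  have H: "has_type X [Z] ?H (Fun A B)"
    by (rule ty_Lam[OF A has_type_sub[OF F wt_sub_sw]])
  show "\<exists>!h. h \<in> mhom X Z (Fun A B) \<and> mcomp X (mev X A B) (mtimes (HCat X) Z (Fun A B) h A) = f"
  proof (rule ex1I)
    show "mor_of X Z ?H (Fun A B) \<in> mhom X Z (Fun A B) \<and>
        mcomp X (mev X A B) (mtimes (HCat X) Z (Fun A B) (mor_of X Z ?H (Fun A B)) A) = f"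
      unfolding mcomp_eval[OF H] f using mhomI[OF H] mor_eqI[OF conv_uncurried_Lam[OF A F]] by blast
  next
    fix h
    assume h: "h \<in> mhom X Z (Fun A B) \<and> mcomp X (mev X A B) (mtimes (HCat X) Z (Fun A B) h A) = f"
    then obtain G where G: "has_type X [Z] G (Fun A B)" and hG: "h = mor_of X Z G (Fun A B)"
      by (metis mhomE)
    have "conv X [Prod Z A] F (uncurried G) B"
      using h mor_eq_iff[OF F has_type_uncurried[OF G]] unfolding hG mcomp_eval[OF G] f by simp
    then have "conv X [Z] ?H (Lam A (sub sw (uncurried G))) (Fun A B)"
      using A by (blast intro: cv_Lam conv_sub wt_sub_sw)
    then have "conv X [Z] G ?H (Fun A B)"
      using conv_Lam_sw_uncurried[OF A G] by (blast intro: cv_sym cv_trans)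
    then show "h = mor_of X Z ?H (Fun A B)" unfolding hG by (rule mor_eqI)
  qed
next
  fix Z A B h h' \<alpha>
  assume A: "A \<in> types X" and "h \<in> mhom X Z (Fun A B)" "h' \<in> mhom X Z (Fun A B)"
    and \<alpha>: "\<alpha> \<in> hcells X (mcomp X (mev X A B) (mtimes (HCat X) Z (Fun A B) h A))
      (mcomp X (mev X A B) (mtimes (HCat X) Z (Fun A B) h' A))"
  then obtain H H' where H: "has_type X [Z] H (Fun A B)" "has_type X [Z] H' (Fun A B)"
    and h: "h = mor_of X Z H (Fun A B)" "h' = mor_of X Z H' (Fun A B)"
    by (metis mhomE)
  obtain Q where Q: "red X [Prod Z A] Q (uncurried H) (uncurried H') B"
    and \<alpha>Q: "\<alpha> = hc (Prod Z A) B (uncurried H) (uncurried H') Q"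
    using \<alpha> unfolding h mcomp_eval[OF H(1)] mcomp_eval[OF H(2)] by (metis hcellsE)
  \<comment> \<open>The transpose is formed as for morphisms. Its raw end points are curried forms
    of \<open>uncurried H\<close> and \<open>uncurried H'\<close>, hence convertible to H and
    H'.\<close>
  let ?P = "RLam A (rsub sw Q)"
  have "red X [Z] ?P (Lam A (sub sw (uncurried H))) (Lam A (sub sw (uncurried H'))) (Fun A B)"
    by (rule rd_Lam[OF A red_rsub[OF Q wt_sub_sw]])
  then have P: "red X [Z] ?P H H' (Fun A B)"
    using conv_Lam_sw_uncurried[OF A] H by (blast intro: rd_conv)
  show "\<exists>!\<beta>. \<beta> \<in> hcells X h h' \<and>
      hhor X (hid X (mev X A B)) (ctimes (HCat X) Z (Fun A B) h h' \<beta> A) = \<alpha>"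
  proof (rule ex1I)
    show "hc Z (Fun A B) H H' ?P \<in> hcells X h h' \<and>
        hhor X (hid X (mev X A B)) (ctimes (HCat X) Z (Fun A B) h h' (hc Z (Fun A B) H H' ?P) A) = \<alpha>"
      unfolding h hhor_eval[OF P] \<alpha>Q using hcellsI[OF P] hc_eqI[OF perm_uncurried_RLam[OF A Q]] by blast
  next
    fix \<beta>
    assume \<beta>: "\<beta> \<in> hcells X h h' \<and>
      hhor X (hid X (mev X A B)) (ctimes (HCat X) Z (Fun A B) h h' \<beta> A) = \<alpha>"
    then obtain R where R: "red X [Z] R H H' (Fun A B)" and \<beta>R: "\<beta> = hc Z (Fun A B) H H' R"
      unfolding h by (metis hcellsE)
    let ?R = "RApp (rsub wk R) (RSnd (RVar 0))"
    have "perm X [Prod Z A] ?R Q (uncurried H) (uncurried H') B"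
      using \<beta> Q unfolding \<beta>R h hhor_eval[OF R] \<alpha>Q by (blast intro: hc_eqD)
    \<comment> \<open>Uniqueness: currying is applied to the equation between uncurried reductions,
      and the \<eta> law recovers R on the left.\<close>
    then have "perm X [Z] (RLam A (rsub sw ?R)) ?P (Lam A (sub sw (uncurried H)))
        (Lam A (sub sw (uncurried H'))) (Fun A B)"
      using A by (blast intro: pm_Lam perm_rsub wt_sub_sw)
    then have "perm X [Z] (RLam A (rsub sw ?R)) ?P H H' (Fun A B)"
      using conv_Lam_sw_uncurried[OF A] H by (blast intro: pm_conv)
    then have "perm X [Z] R ?P H H' (Fun A B)"
      using perm_RLam_uncurried[OF A R] by (blast intro: pm_sym pm_trans)
    then show "\<beta> = hc Z (Fun A B) H H' ?P" unfolding \<beta>R by (rule hc_eqI)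
  qed
qed

end

section \<open>Collapsing 2-cells to a preorder\<close>

context cc_two_category
begin

lemma mtimes_props:
  assumes "Z \<in> obj C" "W \<in> obj C" "A \<in> obj C" "h \<in> hom C Z W"
  shows "mtimes C Z W h A \<in> hom C (prd C Z A) (prd C W A)"
    and "comp C (prj1 C W A) (mtimes C Z W h A) = comp C h (prj1 C Z A)"
    and "comp C (prj2 C W A) (mtimes C Z W h A) = prj2 C Z A"
proof -
  have "comp C h (prj1 C Z A) \<in> hom C (prd C Z A) W"
    using assms comp_hom prd_obj prj1_hom by blast
  then have "\<exists>!k. k \<in> hom C (prd C Z A) (prd C W A) \<and>
      comp C (prj1 C W A) k = comp C h (prj1 C Z A) \<and> comp C (prj2 C W A) k = prj2 C Z A"
    using assms prd_obj prj2_hom by (intro prd_univ) auto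
  from theI'[OF this] show "mtimes C Z W h A \<in> hom C (prd C Z A) (prd C W A)"
    "comp C (prj1 C W A) (mtimes C Z W h A) = comp C h (prj1 C Z A)"
    "comp C (prj2 C W A) (mtimes C Z W h A) = prj2 C Z A"
    unfolding mtimes_def by blast+
qed

text \<open>The whiskered \<beta> and the identity on the second projection pair up to a 2-cell.
  Only its existence matters for the collapse.\<close>

lemma cell_mtimes_nonempty:
  assumes o: "Z \<in> obj C" "W \<in> obj C" "A \<in> obj C" and h: "h \<in> hom C Z W" "h' \<in> hom C Z W"
    and \<beta>: "\<beta> \<in> cell C h h'"
  shows "cell C (mtimes C Z W h A) (mtimes C Z W h' A) \<noteq> {}"
proof -
  note m = mtimes_props[OF o h(1)] and m' = mtimes_props[OF o h(2)]
  have p: "prj1 C Z A \<in> hom C (prd C Z A) Z" "prj2 C Z A \<in> hom C (prd C Z A) A" "prd C Z A \<in> obj C"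
    using o prj1_hom prj2_hom prd_obj by blast+
  have "hcomp C \<beta> (idc C (prj1 C Z A)) \<in> cell C (comp C h (prj1 C Z A)) (comp C h' (prj1 C Z A))"
    by (rule hcomp_cell[OF p(3) o(1,2) p(1) p(1) h idc_cell[OF p(3) o(1) p(1)] \<beta>])
  moreover have "idc C (prj2 C Z A) \<in> cell C (prj2 C Z A) (prj2 C Z A)"
    by (rule idc_cell[OF p(3) o(3) p(2)])
  ultimately show ?thesis
    using prd_univ2[OF p(3) o(2,3) m(1) m'(1)] unfolding m(2,3) m'(2,3) by blast
qed

end

text \<open>A 2-cell of D records only that C has one between the same morphisms. Parallel 2-cells
  of D are therefore equal, and each existence claim reduces to a cell set of C being inhabited,
  which the corresponding operation or universal property of C provides.\<close>

lemma cc_two_category_collapse: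
  fixes C :: "('a, 'm, 'c) cc2" and D :: "('a, 'm, 'm \<times> 'm) cc2"
  assumes "cc_two_category C"
    and eqs: "obj D = obj C" "hom D = hom C" "idm D = idm C" "comp D = comp C"
      "one D = one C" "prd D = prd C" "prj1 D = prj1 C" "prj2 D = prj2 C" "expo D = expo C" "evl D = evl C"
      "idc D = (\<lambda>f. (f, f))" "vcomp D = (\<lambda>\<alpha> \<beta>. (fst \<alpha>, snd \<beta>))"
      "hcomp D = (\<lambda>\<beta> \<alpha>. (comp C (fst \<beta>) (fst \<alpha>), comp C (snd \<beta>) (snd \<alpha>)))"
    and cell_D: "\<And>A B f g. \<lbrakk>A \<in> obj C; B \<in> obj C; f \<in> hom C A B; g \<in> hom C A B\<rbrakk>
      \<Longrightarrow> cell D f g = (if cell C f g = {} then {} else {(f, g)})"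
  shows "cc_two_category D"
proof -
  interpret C: cc_two_category C by fact
  have cell: "\<alpha> \<in> cell D f g \<longleftrightarrow> cell C f g \<noteq> {} \<and> \<alpha> = (f, g)"
    if "A \<in> obj C" "B \<in> obj C" "f \<in> hom C A B" "g \<in> hom C A B" for A B f g \<alpha>
    using cell_D[OF that] by auto
  have mt: "mtimes D = mtimes C"
    by (simp add: fun_eq_iff mtimes_def eqs)
  \<comment> \<open>There is only one candidate for the description, and its projection equations
    become those defining \<open>mtimes\<close>.\<close>
  have ct: "ctimes D Z W h h' (h, h') A = (mtimes C Z W h A, mtimes C Z W h' A)"
    if o: "Z \<in> obj C" "W \<in> obj C" "A \<in> obj C" and h: "h \<in> hom C Z W" "h' \<in> hom C Z W"
      and ne: "cell C h h' \<noteq> {}" for Z W h h' A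
  proof -
    note m = C.mtimes_props[OF o h(1)] and m' = C.mtimes_props[OF o h(2)]
    have c: "\<gamma> \<in> cell D (mtimes C Z W h A) (mtimes C Z W h' A) \<longleftrightarrow>
        \<gamma> = (mtimes C Z W h A, mtimes C Z W h' A)" for \<gamma>
      using cell[OF _ _ m(1) m'(1)] C.cell_mtimes_nonempty[OF o h] ne C.prd_obj o by blast
    show ?thesis
      unfolding ctimes_def mt c eqs by (rule the_equality) (simp_all add: m m')
  qed
  show ?thesis
  proof (unfold_locales, unfold eqs mt)
    fix A B f
    assume "A \<in> obj C" "B \<in> obj C" "f \<in> hom C A B"
    then show "(f, f) \<in> cell D f f" using C.idc_cell by (auto simp: cell)
  next
    fix A B f g h \<alpha> \<beta>
    assume o: "A \<in> obj C" "B \<in> obj C" and h: "f \<in> hom C A B" "g \<in> hom C A B" "h \<in> hom C A B"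
      and "\<alpha> \<in> cell D f g" "\<beta> \<in> cell D g h"
    then show "(fst \<alpha>, snd \<beta>) \<in> cell D f h"
      using C.vcomp_cell[OF o h] by (auto simp: cell[OF o])
  next
    fix A B E f f' g g' \<alpha> \<beta>
    assume o: "A \<in> obj C" "B \<in> obj C" "E \<in> obj C"
      and h: "f \<in> hom C A B" "f' \<in> hom C A B" "g \<in> hom C B E" "g' \<in> hom C B E"
      and "\<alpha> \<in> cell D f f'" "\<beta> \<in> cell D g g'"
    moreover have "comp C g f \<in> hom C A E" "comp C g' f' \<in> hom C A E"
      using o h C.comp_hom by blast+
    ultimately show "(comp C (fst \<beta>) (fst \<alpha>), comp C (snd \<beta>) (snd \<alpha>)) \<in> cell D (comp C g f) (comp C g' f')"
      using C.hcomp_cell[OF o h] by (auto simp: cell[OF o(1,2)] cell[OF o(2,3)] cell[OF o(1,3)])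
  next
    fix Z f f'
    assume "Z \<in> obj C" "f \<in> hom C Z (one C)" "f' \<in> hom C Z (one C)"
    then show "\<exists>!\<alpha>. \<alpha> \<in> cell D f f'"
      using C.one_univ2[of Z f f'] C.one_obj by (auto simp: cell)
  next
    fix Z A B h h' \<alpha> \<beta>
    assume o: "Z \<in> obj C" "A \<in> obj C" "B \<in> obj C"
      and h: "h \<in> hom C Z (prd C A B)" "h' \<in> hom C Z (prd C A B)"
      and \<alpha>: "\<alpha> \<in> cell D (comp C (prj1 C A B) h) (comp C (prj1 C A B) h')"
      and \<beta>: "\<beta> \<in> cell D (comp C (prj2 C A B) h) (comp C (prj2 C A B) h')"
    have p: "prd C A B \<in> obj C" using o C.prd_obj by blast
    have c1: "comp C (prj1 C A B) h \<in> hom C Z A" "comp C (prj1 C A B) h' \<in> hom C Z A"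
      and c2: "comp C (prj2 C A B) h \<in> hom C Z B" "comp C (prj2 C A B) h' \<in> hom C Z B"
      using o h p C.comp_hom C.prj1_hom C.prj2_hom by blast+
    have ne: "cell C h h' \<noteq> {}"
      using \<alpha> \<beta> C.prd_univ2[OF o h] unfolding cell[OF o(1,2) c1] cell[OF o(1,3) c2] by blast
    show "\<exists>!\<gamma>. \<gamma> \<in> cell D h h' \<and>
        (comp C (fst (prj1 C A B, prj1 C A B)) (fst \<gamma>), comp C (snd (prj1 C A B, prj1 C A B)) (snd \<gamma>)) = \<alpha> \<and>
        (comp C (fst (prj2 C A B, prj2 C A B)) (fst \<gamma>), comp C (snd (prj2 C A B, prj2 C A B)) (snd \<gamma>)) = \<beta>"
      using \<alpha> \<beta> ne unfolding cell[OF o(1,2) c1] cell[OF o(1,3) c2] cell[OF o(1) p h] by auto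
  next
    fix Z A B h h' \<alpha>
    assume o: "Z \<in> obj C" "A \<in> obj C" "B \<in> obj C"
      and h: "h \<in> hom C Z (expo C A B)" "h' \<in> hom C Z (expo C A B)"
      and \<alpha>: "\<alpha> \<in> cell D (comp C (evl C A B) (mtimes C Z (expo C A B) h A))
        (comp C (evl C A B) (mtimes C Z (expo C A B) h' A))"
    have p: "prd C Z A \<in> obj C" "expo C A B \<in> obj C" "prd C (expo C A B) A \<in> obj C"
      using o C.prd_obj C.expo_obj by blast+
    have e: "comp C (evl C A B) (mtimes C Z (expo C A B) h A) \<in> hom C (prd C Z A) B"
      "comp C (evl C A B) (mtimes C Z (expo C A B) h' A) \<in> hom C (prd C Z A) B"
      using C.comp_hom[OF p(1,3) o(3) C.mtimes_props(1)[OF o(1) p(2) o(2)] C.evl_hom[OF o(2,3)]] h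
      by blast+
    \<comment> \<open>Transposition in C turns a 2-cell between the uncurried morphisms into one
      between h and h'; no other property of it is used.\<close>
    have ne: "cell C h h' \<noteq> {}"
      using \<alpha> C.expo_univ2[OF o h] unfolding cell[OF p(1) o(3) e] by blast
    show "\<exists>!\<beta>. \<beta> \<in> cell D h h' \<and>
        (comp C (fst (evl C A B, evl C A B)) (fst (ctimes D Z (expo C A B) h h' \<beta> A)),
         comp C (snd (evl C A B, evl C A B)) (snd (ctimes D Z (expo C A B) h h' \<beta> A))) = \<alpha>"
      using \<alpha> ne ct[OF o(1) p(2) o(2) h ne] unfolding cell[OF p(1) o(3) e] cell[OF o(1) p(2) h]
      by auto
  \<comment> \<open>The 1-dimensional laws are those of C. The remaining 2-dimensional equations
    compare pairs of end points and follow from the laws of \<open>comp\<close>.\<close>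
  qed (use C.idm_hom C.comp_hom C.comp_idl C.comp_idr C.comp_assoc C.one_obj C.prd_obj C.prj1_hom
      C.prj2_hom C.expo_obj C.evl_hom C.one_univ C.prd_univ C.expo_univ cell C.idm_hom in \<open>auto\<close>)
qed

section \<open>The comparison 2-functor\<close>

context wf_two_sig
begin

lemma RCat_simps [simp]:
  "obj (RCat X) = types X" "hom (RCat X) = mhom X" "cell (RCat X) = rcells X"
  "idm (RCat X) = (\<lambda>A. mor_of X A (Var 0) A)" "comp (RCat X) = mcomp X"
  "idc (RCat X) = (\<lambda>f. (f, f))" "vcomp (RCat X) = (\<lambda>\<alpha> \<beta>. (fst \<alpha>, snd \<beta>))"
  "hcomp (RCat X) = (\<lambda>\<beta> \<alpha>. (mcomp X (fst \<beta>) (fst \<alpha>), mcomp X (snd \<beta>) (snd \<alpha>)))"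
  "one (RCat X) = One" "prd (RCat X) = Prod"
  "prj1 (RCat X) = (\<lambda>A B. mor_of X (Prod A B) (Fst (Var 0)) A)"
  "prj2 (RCat X) = (\<lambda>A B. mor_of X (Prod A B) (Snd (Var 0)) B)"
  "expo (RCat X) = Fun" "evl (RCat X) = mev X"
  by (simp_all add: RCat_def)

text \<open>Here rewriting meets reductions: by \<open>rew_rel_iff_red\<close>, reachability of
  classes is inhabitedness of the set of 2-cells of H(X), which is the form the collapse
  requires.\<close>

lemma rcells_eq:
  assumes "f \<in> mhom X A B" "g \<in> mhom X A B"
  shows "rcells X f g = (if hcells X f g = {} then {} else {(f, g)})"
proof -
  obtain M N where M: "has_type X [A] M B" "has_type X [A] N B"
    and f: "f = mor_of X A M B" "g = mor_of X A N B"
    using assms by (metis mhomE)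
  have "hcells X f g \<noteq> {} \<longleftrightarrow> (\<exists>P. red X [A] P M N B)"
    unfolding f using hcellsI hcellsE by (metis ex_in_conv)
  then show ?thesis
    using rew_rel_iff_red[OF M] by (auto simp: f mor_of_def)
qed

lemma RCat_cc_two_category: "cc_two_category (RCat X)"
  by (rule cc_two_category_collapse[OF HCat_cc_two_category]) (simp_all add: rcells_eq)

abbreviation ends :: "('s, 'o, 'r) hcell \<Rightarrow> ('s, 'o) rcell" where
  "ends \<alpha> \<equiv> (fst \<alpha>, snd (snd \<alpha>))"

lemma ends_hcell: "\<alpha> \<in> hcells X f g \<Longrightarrow> ends \<alpha> = (f, g)"
  by (cases f; cases g) auto

text \<open>One inclusion makes \<open>ends\<close> act on 2-cells, the other is local
  fullness.\<close>

lemma ends_hcells: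
  assumes "f \<in> mhom X A B" "g \<in> mhom X A B"
  shows "ends ` hcells X f g = rcells X f g"
  using rcells_eq[OF assms] ends_hcell by (auto simp: image_iff)

text \<open>2-cells of R(X) are pairs of end points, so preservation of identities and of both
  compositions follows from the source and target of these operations in H(X).\<close>

lemma ends_cc_two_functor: "cc_two_functor (HCat X) (RCat X) (\<lambda>A. A) (\<lambda>f. f) ends"
proof -
  interpret H: cc_two_category "HCat X" by (rule HCat_cc_two_category)
  interpret R: cc_two_category "RCat X" by (rule RCat_cc_two_category)
  show ?thesis
  proof (unfold_locales, unfold HCat_simps RCat_simps)
    fix A B f g \<alpha>
    assume "f \<in> mhom X A B" "g \<in> mhom X A B" "\<alpha> \<in> hcells X f g"
    then show "ends \<alpha> \<in> rcells X f g" using ends_hcells by blast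
  next
    fix A B f
    assume "A \<in> types X" "B \<in> types X" "f \<in> mhom X A B"
    then show "ends (hid X f) = (f, f)"
      using H.idc_cell[of A B f] ends_hcell by simp
  next
    fix A B f g h \<alpha> \<beta>
    assume *: "A \<in> types X" "B \<in> types X" "f \<in> mhom X A B" "g \<in> mhom X A B" "h \<in> mhom X A B"
      "\<alpha> \<in> hcells X f g" "\<beta> \<in> hcells X g h"
    then have "hvert X \<alpha> \<beta> \<in> hcells X f h"
      using H.vcomp_cell[of A B f g h \<alpha> \<beta>] by simp
    then show "ends (hvert X \<alpha> \<beta>) = (fst (ends \<alpha>), snd (ends \<beta>))"
      using * ends_hcell by (metis fst_conv snd_conv)
  next
    fix A B E f f' g g' \<alpha> \<beta>
    assume *: "A \<in> types X" "B \<in> types X" "E \<in> types X"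
      "f \<in> mhom X A B" "f' \<in> mhom X A B" "g \<in> mhom X B E" "g' \<in> mhom X B E"
      "\<alpha> \<in> hcells X f f'" "\<beta> \<in> hcells X g g'"
    then have "hhor X \<beta> \<alpha> \<in> hcells X (mcomp X g f) (mcomp X g' f')"
      using H.hcomp_cell[of A B E f f' g g' \<alpha> \<beta>] by simp
    then show "ends (hhor X \<beta> \<alpha>) =
        (mcomp X (fst (ends \<beta>)) (fst (ends \<alpha>)), mcomp X (snd (ends \<beta>)) (snd (ends \<alpha>)))"
      using * ends_hcell by (metis fst_conv snd_conv)
  qed auto
qed

end

theorem theorem4p2:
  fixes X :: "('s, 'o, 'r) two_sig"
  assumes "hors X"
  shows "\<exists>F0 F1 F2.
    cc_two_functor (HCat X) (RCat X) F0 F1 F2 \<and>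
    (\<forall>A \<in> obj (HCat X). F0 A = A) \<and>
    (\<forall>A \<in> obj (HCat X). \<forall>B \<in> obj (HCat X). \<forall>f \<in> hom (HCat X) A B. F1 f = f) \<and>
    locally_full (HCat X) (RCat X) F1 F2"
proof -
  interpret wf_two_sig X
    using assms by unfold_locales (simp add: hors_def)
  have "locally_full (HCat X) (RCat X) (\<lambda>f. f) ends"
    unfolding locally_full_def HCat_simps RCat_simps using ends_hcells by blast
  then show ?thesis using ends_cc_two_functor by blast
qed

end
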